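(* Let $n,d$ be natural numbers with $1\le d\le n$, let $\lambda\in[0,1]$, and let $\mathcal D_\lambda:S_1^n\to S_1^n$, $\mathcal D_\lambda(\rho)=\lambda\rho+(1-\lambda)\frac1n\mathrm{tr}(\rho)\mathbf 1_n$, be the quantum depolarizing channel and $\mathcal E_\lambda:S_1^n\to S_1^n\oplus_1\mathbb C$, $\mathcal E_\lambda(\rho)=\lambda\rho\oplus(1-\lambda)\mathrm{tr}(\rho)$, the quantum erasure channel with parameter $\lambda$. Then $$\lambda\log_2(nd)-H(\mu)\le C^d_{prod}(\mathcal D_\lambda)\le C^d(\mathcal D_\lambda)\le\lambda\log_2(nd),$$ where $H(\mu)=-\mu\log_2(\mu)-(1-\mu)\log_2(1-\mu)$ is the Shannon entropy of the probability distribution $(\mu,1-\mu)$ with $\mu=\lambda+\frac{1-\lambda}{nd}$. In particular, $\lambda\log_2(nd)-1\le C^d_{prod}(\mathcal D_\lambda)$. On the other hand, for every natural number $k\ge1$, $$C^{d^k}_{prod}(\mathcal E_\lambda^{\otimes k})=k\,C^d_{prod}(\mathcal E_\lambda)=k\lambda\log_2(nd).$$ Hence $C^d(\mathcal E_\lambda)=\lambda\log_2(nd)$.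
   Context: $\mathbf 1_n$ is the identity of $M_n$; $S_1^n$ is $M_n$ with the trace norm. A quantum channel $\mathcal N:S_1^n\to S_1^m$ is a completely positive trace preserving map $M_n\to M_m$; direct sums $S_1^{n_1}\oplus_1\cdots\oplus_1S_1^{n_m}$ are regarded as block-diagonal in $S_1^{n_1+\cdots+n_m}$. A state is a positive semidefinite matrix of trace one; $S(\rho)=-\mathrm{tr}(\rho\log_2\rho)$ (with $0\log_20=0$). For a natural number $d$, the product state classical capacity with assisted entanglement restricted to dimension $d$ is $$C^d_{prod}(\mathcal N)=\sup\Big\{S\Big(\sum_{i=1}^N\lambda_i\,\mathcal N\big((\mathrm{tr}_d\otimes \mathrm{id}_n)(\rho_i)\big)\Big)+\sum_{i=1}^N\lambda_i\Big[S\big((\mathrm{id}_d\otimes \mathrm{tr}_n)(\rho_i)\big)-S\big((\mathrm{id}_d\otimes\mathcal N)(\rho_i)\big)\Big]\Big\},$$ the supremum over all $N\in\mathbb N$, probability distributions $(\lambda_i)_{i=1}^N$ and states $\rho_i\in S_1^d\otimes S_1^n$ (with $\mathrm{tr}_k$ the trace on $M_k$). Its regularization is $$C^d(\mathcal N)=\sup_{k\ge1}\frac{C^{d^k}_{prod}(\mathcal N^{\otimes k})}{k}.$$ *)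

theory Defs
  imports "HOL-Library.Extended_Real" "Jordan_Normal_Form.Schur_Decomposition"
begin

definition mat_trace :: "complex mat \<Rightarrow> complex" where
  "mat_trace A = (\<Sum>i<dim_row A. A $$ (i, i))"

(* On complex numbers, 0 \<le> z includes that z is real, so A is Hermitian. *)
definition pos_semidef :: "nat \<Rightarrow> complex mat \<Rightarrow> bool" where
  "pos_semidef n A \<longleftrightarrow>
     A \<in> carrier_mat n n \<and> (\<forall>v \<in> carrier_vec n. 0 \<le> (A *\<^sub>v v) \<bullet>c v)"

definition state :: "nat \<Rightarrow> complex mat \<Rightarrow> bool" where
  "state n \<rho> \<longleftrightarrow> pos_semidef n \<rho> \<and> mat_trace \<rho> = 1"

definition unitary_mat :: "nat \<Rightarrow> complex mat \<Rightarrow> bool" where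
  "unitary_mat n U \<longleftrightarrow> U \<in> carrier_mat n n \<and> mat_adjoint U * U = 1\<^sub>m n"

(* Functional calculus f(A) for a Hermitian matrix A and a real function f. For such A a
   diagonalization exists and the resulting B does not depend on it, so the choice operator
   merely names that B. *)
definition mat_fun :: "(real \<Rightarrow> real) \<Rightarrow> complex mat \<Rightarrow> complex mat" where
  "mat_fun f A = (SOME B. \<exists>U e. unitary_mat (dim_row A) U \<and>
     A = U * mat_diag (dim_row A) (\<lambda>i. complex_of_real (e i)) * mat_adjoint U \<and>
     B = U * mat_diag (dim_row A) (\<lambda>i. complex_of_real (f (e i))) * mat_adjoint U)"

(* The convention 0 log 0 = 0 is automatic: log 2 is a total function on the reals, so a zero
   eigenvalue contributes 0 * log 2 0 = 0. *)
definition entropy :: "complex mat \<Rightarrow> real" where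
  "entropy \<rho> = - Re (mat_trace (\<rho> * mat_fun (log 2) \<rho>))"

definition bin_entropy :: "real \<Rightarrow> real" where
  "bin_entropy \<mu> = - \<mu> * log 2 \<mu> - (1 - \<mu>) * log 2 (1 - \<mu>)"

(* A linear map from M_(dim_in) to M_(dim_out). The function is only meaningful on the
   matrices in carrier_mat dim_in dim_in. *)
datatype superop =
  Superop (dim_in: nat) (dim_out: nat) (app: "complex mat \<Rightarrow> complex mat")

definition id_op :: "nat \<Rightarrow> superop" where
  "id_op n = Superop n n (\<lambda>X. X)"

(* The trace as a map from M_n to M_1 = C; M_a tensor M_1 and M_1 tensor M_a are M_a. *)
definition trace_op :: "nat \<Rightarrow> superop" where
  "trace_op n = Superop n 1 (\<lambda>X. mat 1 1 (\<lambda>_. mat_trace X))"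

definition mat_unit :: "nat \<Rightarrow> nat \<Rightarrow> nat \<Rightarrow> complex mat" where
  "mat_unit n i j = mat n n (\<lambda>(r, s). if r = i \<and> s = j then 1 else 0)"

(* M_a tensor M_b is identified with M_(a*b) by the Kronecker product, i.e. the basis vector
   e_i tensor e_k has index i * b + k. The tensor product of linear maps is the linear map with
     E_ij tensor E_kl  |->  F(E_ij) tensor G(E_kl),
   written here in terms of matrix entries. *)
definition tensor_op :: "superop \<Rightarrow> superop \<Rightarrow> superop" (infixr "\<otimes>\<^sub>o" 70) where
  "F \<otimes>\<^sub>o G = Superop (dim_in F * dim_in G) (dim_out F * dim_out G)
     (\<lambda>X. mat (dim_out F * dim_out G) (dim_out F * dim_out G) (\<lambda>(r, s).
        \<Sum>i<dim_in F. \<Sum>j<dim_in F. \<Sum>k<dim_in G. \<Sum>l<dim_in G.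
          X $$ (i * dim_in G + k, j * dim_in G + l)
          * app F (mat_unit (dim_in F) i j) $$ (r div dim_out G, s div dim_out G)
          * app G (mat_unit (dim_in G) k l) $$ (r mod dim_out G, s mod dim_out G)))"

primrec tensor_power :: "superop \<Rightarrow> nat \<Rightarrow> superop" where
  "tensor_power F 0 = id_op 1"
| "tensor_power F (Suc k) = tensor_power F k \<otimes>\<^sub>o F"

definition mixture :: "nat \<Rightarrow> nat \<Rightarrow> (nat \<Rightarrow> real) \<Rightarrow> (nat \<Rightarrow> complex mat) \<Rightarrow> complex mat" where
  "mixture m N p A = mat m m (\<lambda>rs. \<Sum>i<N. complex_of_real (p i) * A i $$ rs)"

definition prob_dist :: "nat \<Rightarrow> (nat \<Rightarrow> real) \<Rightarrow> bool" where
  "prob_dist N p \<longleftrightarrow> (\<forall>i<N. 0 \<le> p i) \<and> (\<Sum>i<N. p i) = 1"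

definition ensemble_value ::
  "nat \<Rightarrow> superop \<Rightarrow> nat \<Rightarrow> (nat \<Rightarrow> real) \<Rightarrow> (nat \<Rightarrow> complex mat) \<Rightarrow> real" where
  "ensemble_value d \<N> N p \<rho> =
     entropy (mixture (dim_out \<N>) N p
       (\<lambda>i. app \<N> (app (trace_op d \<otimes>\<^sub>o id_op (dim_in \<N>)) (\<rho> i))))
     + (\<Sum>i<N. p i * (entropy (app (id_op d \<otimes>\<^sub>o trace_op (dim_in \<N>)) (\<rho> i))
                    - entropy (app (id_op d \<otimes>\<^sub>o \<N>) (\<rho> i))))"

(* Suprema are taken in the extended reals, so that they are the true suprema whether or not
   the set is bounded. *)
definition C_prod :: "nat \<Rightarrow> superop \<Rightarrow> ereal" where
  "C_prod d \<N> = Sup {ereal (ensemble_value d \<N> N p \<rho>) | N p \<rho>.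
     prob_dist N p \<and> (\<forall>i<N. state (d * dim_in \<N>) (\<rho> i))}"

definition C_reg :: "nat \<Rightarrow> superop \<Rightarrow> ereal" where
  "C_reg d \<N> = (SUP k\<in>{1..}. C_prod (d ^ k) (tensor_power \<N> k) / ereal (real k))"

definition depolarizing :: "nat \<Rightarrow> real \<Rightarrow> superop" where
  "depolarizing n q = Superop n n (\<lambda>X.
     complex_of_real q \<cdot>\<^sub>m X
     + (complex_of_real ((1 - q) * (1 / real n)) * mat_trace X) \<cdot>\<^sub>m 1\<^sub>m n)"

(* The codomain, the direct sum of M_n and C, sits block-diagonally in M_(n+1). *)
definition erasure :: "nat \<Rightarrow> real \<Rightarrow> superop" where
  "erasure n q = Superop n (n + 1) (\<lambda>X.
     four_block_mat (complex_of_real q \<cdot>\<^sub>m X) (0\<^sub>m n 1) (0\<^sub>m 1 n)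
       (mat 1 1 (\<lambda>_. complex_of_real (1 - q) * mat_trace X)))"

end

theory Submission
  imports Defs
begin

text \<open>
  Write \<open>S\<close> for the entropy, \<open>R\<close> for the assistance system and \<open>q\<close> for the channel parameter. Both
  channels either let the input through (with probability \<open>q\<close>) or lose it, the depolarizing channel
  without telling which. Whatever happens, the output satisfies
    \<open>S(output) \<ge> q S(input) + (1 - q) S(what is left when the input is lost) + c\<close>,
  where \<open>c\<close> is the entropy made by the noise: the entropy of the flag for erasure (with equality),
  and \<open>(1 - q) log n\<close> for depolarizing, by concavity. This estimate is called \<open>noisy\<close> below.
  It yields the upper bounds at once: with \<open>S(output) \<le> u\<close> for the channel output alone, an ensemble
  has value at most \<open>u - c + q log d\<close>, because \<open>S(R) \<le> log d\<close> and \<open>S(input) \<ge> 0\<close>; and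
  \<open>u - c = q log n\<close> in both cases.

  The point is that the estimate survives tensor products with additive \<open>c\<close>. Applying it to the two
  factors in turn produces the entropies of the joint system with neither, one or both inputs lost.
  Strong subadditivity trades the two mixed terms for the two extreme ones, which restores the same
  form (\<open>noisy_tensor\<close>). The bound \<open>u\<close> adds up by ordinary subadditivity. So the regularized
  capacity obeys the one-shot bound.

  Strong subadditivity is proved from monotonicity of the relative entropy under partial trace
  (\<open>rel_entropy_ptr_mono\<close>). For eigenvalues \<open>a\<close>, \<open>b\<close> of the two matrices \<open>A\<close>, \<open>B\<close>, the scalar
  \<open>a ln (a / b) - a + b\<close> is the increment over \<open>[0, 1]\<close> of a function of \<open>t\<close> with derivative
  \<open>(1 - t) (a - b)\<^sup>2 / (t a + (1 - t) b)\<close>. Weighted by the squared eigenvector overlaps and summed,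
  the quotient becomes the maximum over matrices \<open>Y\<close> of
    \<open>2 Re tr (A - B) Y\<^sup>* - t tr A Y Y\<^sup>* - (1 - t) tr B Y\<^sup>* Y\<close>,
  and a maximizer for the reduced matrices, tensored with the identity, competes for the full ones.

  For the lower bounds, take the \<open>n\<close> cyclic shifts of a maximally entangled state between \<open>R\<close> and
  \<open>d\<close> levels of the input, with equal weights. The averaged input is maximally mixed, \<open>S(R) = log d\<close>
  and the states are pure, so that all spectra are explicit. For erasure the value is exactly
  \<open>q log (n d)\<close>, and product ensembles carry it to all tensor powers (\<open>achievable_tensor\<close>).

  Entropies are always computed from an orthonormal family that diagonalizes the matrix, indexed by
  whatever set is natural (\<open>entropy_eigenfamily\<close>).\<close>

section \<open>Adjoints, traces and unitary matrices\<close>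

lemma adjoint_carrier [simp]: "A \<in> carrier_mat n m \<Longrightarrow> mat_adjoint A \<in> carrier_mat m n"
  unfolding mat_adjoint_def by auto

lemma dim_adjoint [simp]:
  "dim_row (mat_adjoint A) = dim_col A" "dim_col (mat_adjoint A) = dim_row A"
  unfolding mat_adjoint_def by auto

lemma index_adjoint [simp]:
  fixes A :: "complex mat"
  assumes "i < dim_col A" "j < dim_row A"
  shows "mat_adjoint A $$ (i, j) = cnj (A $$ (j, i))"
  using assms unfolding mat_adjoint_def by (auto simp: mat_of_rows_def)

lemma adjoint_adjoint [simp]: "mat_adjoint (mat_adjoint A) = (A :: complex mat)"
  by (rule eq_matI) auto

declare index_mult_mat(1) [simp del]

lemma mult_carrier_square [simp]:
  "A \<in> carrier_mat n n \<Longrightarrow> B \<in> carrier_mat n n \<Longrightarrow> A * B \<in> carrier_mat n n"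
  by simp

lemma adjoint_one [simp]: "mat_adjoint (1\<^sub>m n) = (1\<^sub>m n :: complex mat)"
  by (rule eq_matI) auto

lemma index_mult:
  assumes "A \<in> carrier_mat n k" "B \<in> carrier_mat k m" "i < n" "j < m"
  shows "(A * B) $$ (i, j) = (\<Sum>l<k. A $$ (i, l) * B $$ (l, j))"
  using assms by (auto simp: index_mult_mat(1) scalar_prod_def atLeast0LessThan)

lemma adjoint_mult:
  fixes A B :: "complex mat"
  assumes "A \<in> carrier_mat n k" "B \<in> carrier_mat k m"
  shows "mat_adjoint (A * B) = mat_adjoint B * mat_adjoint A"
proof (rule eq_matI)
  fix i j assume ij: "i < dim_row (mat_adjoint B * mat_adjoint A)" "j < dim_col (mat_adjoint B * mat_adjoint A)"
  then have i: "i < m" and j: "j < n" using assms by auto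
  have "mat_adjoint (A * B) $$ (i, j) = cnj ((A * B) $$ (j, i))"
    using assms i j by (subst index_adjoint) auto
  also have "\<dots> = (\<Sum>l<k. cnj (A $$ (j, l)) * cnj (B $$ (l, i)))"
    using assms i j by (simp add: index_mult[OF assms j i])
  also have "\<dots> = (\<Sum>l<k. mat_adjoint B $$ (i, l) * mat_adjoint A $$ (l, j))"
    using assms i j by (intro sum.cong) auto
  also have "\<dots> = (mat_adjoint B * mat_adjoint A) $$ (i, j)"
    using assms i j by (subst index_mult[of _ m k _ n]) auto
  finally show "mat_adjoint (A * B) $$ (i, j) = (mat_adjoint B * mat_adjoint A) $$ (i, j)" .
qed (use assms in auto)

lemma trace_mult:
  assumes "A \<in> carrier_mat n m" "B \<in> carrier_mat m n"
  shows "mat_trace (A * B) = (\<Sum>i<n. \<Sum>j<m. A $$ (i, j) * B $$ (j, i))"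
  unfolding mat_trace_def using assms by (auto intro!: sum.cong simp: index_mult[OF assms])

lemma trace_comm:
  assumes "A \<in> carrier_mat n m" "B \<in> carrier_mat m n"
  shows "mat_trace (A * B) = mat_trace (B * A)"
  unfolding trace_mult[OF assms] trace_mult[OF assms(2,1)]
  by (subst sum.swap) (simp add: mult.commute)

lemma unitary_left: "unitary_mat n U \<Longrightarrow> mat_adjoint U * U = 1\<^sub>m n"
  by (simp add: unitary_mat_def)

lemma unitary_right: "unitary_mat n U \<Longrightarrow> U * mat_adjoint U = 1\<^sub>m n"
  using mat_mult_left_right_inverse[of "mat_adjoint U" n U] by (auto simp: unitary_mat_def)

lemma unitary_adjoint: "unitary_mat n U \<Longrightarrow> unitary_mat n (mat_adjoint U)"
  using unitary_right[of n U] by (auto simp: unitary_mat_def)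

lemma unitary_mult:
  assumes "unitary_mat n U" "unitary_mat n V"
  shows "unitary_mat n (U * V)"
proof -
  have c: "U \<in> carrier_mat n n" "V \<in> carrier_mat n n" using assms by (auto simp: unitary_mat_def)
  have "mat_adjoint (U * V) * (U * V) = mat_adjoint V * (mat_adjoint U * U) * V"
    using c by (simp add: adjoint_mult[of _ n n _ n] assoc_mult_mat[of _ n n _ n _ n])
  then show ?thesis using assms c by (auto simp: unitary_mat_def)
qed

lemma unitary_cols:
  assumes "unitary_mat n U" "k < n" "l < n"
  shows "(\<Sum>i<n. cnj (U $$ (i, k)) * U $$ (i, l)) = (if k = l then 1 else 0)"
proof -
  have U: "U \<in> carrier_mat n n" using assms by (simp add: unitary_mat_def)
  have "(mat_adjoint U * U) $$ (k, l) = (if k = l then 1 else 0)"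
    using assms unitary_left[of n U] by auto
  then show ?thesis
    using U assms by (simp add: index_mult[of _ n n _ n])
qed

lemma unitary_rows:
  assumes "unitary_mat n U" "k < n" "l < n"
  shows "(\<Sum>i<n. U $$ (k, i) * cnj (U $$ (l, i))) = (if k = l then 1 else 0)"
proof -
  have U: "U \<in> carrier_mat n n" using assms by (simp add: unitary_mat_def)
  have "(U * mat_adjoint U) $$ (k, l) = (if k = l then 1 else 0)"
    using assms unitary_right[of n U] by auto
  then show ?thesis
    using U assms by (simp add: index_mult[of _ n n _ n])
qed

lemma sum_rotate:
  "(\<Sum>y\<in>A. \<Sum>i\<in>B. \<Sum>j\<in>C. f y i j) = (\<Sum>i\<in>B. \<Sum>j\<in>C. \<Sum>y\<in>A. f y i j)"
  by (subst sum.swap, rule sum.cong[OF refl], rule sum.swap)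

section \<open>The spectral theorem\<close>

definition diagonalizes :: "nat \<Rightarrow> complex mat \<Rightarrow> complex mat \<Rightarrow> (nat \<Rightarrow> real) \<Rightarrow> bool" where
  "diagonalizes n A U e \<longleftrightarrow> unitary_mat n U \<and>
     A = U * mat_diag n (\<lambda>i. complex_of_real (e i)) * mat_adjoint U"

text \<open>
  Complete \<open>v\<close> to a basis, apply Gram-Schmidt, which keeps the first vector, and normalize.\<close>

lemma unitary_with_first_column:
  fixes v :: "complex vec"
  assumes v: "v \<in> carrier_vec n" and v0: "v \<noteq> 0\<^sub>v n"
  shows "\<exists>W c. unitary_mat n W \<and> c \<noteq> 0 \<and> col W 0 = c \<cdot>\<^sub>v v"
proof -
  interpret cof_vec_space n "TYPE(complex)" .
  have n: "n > 0" using v v0 by (cases n) auto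
  define b where "b = basis_completion v"
  from basis_completion[OF v v0, folded b_def]
  have dist_b: "distinct b" and indep: "\<not> lin_dep (set b)" and b: "set b \<subseteq> carrier_vec n"
    and hdb: "hd b = v" and len_b: "length b = n" by auto
  from hdb len_b n obtain vs where bv: "b = v # vs" by (cases b, auto)
  define ws where "ws = gram_schmidt n b"
  from gram_schmidt_result[OF b dist_b indep refl, folded ws_def]
  have ws: "set ws \<subseteq> carrier_vec n" "corthogonal ws" "length ws = n"
    by (auto simp: len_b)
  from gram_schmidt_hd[OF v, of vs, folded bv] have hdws: "hd ws = v" unfolding ws_def .
  define nn where "nn w = (1 / sqrt (Re (w \<bullet>c w)))" for w :: "complex vec"
  have pos: "ws ! i \<bullet>c ws ! i > 0" if "i < n" for i
    using that ws(3) corthogonalD[OF ws(2), of i i] conjugate_square_ge_0_vec[of "ws ! i"]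
    by (metis order_le_imp_less_or_eq)
  define W where "W = mat n n (\<lambda>(i, j). complex_of_real (nn (ws ! j)) * (ws ! j) $ i)"
  have W: "W \<in> carrier_mat n n" by (simp add: W_def)
  have "mat_adjoint W * W = 1\<^sub>m n"
  proof (rule eq_matI)
    fix i j assume "i < dim_row (1\<^sub>m n :: complex mat)" "j < dim_col (1\<^sub>m n :: complex mat)"
    then have i: "i < n" and j: "j < n" by auto
    have dj: "dim_vec (ws ! j) = n" "dim_vec (ws ! i) = n" using ws i j by (metis carrier_vecD nth_mem subsetD)+
    have "(mat_adjoint W * W) $$ (i, j) = (\<Sum>l<n. cnj (W $$ (l, i)) * W $$ (l, j))"
      using i j W by (simp add: index_mult[of _ n n _ n])
    also have "\<dots> = complex_of_real (nn (ws ! i) * nn (ws ! j)) * (ws ! j \<bullet>c ws ! i)"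
      using i j dj by (auto simp: W_def scalar_prod_def sum_distrib_left atLeast0LessThan
          intro!: sum.cong)
    also have "\<dots> = (if i = j then 1 else 0)"
    proof (cases "i = j")
      case True
      define r where "r = Re (ws ! i \<bullet>c ws ! i)"
      have r: "ws ! i \<bullet>c ws ! i = complex_of_real r" "r > 0"
        using pos[OF i] by (auto simp: r_def complex_eq_iff less_complex_def)
      have "nn (ws ! i) * nn (ws ! i) = 1 / r"
        using r(2) by (simp add: nn_def r_def)
      then show ?thesis using True r by (simp flip: of_real_mult)
    next
      case False
      then show ?thesis using corthogonalD[OF ws(2), of j i] ws i j by auto
    qed
    finally show "(mat_adjoint W * W) $$ (i, j) = 1\<^sub>m n $$ (i, j)" using i j by simp
  qed (use W in auto)
  then have "unitary_mat n W" using W by (simp add: unitary_mat_def)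
  moreover have w0: "ws ! 0 = v" using hdws n ws(3) by (metis hd_conv_nth length_greater_0_conv)
  moreover have "nn v \<noteq> 0" using pos[OF n] w0 by (auto simp: nn_def less_complex_def)
  moreover have "col W 0 = complex_of_real (nn v) \<cdot>\<^sub>v v"
    using n w0 v by (auto simp: W_def intro!: eq_vecI)
  ultimately show ?thesis by (metis of_real_eq_0_iff)
qed

text \<open>
  Deflation: in an orthonormal basis starting with an eigenvector the first column is zero below
  the diagonal, hence by symmetry so is the first row, and the remaining block is again Hermitian.\<close>

lemma hermitian_diagonalizable:
  fixes A :: "complex mat"
  assumes "A \<in> carrier_mat n n" "mat_adjoint A = A"
  shows "\<exists>U e. diagonalizes n A U e"
  using assms
proof (induction n arbitrary: A)
  case 0
  have "diagonalizes 0 A (1\<^sub>m 0) (\<lambda>_. 0)"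
    using 0 by (auto simp: diagonalizes_def unitary_mat_def intro!: eq_matI)
  then show ?case by blast
next
  case (Suc n)
  let ?N = "Suc n"
  have A: "A \<in> carrier_mat ?N ?N" by fact
  obtain as where as: "char_poly A = (\<Prod>a\<leftarrow>as. [:- a, 1:])" "length as = ?N"
    using char_poly_factorized[OF A] by auto
  then obtain a as' where "as = a # as'" by (cases as) auto
  then have "eigenvalue A a" unfolding eigenvalue_root_char_poly[OF A] as(1) by simp
  then obtain v where v: "v \<in> carrier_vec ?N" "v \<noteq> 0\<^sub>v ?N" "A *\<^sub>v v = a \<cdot>\<^sub>v v"
    using A by (auto simp: eigenvalue_def eigenvector_def)
  obtain W c where W: "unitary_mat ?N W" and c: "c \<noteq> 0" "col W 0 = c \<cdot>\<^sub>v v"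
    using unitary_with_first_column[OF v(1,2)] by blast
  have Wc: "W \<in> carrier_mat ?N ?N" using W by (simp add: unitary_mat_def)
  define B where "B = mat_adjoint W * A * W"
  have B: "B \<in> carrier_mat ?N ?N" using Wc A by (auto simp: B_def)
  have Bh: "mat_adjoint B = B"
    using Wc A Suc.prems(2) unfolding B_def
    by (simp add: adjoint_mult[of _ ?N ?N _ ?N] assoc_mult_mat[of _ ?N ?N _ ?N _ ?N])
  have AWB: "A = W * B * mat_adjoint W"
  proof -
    have "W * B * mat_adjoint W = (W * mat_adjoint W) * A * (W * mat_adjoint W)"
      using Wc A unfolding B_def by (simp add: assoc_mult_mat[of _ ?N ?N _ ?N _ ?N])
    then show ?thesis using A unitary_right[OF W] by simp
  qed
  have B0: "B $$ (i, 0) = (if i = 0 then a else 0)" if i: "i < ?N" for i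
  proof -
    have AW0: "(A * W) $$ (k, 0) = a * W $$ (k, 0)" if k: "k < ?N" for k
    proof -
      have "(A * W) $$ (k, 0) = (A *\<^sub>v col W 0) $ k" using A Wc k by (simp add: index_mult_mat(1))
      also have "A *\<^sub>v col W 0 = a \<cdot>\<^sub>v col W 0"
        using A v c by (simp add: mult_mat_vec[of _ "?N" "?N"] smult_smult_assoc mult.commute)
      finally show ?thesis using Wc k by simp
    qed
    have "B $$ (i, 0) = (mat_adjoint W * (A * W)) $$ (i, 0)"
      using Wc A unfolding B_def by (simp add: assoc_mult_mat[of _ ?N ?N _ ?N _ ?N])
    also have "\<dots> = (\<Sum>k<?N. cnj (W $$ (k, i)) * (a * W $$ (k, 0)))"
      using Wc A i AW0
      by (subst index_mult[of _ ?N ?N _ ?N]) (auto intro!: sum.cong)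
    also have "\<dots> = a * (\<Sum>k<?N. cnj (W $$ (k, i)) * W $$ (k, 0))"
      by (simp only: sum_distrib_left mult_ac)
    also have "\<dots> = (if i = 0 then a else 0)" using unitary_cols[OF W i, of 0] by simp
    finally show ?thesis .
  qed
  have Bsym: "B $$ (j, i) = cnj (B $$ (i, j))" if "i < ?N" "j < ?N" for i j
    using that B Bh index_adjoint[of j B i] by auto
  have are: "a = complex_of_real (Re a)"
    using B0[of 0] Bsym[of 0 0] by (simp add: complex_eq_iff)
  define B3 where "B3 = mat n n (\<lambda>(i, j). B $$ (Suc i, Suc j))"
  have B3: "B3 \<in> carrier_mat n n" by (simp add: B3_def)
  have "mat_adjoint B3 = B3"
    by (rule eq_matI) (auto simp: B3_def Bsym[symmetric])
  from Suc.IH[OF B3 this] obtain U3 e3 where "diagonalizes n B3 U3 e3" by blast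
  then have U3: "unitary_mat n U3"
    and B3eq: "B3 = U3 * mat_diag n (\<lambda>i. complex_of_real (e3 i)) * mat_adjoint U3"
    by (auto simp: diagonalizes_def)
  have U3c: "U3 \<in> carrier_mat n n" using U3 by (simp add: unitary_mat_def)
  let ?blk = "\<lambda>c X. four_block_mat (mat 1 1 (\<lambda>_. c)) (0\<^sub>m 1 n) (0\<^sub>m n 1) (X :: complex mat)"
  define V where "V = ?blk 1 U3"
  have Vc: "V \<in> carrier_mat ?N ?N" using U3c by (auto simp: V_def)
  have Va: "mat_adjoint V = ?blk 1 (mat_adjoint U3)"
    using U3c by (auto simp: V_def intro!: eq_matI)
  have blkmult: "?blk c X * ?blk c' X' = ?blk (c * c') (X * X')"
    if "X \<in> carrier_mat n n" "X' \<in> carrier_mat n n" for c c' X X'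
  proof -
    have "mat 1 1 (\<lambda>_. c) * mat 1 1 (\<lambda>_. c') = (mat 1 1 (\<lambda>_. c * c') :: complex mat)"
      by (rule eq_matI) (auto simp: index_mult_mat(1) scalar_prod_def)
    then show ?thesis using that
      by (subst mult_four_block_mat[of _ 1 1 _ n _ n _ _ 1 _ n]) auto
  qed
  have one: "?blk 1 (1\<^sub>m n) = 1\<^sub>m ?N" by (auto intro!: eq_matI)
  have "mat_adjoint V * V = 1\<^sub>m ?N"
    unfolding Va unfolding V_def blkmult[OF adjoint_carrier[OF U3c] U3c] unitary_left[OF U3]
    by (simp only: mult_1 one)
  then have V: "unitary_mat ?N V" using Vc by (simp add: unitary_mat_def)
  define e where "e i = (case i of 0 \<Rightarrow> Re a | Suc j \<Rightarrow> e3 j)" for i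
  have diag: "?blk a (mat_diag n (\<lambda>i. complex_of_real (e3 i))) = mat_diag ?N (\<lambda>i. complex_of_real (e i))"
    using are by (intro eq_matI) (auto simp: mat_diag_def e_def split: nat.splits)
  have "B = ?blk a B3"
  proof (rule eq_matI)
    fix i j assume "i < dim_row (?blk a B3)" "j < dim_col (?blk a B3)"
    then have ij: "i < ?N" "j < ?N" by (auto simp: B3_def)
    show "B $$ (i, j) = ?blk a B3 $$ (i, j)"
      using ij B0[of i] B0[of j] Bsym[of j i] are
      by (cases i; cases j) (auto simp: B3_def complex_eq_iff)
  qed (use B in \<open>auto simp: B3_def\<close>)
  also have "\<dots> = V * mat_diag ?N (\<lambda>i. complex_of_real (e i)) * mat_adjoint V"
    unfolding Va diag[symmetric] B3eq unfolding V_def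
    using U3c by (simp add: blkmult del: One_nat_def)
  finally have "A = (W * V) * mat_diag ?N (\<lambda>i. complex_of_real (e i)) * mat_adjoint (W * V)"
    unfolding AWB using Wc Vc
    by (simp add: adjoint_mult[of _ ?N ?N _ ?N] assoc_mult_mat[of _ ?N ?N _ ?N _ ?N])
  then have "diagonalizes ?N A (W * V) e"
    using unitary_mult[OF W V] by (simp add: diagonalizes_def)
  then show ?case by blast
qed

section \<open>Positive semidefinite matrices\<close>

lemma pos_semidef_iff:
  "pos_semidef n A \<longleftrightarrow> A \<in> carrier_mat n n \<and>
     (\<forall>f. 0 \<le> (\<Sum>i<n. \<Sum>j<n. A $$ (i, j) * f j * cnj (f i)))"
proof -
  have eq: "(A *\<^sub>v v) \<bullet>c v = (\<Sum>i<n. \<Sum>j<n. A $$ (i, j) * v $ j * cnj (v $ i))"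
    if "A \<in> carrier_mat n n" "v \<in> carrier_vec n" for v
    using that by (auto simp: scalar_prod_def atLeast0LessThan sum_distrib_right intro!: sum.cong)
  have "(\<Sum>i<n. \<Sum>j<n. A $$ (i, j) * f j * cnj (f i)) = (A *\<^sub>v vec n f) \<bullet>c vec n f"
    if "A \<in> carrier_mat n n" for f
    using eq[OF that, of "vec n f"] by simp
  with eq show ?thesis unfolding pos_semidef_def
    by (metis vec_carrier)
qed

lemma pos_semidef_carrier: "pos_semidef n A \<Longrightarrow> A \<in> carrier_mat n n"
  by (simp add: pos_semidef_def)

text \<open>
  Polarization: the quadratic form is real, and its values on \<open>e\<^sub>i + e\<^sub>j\<close> and \<open>e\<^sub>i + \<i> e\<^sub>j\<close> compare the
  imaginary and real parts of the two off-diagonal entries.\<close>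

lemma pos_semidef_hermitian:
  assumes "pos_semidef n A"
  shows "mat_adjoint A = A"
proof (rule eq_matI)
  have A: "A \<in> carrier_mat n n" using assms by (rule pos_semidef_carrier)
  fix i j assume "i < dim_row A" "j < dim_col A"
  then have ij: "i < n" "j < n" using A by auto
  define Q where "Q f = (\<Sum>i<n. \<Sum>j<n. A $$ (i, j) * f j * cnj (f i))" for f
  have Q: "Im (Q f) = 0" for f
    using assms unfolding pos_semidef_iff Q_def less_eq_complex_def by (metis zero_complex.simps(2))
  have delta: "(\<Sum>j<n. c j * ((if j = a then x else 0) + (if j = b then y else 0))) = c a * x + c b * y"
    if "a < n" "b < n" for a b x y and c :: "nat \<Rightarrow> complex"
  proof -
    have "(\<Sum>j<n. c j * (if j = k then z else 0)) = c k * z" if "k < n" for k z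
      using that by (simp add: if_distrib cong: if_cong)
    then show ?thesis using that by (simp add: distrib_left sum.distrib)
  qed
  have eval: "Q (\<lambda>l. (if l = a then x else 0) + (if l = b then y else 0)) =
      (A $$ (a, a) * x + A $$ (a, b) * y) * cnj x + (A $$ (b, a) * x + A $$ (b, b) * y) * cnj y"
    if "a < n" "b < n" for a b x y
  proof -
    have c: "cnj ((if i = a then x else 0) + (if i = b then y else 0)) =
        (if i = a then cnj x else 0) + (if i = b then cnj y else 0)" for i by simp
    show ?thesis unfolding Q_def sum_distrib_right[symmetric] c delta[OF that] ..
  qed
  have diag: "Im (A $$ (a, a)) = 0" if "a < n" for a
    using Q[of "\<lambda>l. (if l = a then 1 else 0) + (if l = a then 0 else 0)"]
    unfolding eval[OF that that] by simp
  have 1: "Im (A $$ (i, j)) + Im (A $$ (j, i)) = 0"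
    using Q[of "\<lambda>l. (if l = i then 1 else 0) + (if l = j then 1 else 0)"] diag ij
    unfolding eval[OF ij] by simp
  have 2: "Re (A $$ (i, j)) - Re (A $$ (j, i)) = 0"
    using Q[of "\<lambda>l. (if l = i then 1 else 0) + (if l = j then \<i> else 0)"] diag ij
    unfolding eval[OF ij] by simp
  show "mat_adjoint A $$ (i, j) = A $$ (i, j)"
    using 1 2 A ij by (auto simp: complex_eq_iff)
qed (use pos_semidef_carrier[OF assms] in auto)

lemma gram_pos_semidef:
  assumes "A \<in> carrier_mat n n"
    and gram: "\<And>i j. i < n \<Longrightarrow> j < n \<Longrightarrow> A $$ (i, j) = (\<Sum>k\<in>K. g k i * cnj (g k j))"
  shows "pos_semidef n A"
  unfolding pos_semidef_iff
proof (intro conjI allI)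
  fix f :: "nat \<Rightarrow> complex"
  have "(\<Sum>i<n. \<Sum>j<n. A $$ (i, j) * f j * cnj (f i)) =
      (\<Sum>i<n. \<Sum>j<n. \<Sum>k\<in>K. (g k i * cnj (f i)) * cnj (g k j * cnj (f j)))"
    by (auto intro!: sum.cong simp: gram sum_distrib_left sum_distrib_right mult_ac)
  also have "\<dots> = (\<Sum>k\<in>K. \<Sum>i<n. \<Sum>j<n. (g k i * cnj (f i)) * cnj (g k j * cnj (f j)))"
    by (rule sum_rotate[symmetric])
  also have "\<dots> = (\<Sum>k\<in>K. (\<Sum>i<n. g k i * cnj (f i)) * cnj (\<Sum>i<n. g k i * cnj (f i)))"
    by (simp only: cnj_sum sum_product)
  also have "\<dots> = (\<Sum>k\<in>K. complex_of_real ((cmod (\<Sum>i<n. g k i * cnj (f i)))\<^sup>2))"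
    by (simp only: complex_norm_square)
  also have "0 \<le> \<dots>"
    by (intro sum_nonneg) (simp add: less_eq_complex_def)
  finally show "0 \<le> (\<Sum>i<n. \<Sum>j<n. A $$ (i, j) * f j * cnj (f i))" .
qed (use assms in auto)

lemma diagonalizes_index:
  assumes "diagonalizes n A U e" "i < n" "j < n"
  shows "A $$ (i, j) = (\<Sum>k<n. complex_of_real (e k) * U $$ (i, k) * cnj (U $$ (j, k)))"
proof -
  have U: "U \<in> carrier_mat n n" using assms by (simp add: diagonalizes_def unitary_mat_def)
  have "A = mat n n (\<lambda>(i, j). U $$ (i, j) * complex_of_real (e j)) * mat_adjoint U"
    using assms mat_diag_mult_right[OF U] by (simp add: diagonalizes_def)
  then show ?thesis using U assms
    by (auto simp: index_mult[of _ n n _ n] mult_ac intro!: sum.cong)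
qed

lemma diagonalizes_carrier: "diagonalizes n A U e \<Longrightarrow> A \<in> carrier_mat n n"
  by (auto simp: diagonalizes_def unitary_mat_def)

lemma diagonalizes_adjoint_mult:
  assumes "diagonalizes n A U e"
  shows "mat_adjoint U * A * U = mat_diag n (\<lambda>i. complex_of_real (e i))"
proof -
  have U: "U \<in> carrier_mat n n" and u: "unitary_mat n U"
    using assms by (auto simp: diagonalizes_def unitary_mat_def)
  have "mat_adjoint U * A * U =
     (mat_adjoint U * U) * mat_diag n (\<lambda>i. complex_of_real (e i)) * (mat_adjoint U * U)"
    using U assms by (simp add: diagonalizes_def assoc_mult_mat[of _ n n _ n _ n])
  then show ?thesis by (simp add: unitary_left[OF u] left_mult_one_mat[of _ n n] right_mult_one_mat[of _ n n])
qed

lemma diagonalizes_quadratic: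
  assumes "diagonalizes n A U e" "k < n"
  shows "complex_of_real (e k) = (\<Sum>i<n. \<Sum>j<n. A $$ (i, j) * U $$ (j, k) * cnj (U $$ (i, k)))"
proof -
  have U: "U \<in> carrier_mat n n" and A: "A \<in> carrier_mat n n"
    using assms by (auto simp: diagonalizes_def unitary_mat_def)
  have "complex_of_real (e k) = (mat_adjoint U * (A * U)) $$ (k, k)"
    using diagonalizes_adjoint_mult[OF assms(1)] assms(2) U A
    by (simp add: mat_diag_def assoc_mult_mat[of _ n n _ n _ n])
  also have "\<dots> = (\<Sum>i<n. \<Sum>j<n. A $$ (i, j) * U $$ (j, k) * cnj (U $$ (i, k)))"
    using U A assms(2)
    by (simp add: index_mult[of _ n n _ n] sum_distrib_left mult_ac)
  finally show ?thesis .
qed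

lemma pos_semidef_eigenvalues_nonneg:
  assumes "pos_semidef n A" "diagonalizes n A U e" "k < n"
  shows "0 \<le> e k"
proof -
  have "0 \<le> complex_of_real (e k)"
    unfolding diagonalizes_quadratic[OF assms(2,3)] using assms(1) unfolding pos_semidef_iff by auto
  then show ?thesis by (simp add: less_eq_complex_def)
qed

lemma diagonalizes_trace:
  assumes "diagonalizes n A U e"
  shows "mat_trace A = (\<Sum>k<n. complex_of_real (e k))"
proof -
  have u: "unitary_mat n U" and A: "A \<in> carrier_mat n n"
    using assms by (auto simp: diagonalizes_def unitary_mat_def)
  have "mat_trace A = (\<Sum>i<n. \<Sum>k<n. complex_of_real (e k) * (U $$ (i, k) * cnj (U $$ (i, k))))"
    using A by (auto simp: mat_trace_def diagonalizes_index[OF assms] mult_ac intro!: sum.cong)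
  also have "\<dots> = (\<Sum>k<n. complex_of_real (e k) * (\<Sum>i<n. cnj (U $$ (i, k)) * U $$ (i, k)))"
    by (subst sum.swap) (simp add: sum_distrib_left mult_ac)
  finally show ?thesis using unitary_cols[OF u] by simp
qed

lemma pos_semidef_diagonalizes:
  assumes "pos_semidef n A"
  obtains U e where "diagonalizes n A U e" "\<And>k. k < n \<Longrightarrow> 0 \<le> e k"
  using hermitian_diagonalizable[OF pos_semidef_carrier[OF assms] pos_semidef_hermitian[OF assms]]
    pos_semidef_eigenvalues_nonneg[OF assms] by blast

lemma pos_semidef_gram:
  assumes "pos_semidef n A"
  obtains g :: "nat \<Rightarrow> nat \<Rightarrow> complex"
  where "\<And>i j. i < n \<Longrightarrow> j < n \<Longrightarrow> A $$ (i, j) = (\<Sum>k<n. g k i * cnj (g k j))"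
proof -
  obtain U e where U: "diagonalizes n A U e" and e: "\<And>k. k < n \<Longrightarrow> 0 \<le> e k"
    using pos_semidef_diagonalizes[OF assms] by blast
  have "A $$ (i, j) = (\<Sum>k<n. (complex_of_real (sqrt (e k)) * U $$ (i, k)) *
      cnj (complex_of_real (sqrt (e k)) * U $$ (j, k)))" if "i < n" "j < n" for i j
    unfolding diagonalizes_index[OF U that]
  proof (rule sum.cong)
    fix k assume "k \<in> {..<n}"
    then have "complex_of_real (sqrt (e k)) * complex_of_real (sqrt (e k)) = complex_of_real (e k)"
      using e by (simp flip: of_real_mult)
    then show "complex_of_real (e k) * U $$ (i, k) * cnj (U $$ (j, k)) =
      complex_of_real (sqrt (e k)) * U $$ (i, k) * cnj (complex_of_real (sqrt (e k)) * U $$ (j, k))"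
      by (simp add: mult_ac)
  qed simp
  then show ?thesis using that[of "\<lambda>k i. complex_of_real (sqrt (e k)) * U $$ (i, k)"] by blast
qed

lemma state_carrier: "state n \<rho> \<Longrightarrow> \<rho> \<in> carrier_mat n n"
  by (simp add: state_def pos_semidef_def)

lemma state_diagonalizes:
  assumes "state n \<rho>"
  obtains U e where "diagonalizes n \<rho> U e" "\<And>k. k < n \<Longrightarrow> 0 \<le> e k" "(\<Sum>k<n. e k) = 1"
proof -
  obtain U e where U: "diagonalizes n \<rho> U e" and e: "\<And>k. k < n \<Longrightarrow> 0 \<le> e k"
    using pos_semidef_diagonalizes assms unfolding state_def by blast
  have "complex_of_real (\<Sum>k<n. e k) = 1"
    using diagonalizes_trace[OF U] assms by (simp add: state_def)
  then have "(\<Sum>k<n. e k) = 1" using of_real_eq_1_iff by blast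
  then show ?thesis using that[OF U e] by blast
qed

section \<open>Entropy from an orthonormal family\<close>

definition ent_term :: "real \<Rightarrow> real" where
  "ent_term x = - (x * log 2 x)"

lemma ent_term_0 [simp]: "ent_term 0 = 0" and ent_term_1 [simp]: "ent_term 1 = 0"
  by (simp_all add: ent_term_def)

text \<open>
  Zero eigenvalues may be left out and the index set is arbitrary, so pure states, direct sums and
  tensor products can be described by the index sets that they come with.\<close>

definition eigenfamily ::
  "nat \<Rightarrow> complex mat \<Rightarrow> 'k set \<Rightarrow> ('k \<Rightarrow> real) \<Rightarrow> ('k \<Rightarrow> nat \<Rightarrow> complex) \<Rightarrow> bool" where
  "eigenfamily n A K e u \<longleftrightarrow> A \<in> carrier_mat n n \<and> finite K \<and>
     (\<forall>i<n. \<forall>j<n. A $$ (i, j) = (\<Sum>k\<in>K. complex_of_real (e k) * u k i * cnj (u k j))) \<and>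
     (\<forall>k\<in>K. \<forall>l\<in>K. (\<Sum>i<n. u k i * cnj (u l i)) = (if k = l then 1 else 0))"

lemma eigenfamilyI:
  assumes "A \<in> carrier_mat n n" "finite K"
    and "\<And>i j. i < n \<Longrightarrow> j < n \<Longrightarrow> A $$ (i, j) = (\<Sum>k\<in>K. complex_of_real (e k) * u k i * cnj (u k j))"
    and "\<And>k l. k \<in> K \<Longrightarrow> l \<in> K \<Longrightarrow> (\<Sum>i<n. u k i * cnj (u l i)) = (if k = l then 1 else 0)"
  shows "eigenfamily n A K e u"
  using assms by (simp add: eigenfamily_def)

lemma diagonalizes_eigenfamily:
  assumes "diagonalizes n A U e"
  shows "eigenfamily n A {..<n} e (\<lambda>k i. U $$ (i, k))"
  using assms diagonalizes_index[OF assms] unitary_cols[of n U]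
  by (intro eigenfamilyI) (auto simp: diagonalizes_def unitary_mat_def mult.commute)

text \<open>
  The weights \<open>\<bar>\<langle>v\<^sub>j, u\<^sub>k\<rangle>\<bar>\<^sup>2\<close> link only equal eigenvalues. They sum to one over \<open>j\<close> by completeness
  of \<open>v\<close>, and over \<open>k\<close> whenever \<open>b\<^sub>j \<noteq> 0\<close>, since then \<open>v\<^sub>j\<close> lies in the span of the \<open>u\<^sub>k\<close>.\<close>

lemma eigenfamily_eigenvalue_sum:
  assumes fam: "eigenfamily n A K e u" and V: "diagonalizes n A V b"
  shows "(\<Sum>k\<in>K. ent_term (e k)) = (\<Sum>j<n. ent_term (b j))"
proof -
  have uV: "unitary_mat n V" using V by (simp add: diagonalizes_def)
  have fin: "finite K" and idx: "\<And>i j. i < n \<Longrightarrow> j < n \<Longrightarrow>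
      A $$ (i, j) = (\<Sum>k\<in>K. complex_of_real (e k) * u k i * cnj (u k j))"
    and on: "\<And>k l. k \<in> K \<Longrightarrow> l \<in> K \<Longrightarrow> (\<Sum>i<n. u k i * cnj (u l i)) = (if k = l then 1 else 0)"
    using fam by (auto simp: eigenfamily_def)
  define M where "M k j = (\<Sum>i<n. cnj (V $$ (i, j)) * u k i)" for k j
  have Au: "(\<Sum>j<n. A $$ (i, j) * u k j) = complex_of_real (e k) * u k i" if "i < n" "k \<in> K" for i k
  proof -
    have "(\<Sum>j<n. A $$ (i, j) * u k j) = (\<Sum>j<n. \<Sum>l\<in>K. complex_of_real (e l) * u l i * (u k j * cnj (u l j)))"
      using that by (auto simp: idx sum_distrib_left sum_distrib_right mult_ac intro!: sum.cong)
    also have "\<dots> = (\<Sum>l\<in>K. complex_of_real (e l) * u l i * (\<Sum>j<n. u k j * cnj (u l j)))"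
      by (subst sum.swap) (simp add: sum_distrib_left)
    also have "\<dots> = (\<Sum>l\<in>K. if k = l then complex_of_real (e l) * u l i else 0)"
      using that by (intro sum.cong) (auto simp: on)
    finally show ?thesis using fin that by simp
  qed
  have VA: "(\<Sum>i<n. cnj (V $$ (i, j)) * A $$ (i, l)) = complex_of_real (b j) * cnj (V $$ (l, j))"
    if "j < n" "l < n" for j l
  proof -
    have "(\<Sum>i<n. cnj (V $$ (i, j)) * A $$ (i, l)) =
        (\<Sum>i<n. \<Sum>k<n. complex_of_real (b k) * cnj (V $$ (l, k)) * (cnj (V $$ (i, j)) * V $$ (i, k)))"
      using that by (auto simp: diagonalizes_index[OF V] sum_distrib_left mult_ac intro!: sum.cong)
    also have "\<dots> = (\<Sum>k<n. complex_of_real (b k) * cnj (V $$ (l, k)) * (\<Sum>i<n. cnj (V $$ (i, j)) * V $$ (i, k)))"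
      by (subst sum.swap) (simp add: sum_distrib_left)
    also have "\<dots> = (\<Sum>k<n. if j = k then complex_of_real (b k) * cnj (V $$ (l, k)) else 0)"
      using that by (intro sum.cong) (auto simp: unitary_cols[OF uV])
    finally show ?thesis using that by simp
  qed
  \<comment> \<open>Eigenvectors for different eigenvalues are orthogonal.\<close>
  have eb: "complex_of_real (e k) * M k j = complex_of_real (b j) * M k j" if "k \<in> K" "j < n" for k j
  proof -
    have "complex_of_real (e k) * M k j = (\<Sum>i<n. cnj (V $$ (i, j)) * (complex_of_real (e k) * u k i))"
      by (simp add: M_def sum_distrib_left mult_ac)
    also have "\<dots> = (\<Sum>i<n. cnj (V $$ (i, j)) * (\<Sum>l<n. A $$ (i, l) * u k l))"
      using that by (intro sum.cong) (simp_all add: Au)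
    also have "\<dots> = (\<Sum>l<n. (\<Sum>i<n. cnj (V $$ (i, j)) * A $$ (i, l)) * u k l)"
      by (simp only: sum_distrib_left sum_distrib_right) (subst sum.swap, simp add: mult_ac)
    also have "\<dots> = complex_of_real (b j) * M k j"
      unfolding M_def sum_distrib_left using that
      by (intro sum.cong) (simp_all add: VA mult.assoc)
    finally show ?thesis .
  qed
  \<comment> \<open>So the weight of \<open>k\<close>, \<open>j\<close> vanishes unless the eigenvalues agree.\<close>
  have e_eq: "e k = b j" if "k \<in> K" "j < n" "M k j \<noteq> 0" for k j
    using eb[OF that(1,2)] that(3) by simp
  have parseval: "(\<Sum>j<n. (cmod (M k j))\<^sup>2) = 1" if "k \<in> K" for k
  proof -
    have "complex_of_real (\<Sum>j<n. (cmod (M k j))\<^sup>2) = (\<Sum>j<n. M k j * cnj (M k j))"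
      by (simp add: complex_norm_square[symmetric] del: of_real_power)
    also have "\<dots> = (\<Sum>j<n. \<Sum>i<n. \<Sum>l<n. (u k i * cnj (u k l)) * (V $$ (l, j) * cnj (V $$ (i, j))))"
      by (simp add: M_def sum_product mult_ac)
    also have "\<dots> = (\<Sum>i<n. \<Sum>l<n. \<Sum>j<n. (u k i * cnj (u k l)) * (V $$ (l, j) * cnj (V $$ (i, j))))"
      by (subst sum.swap, rule sum.cong[OF refl], rule sum.swap)
    also have "\<dots> = (\<Sum>i<n. \<Sum>l<n. (u k i * cnj (u k l)) * (if l = i then 1 else 0))"
      by (simp add: sum_distrib_left[symmetric] unitary_rows[OF uV])
    also have "\<dots> = (\<Sum>i<n. u k i * cnj (u k i))"
      by (simp add: if_distrib cong: if_cong)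
    also have "\<dots> = 1" using on[OF that that] by simp
    finally show ?thesis using of_real_eq_1_iff by blast
  qed
  have b_eq: "b j = (\<Sum>k\<in>K. e k * (cmod (M k j))\<^sup>2)" if "j < n" for j
  proof -
    have "complex_of_real (b j) = (\<Sum>i<n. \<Sum>l<n. A $$ (i, l) * V $$ (l, j) * cnj (V $$ (i, j)))"
      by (rule diagonalizes_quadratic[OF V that])
    also have "\<dots> = (\<Sum>i<n. \<Sum>l<n. \<Sum>k\<in>K. complex_of_real (e k) *
        ((cnj (V $$ (i, j)) * u k i) * (V $$ (l, j) * cnj (u k l))))"
      by (auto simp: idx sum_distrib_left sum_distrib_right mult_ac intro!: sum.cong)
    also have "\<dots> = (\<Sum>k\<in>K. \<Sum>i<n. \<Sum>l<n. complex_of_real (e k) *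
        ((cnj (V $$ (i, j)) * u k i) * (V $$ (l, j) * cnj (u k l))))"
      by (rule sum_rotate[symmetric])
    also have "\<dots> = (\<Sum>k\<in>K. complex_of_real (e k) * (M k j * cnj (M k j)))"
      by (simp only: M_def cnj_sum complex_cnj_mult complex_cnj_cnj sum_product)
        (simp only: sum_distrib_left)
    also have "\<dots> = complex_of_real (\<Sum>k\<in>K. e k * (cmod (M k j))\<^sup>2)"
      by (simp add: complex_norm_square[symmetric] del: of_real_power)
    finally show ?thesis using of_real_eq_iff by blast
  qed
  have complete: "b j \<noteq> 0 \<Longrightarrow> (\<Sum>k\<in>K. (cmod (M k j))\<^sup>2) = 1" if "j < n" for j
  proof -
    have "b j = (\<Sum>k\<in>K. b j * (cmod (M k j))\<^sup>2)"
      by (subst b_eq[OF that], rule sum.cong) (use e_eq that in force)+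
    then have "b j * (\<Sum>k\<in>K. (cmod (M k j))\<^sup>2) = b j * 1" by (simp add: sum_distrib_left)
    then show "b j \<noteq> 0 \<Longrightarrow> (\<Sum>k\<in>K. (cmod (M k j))\<^sup>2) = 1"
      by simp
  qed
  have "(\<Sum>k\<in>K. ent_term (e k)) = (\<Sum>k\<in>K. \<Sum>j<n. (cmod (M k j))\<^sup>2 * ent_term (e k))"
    by (simp add: sum_distrib_right[symmetric] parseval)
  also have "\<dots> = (\<Sum>k\<in>K. \<Sum>j<n. (cmod (M k j))\<^sup>2 * ent_term (b j))"
    by (intro sum.cong refl) (use e_eq in force)
  also have "\<dots> = (\<Sum>j<n. (\<Sum>k\<in>K. (cmod (M k j))\<^sup>2) * ent_term (b j))"
    by (subst sum.swap) (simp add: sum_distrib_right)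
  also have "\<dots> = (\<Sum>j<n. ent_term (b j))"
    by (intro sum.cong refl) (metis complete ent_term_0 lessThan_iff mult_1 mult_zero_right)
  finally show ?thesis .
qed

lemma entropy_eigenfamily:
  assumes fam: "eigenfamily n A K e u"
  shows "entropy A = (\<Sum>k\<in>K. ent_term (e k))"
proof -
  have A: "A \<in> carrier_mat n n" using fam by (simp add: eigenfamily_def)
  have "mat_adjoint A = A"
  proof (rule eq_matI)
    fix i j assume "i < dim_row A" "j < dim_col A"
    then show "mat_adjoint A $$ (i, j) = A $$ (i, j)"
      using fam A by (auto simp: eigenfamily_def mult_ac intro!: sum.cong)
  qed (use A in auto)
  from hermitian_diagonalizable[OF A this] obtain U' e' where "diagonalizes n A U' e'" by blast
  then have ex: "\<exists>B U e. unitary_mat (dim_row A) U \<and>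
     A = U * mat_diag (dim_row A) (\<lambda>i. complex_of_real (e i)) * mat_adjoint U \<and>
     B = U * mat_diag (dim_row A) (\<lambda>i. complex_of_real (log 2 (e i))) * mat_adjoint U"
    using A unfolding diagonalizes_def by (metis carrier_matD(1))
  from someI_ex[OF this, folded mat_fun_def]
  obtain V b where V: "diagonalizes n A V b"
    and L: "mat_fun (log 2) A = V * mat_diag n (\<lambda>i. complex_of_real (log 2 (b i))) * mat_adjoint V"
    using A by (auto simp: diagonalizes_def)
  let ?D = "\<lambda>f. mat_diag n (\<lambda>i. complex_of_real (f i))"
  have Vc: "V \<in> carrier_mat n n" and Vu: "unitary_mat n V"
    using V by (auto simp: diagonalizes_def unitary_mat_def)
  have "A * mat_fun (log 2) A = V * (?D b * (mat_adjoint V * V) * ?D (\<lambda>i. log 2 (b i))) * mat_adjoint V"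
    using Vc V unfolding L by (simp add: diagonalizes_def assoc_mult_mat[of _ n n _ n _ n] del: mat_diag_diag)
  also have "\<dots> = V * ?D (\<lambda>i. b i * log 2 (b i)) * mat_adjoint V"
    by (simp add: unitary_left[OF Vu] right_mult_one_mat[of _ n n])
  finally have "diagonalizes n (A * mat_fun (log 2) A) V (\<lambda>i. b i * log 2 (b i))"
    using Vu by (simp add: diagonalizes_def)
  from diagonalizes_trace[OF this] have "entropy A = (\<Sum>j<n. ent_term (b j))"
    by (simp add: entropy_def ent_term_def sum_negf)
  then show ?thesis using eigenfamily_eigenvalue_sum[OF fam V] by simp
qed

lemma entropy_diagonalizes:
  assumes "diagonalizes n A U e"
  shows "entropy A = (\<Sum>k<n. ent_term (e k))"
  by (rule entropy_eigenfamily[OF diagonalizes_eigenfamily[OF assms]])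

section \<open>Tensor factors: mixed-radix indices, partial trace and amplification\<close>

text \<open>
  The position of \<open>e\<^sub>x \<otimes> e\<^sub>y \<otimes> e\<^sub>z\<close> when the last two factors have dimensions \<open>m\<close> and \<open>s\<close>. The encoding
  is associative, so that a triple product can be regrouped without moving entries.\<close>

abbreviation (input) ix :: "nat \<Rightarrow> nat \<Rightarrow> nat \<Rightarrow> nat \<Rightarrow> nat \<Rightarrow> nat" where
  "ix m s x y z \<equiv> (x * m + y) * s + z"

lemma pair_less: "x < r \<Longrightarrow> z < s \<Longrightarrow> x * s + z < r * (s::nat)"
proof -
  assume "x < r" "z < s"
  then have "x * s + z < x * s + s" "Suc x * s \<le> r * s" by (auto simp del: mult_Suc intro!: mult_le_mono1)
  then show ?thesis by simp
qed

lemma ix_less: "x < r \<Longrightarrow> y < m \<Longrightarrow> z < s \<Longrightarrow> ix m s x y z < r * m * s"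
  by (intro pair_less)

lemma pair_div [simp]: "z < s \<Longrightarrow> (x * s + z) div s = (x::nat)"
  and pair_mod [simp]: "z < s \<Longrightarrow> (x * s + z) mod s = (z::nat)"
  by auto

lemma pair_cases:
  assumes "p < r * (s::nat)"
  obtains x z where "x < r" "z < s" "p = x * s + z"
proof -
  have "0 < s" using assms by (cases s) auto
  then show ?thesis using assms
    by (intro that[of "p div s" "p mod s"]) (auto simp: less_mult_imp_div_less)
qed

lemma ix_cases:
  assumes "p < r * m * (s::nat)"
  obtains x y z where "x < r" "y < m" "z < s" "p = ix m s x y z"
  using assms by (metis pair_cases)

lemma sum_pair: "(\<Sum>p<r * s. f p) = (\<Sum>x<r. \<Sum>z<s. f (x * s + z))"
  for f :: "nat \<Rightarrow> 'a::comm_monoid_add"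
proof -
  have "(\<Sum>p\<in>{x * s..<x * s + s}. f p) = (\<Sum>z<s. f (x * s + z))" for x
    using sum.shift_bounds_nat_ivl[of f 0 "x * s" s] by (simp add: add.commute lessThan_atLeast0)
  then show ?thesis using sum.nat_group[of f s r] by simp
qed

lemma sum_ix: "(\<Sum>p<r * m * s. f p) = (\<Sum>x<r. \<Sum>y<m. \<Sum>z<s. f (ix m s x y z))"
  for f :: "nat \<Rightarrow> 'a::comm_monoid_add"
  by (simp only: sum_pair)

lemma eq_mat_pair:
  assumes "A \<in> carrier_mat (r * s) (r * s)" "B \<in> carrier_mat (r * s) (r * s)"
    and "\<And>x z x' z'. x < r \<Longrightarrow> z < s \<Longrightarrow> x' < r \<Longrightarrow> z' < s \<Longrightarrow>
      A $$ (x * s + z, x' * s + z') = B $$ (x * s + z, x' * s + z')"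
  shows "A = B"
  using assms by (intro eq_matI) (auto elim!: pair_cases)

lemma eq_mat_ix:
  assumes "A \<in> carrier_mat (r * m * s) (r * m * s)" "B \<in> carrier_mat (r * m * s) (r * m * s)"
    and "\<And>x y z x' y' z'. x < r \<Longrightarrow> y < m \<Longrightarrow> z < s \<Longrightarrow> x' < r \<Longrightarrow> y' < m \<Longrightarrow> z' < s \<Longrightarrow>
      A $$ (ix m s x y z, ix m s x' y' z') = B $$ (ix m s x y z, ix m s x' y' z')"
  shows "A = B"
  using assms by (intro eq_matI) (auto elim!: ix_cases)

text \<open>
  Partial trace over the middle factor of dimensions \<open>r\<close>, \<open>m\<close>, \<open>s\<close>.\<close>

definition ptr :: "nat \<Rightarrow> nat \<Rightarrow> nat \<Rightarrow> complex mat \<Rightarrow> complex mat" where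
  "ptr r m s X = mat (r * s) (r * s) (\<lambda>(p, q).
     \<Sum>y<m. X $$ (ix m s (p div s) y (p mod s), ix m s (q div s) y (q mod s)))"

text \<open>
  The position of \<open>e\<^sub>x \<otimes> e\<^sub>z\<close>, given that of \<open>e\<^sub>x \<otimes> e\<^sub>y \<otimes> e\<^sub>z\<close>.\<close>

definition outer :: "nat \<Rightarrow> nat \<Rightarrow> nat \<Rightarrow> nat" where
  "outer m s p = (p div s div m) * s + p mod s"

text \<open>
  Amplification: \<open>Y\<close> on the two outer factors, tensored with the identity on the middle one.\<close>

definition amp :: "nat \<Rightarrow> nat \<Rightarrow> nat \<Rightarrow> complex mat \<Rightarrow> complex mat" where
  "amp r m s Y = mat (r * m * s) (r * m * s) (\<lambda>(p, q).
     if p div s mod m = q div s mod m then Y $$ (outer m s p, outer m s q) else 0)"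

lemma outer_ix [simp]: "y < m \<Longrightarrow> z < s \<Longrightarrow> outer m s (ix m s x y z) = x * s + z"
  by (simp add: outer_def)

lemma ptr_carrier [simp]: "ptr r m s X \<in> carrier_mat (r * s) (r * s)"
  by (simp add: ptr_def)

lemma amp_carrier [simp]: "amp r m s Y \<in> carrier_mat (r * m * s) (r * m * s)"
  by (simp add: amp_def)

lemma ptr_index:
  assumes "x < r" "z < s" "x' < r" "z' < s"
  shows "ptr r m s X $$ (x * s + z, x' * s + z') = (\<Sum>y<m. X $$ (ix m s x y z, ix m s x' y z'))"
  using assms by (simp add: ptr_def pair_less)

lemma ix_assoc: "x * (m * s) + (y * s + z) = ix m s x y (z::nat)"
  by (simp add: algebra_simps)

lemma ptr_index_assoc:
  assumes "x < r" "y < m2" "z < s" "x' < r" "y' < m2" "z' < s"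
  shows "ptr r m1 (m2 * s) X $$ (ix m2 s x y z, ix m2 s x' y' z') =
    (\<Sum>y1<m1. X $$ (ix m2 s (x * m1 + y1) y z, ix m2 s (x' * m1 + y1) y' z'))"
  using ptr_index[of x r "y * s + z" "m2 * s" x' "y' * s + z'" m1 X] assms
  by (simp only: ix_assoc pair_less simp_thms)

lemma amp_index:
  assumes "x < r" "y < m" "z < s" "x' < r" "y' < m" "z' < s"
  shows "amp r m s Y $$ (ix m s x y z, ix m s x' y' z') =
    (if y = y' then Y $$ (x * s + z, x' * s + z') else 0)"
  using assms by (simp add: amp_def ix_less)

lemma amp_mult:
  assumes "Y \<in> carrier_mat (r * s) (r * s)" "Z \<in> carrier_mat (r * s) (r * s)"
  shows "amp r m s (Y * Z) = amp r m s Y * amp r m s Z"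
proof (rule eq_mat_ix[of _ r m s])
  fix x y z x' y' z' assume b: "x < r" "y < m" "z < s" "x' < r" "y' < m" "z' < s"
  have "(amp r m s Y * amp r m s Z) $$ (ix m s x y z, ix m s x' y' z') =
      (\<Sum>u<r. \<Sum>v<m. \<Sum>w<s. (if y = v then Y $$ (x * s + z, u * s + w) else 0) *
         (if v = y' then Z $$ (u * s + w, x' * s + z') else 0))"
    using b by (simp add: index_mult[OF amp_carrier amp_carrier] ix_less sum_ix amp_index)
  also have "\<dots> = (\<Sum>u<r. \<Sum>v<m. if y = v then \<Sum>w<s. Y $$ (x * s + z, u * s + w) *
         (if v = y' then Z $$ (u * s + w, x' * s + z') else 0) else 0)"
    by (intro sum.cong) auto
  also have "\<dots> = (if y = y' then \<Sum>u<r. \<Sum>w<s. Y $$ (x * s + z, u * s + w) * Z $$ (u * s + w, x' * s + z') else 0)"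
    using b by simp
  finally show "amp r m s (Y * Z) $$ (ix m s x y z, ix m s x' y' z') =
      (amp r m s Y * amp r m s Z) $$ (ix m s x y z, ix m s x' y' z')"
    using b by (simp add: amp_index index_mult[OF assms] pair_less sum_pair)
qed auto

lemma amp_adjoint:
  assumes "Y \<in> carrier_mat (r * s) (r * s)"
  shows "amp r m s (mat_adjoint Y) = mat_adjoint (amp r m s Y)"
proof (rule eq_mat_ix[of _ r m s])
  fix x y z x' y' z' assume b: "x < r" "y < m" "z < s" "x' < r" "y' < m" "z' < s"
  have "mat_adjoint (amp r m s Y) $$ (ix m s x y z, ix m s x' y' z') =
      cnj (amp r m s Y $$ (ix m s x' y' z', ix m s x y z))"
    using b by (intro index_adjoint) (auto simp: amp_def ix_less)
  then show "amp r m s (mat_adjoint Y) $$ (ix m s x y z, ix m s x' y' z') =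
      mat_adjoint (amp r m s Y) $$ (ix m s x y z, ix m s x' y' z')"
    using b assms by (simp add: amp_index pair_less)
qed auto

lemma amp_diag: "amp r m s (mat_diag (r * s) f) = mat_diag (r * m * s) (\<lambda>p. f (outer m s p))"
proof (rule eq_mat_ix[of _ r m s])
  fix x y z x' y' z' assume b: "x < r" "y < m" "z < s" "x' < r" "y' < m" "z' < s"
  have "ix m s x y z = ix m s x' y' z' \<longleftrightarrow> x = x' \<and> y = y' \<and> z = z'"
    using b by (metis pair_div pair_mod)
  moreover have "x * s + z = x' * s + z' \<longleftrightarrow> x = x' \<and> z = z'"
    using b by (metis pair_div pair_mod)
  ultimately show "amp r m s (mat_diag (r * s) f) $$ (ix m s x y z, ix m s x' y' z') =
      mat_diag (r * m * s) (\<lambda>p. f (outer m s p)) $$ (ix m s x y z, ix m s x' y' z')"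
    using b by (auto simp: amp_index mat_diag_def pair_less ix_less)
qed auto

lemma amp_one: "amp r m s (1\<^sub>m (r * s)) = 1\<^sub>m (r * m * s)"
  using amp_diag[of r m s "\<lambda>_. 1"] by simp

lemma amp_unitary:
  assumes "unitary_mat (r * s) V"
  shows "unitary_mat (r * m * s) (amp r m s V)"
  using assms unitary_left[OF assms]
  by (simp add: unitary_mat_def amp_adjoint[symmetric] amp_mult[symmetric] amp_one)

lemma amp_diagonalizes:
  assumes "diagonalizes (r * s) B V b"
  shows "diagonalizes (r * m * s) (amp r m s B) (amp r m s V) (\<lambda>p. b (outer m s p))"
proof -
  have V: "V \<in> carrier_mat (r * s) (r * s)" using assms by (simp add: diagonalizes_def unitary_mat_def)
  show ?thesis using assms V amp_unitary[of r s V m]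
    by (simp add: diagonalizes_def amp_mult[OF mult_carrier_square adjoint_carrier] amp_mult amp_diag amp_adjoint)
qed

text \<open>Every comparison of a matrix with its partial trace below goes through this adjunction.\<close>

lemma trace_mult_amp:
  assumes X: "X \<in> carrier_mat (r * m * s) (r * m * s)" and Y: "Y \<in> carrier_mat (r * s) (r * s)"
  shows "mat_trace (X * amp r m s Y) = mat_trace (ptr r m s X * Y)"
proof -
  define g where "g x y z x' z' = X $$ (ix m s x y z, ix m s x' y z') * Y $$ (x' * s + z', x * s + z)"
    for x y z x' z'
  have "mat_trace (X * amp r m s Y) =
      (\<Sum>x<r. \<Sum>y<m. \<Sum>z<s. \<Sum>x'<r. \<Sum>y'<m. \<Sum>z'<s.
        if y' = y then g x y z x' z' else 0)"
    unfolding trace_mult[OF X amp_carrier] sum_ix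
    by (intro sum.cong refl) (auto simp: amp_index g_def)
  also have "\<dots> = (\<Sum>x<r. \<Sum>y<m. \<Sum>z<s. \<Sum>x'<r. \<Sum>y'<m. if y' = y then \<Sum>z'<s. g x y z x' z' else 0)"
    by (intro sum.cong refl) auto
  also have "\<dots> = (\<Sum>x<r. \<Sum>y<m. \<Sum>z<s. \<Sum>x'<r. \<Sum>z'<s. g x y z x' z')"
    by simp
  also have "\<dots> = (\<Sum>x<r. \<Sum>z<s. \<Sum>y<m. \<Sum>x'<r. \<Sum>z'<s. g x y z x' z')"
    by (rule sum.cong[OF refl], rule sum.swap)
  also have "\<dots> = (\<Sum>x<r. \<Sum>z<s. \<Sum>x'<r. \<Sum>y<m. \<Sum>z'<s. g x y z x' z')"
    by (rule sum.cong[OF refl], rule sum.cong[OF refl], rule sum.swap)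
  also have "\<dots> = (\<Sum>x<r. \<Sum>z<s. \<Sum>x'<r. \<Sum>z'<s. \<Sum>y<m. g x y z x' z')"
    by (rule sum.cong[OF refl], rule sum.cong[OF refl], rule sum.cong[OF refl], rule sum.swap)
  also have "\<dots> = mat_trace (ptr r m s X * Y)"
    unfolding trace_mult[OF ptr_carrier Y] sum_pair
    by (intro sum.cong refl) (auto simp: ptr_index g_def sum_distrib_right)
  finally show ?thesis .
qed

lemma trace_ptr:
  assumes X: "X \<in> carrier_mat (r * m * s) (r * m * s)"
  shows "mat_trace (ptr r m s X) = mat_trace X"
  using trace_mult_amp[OF X, of "1\<^sub>m (r * s)"] X
  by (simp add: amp_one right_mult_one_mat[OF ptr_carrier])

lemma pos_semidef_ptr:
  assumes "pos_semidef (r * m * s) X"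
  shows "pos_semidef (r * s) (ptr r m s X)"
proof -
  obtain g where g: "\<And>i j. i < r * m * s \<Longrightarrow> j < r * m * s \<Longrightarrow>
      X $$ (i, j) = (\<Sum>k<r * m * s. g k i * cnj (g k j))"
    using pos_semidef_gram[OF assms] by metis
  show ?thesis
  proof (rule gram_pos_semidef[where K = "{..<m} \<times> {..<r * m * s}"
        and g = "\<lambda>(y, k) i. g k (ix m s (i div s) y (i mod s))"])
    fix i j assume "i < r * s" "j < r * s"
    then show "ptr r m s X $$ (i, j) = (\<Sum>k\<in>{..<m} \<times> {..<r * m * s}.
        (case k of (y, k) \<Rightarrow> \<lambda>i. g k (ix m s (i div s) y (i mod s))) i *
        cnj ((case k of (y, k) \<Rightarrow> \<lambda>i. g k (ix m s (i div s) y (i mod s))) j))"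
      by (elim pair_cases) (simp add: ptr_index g ix_less sum.cartesian_product case_prod_unfold)
  qed simp
qed

lemma state_ptr: "state (r * m * s) X \<Longrightarrow> state (r * s) (ptr r m s X)"
  by (simp add: state_def pos_semidef_ptr trace_ptr pos_semidef_carrier)

lemma ptr_ptr:
  assumes "X \<in> carrier_mat (r * m1 * m2 * s) (r * m1 * m2 * s)"
  shows "ptr r m1 s (ptr (r * m1) m2 s X) = ptr r m2 s (ptr r m1 (m2 * s) X)"
proof (rule eq_mat_pair[of _ r s])
  fix x z x' z' assume b: "x < r" "z < s" "x' < r" "z' < s"
  show "ptr r m1 s (ptr (r * m1) m2 s X) $$ (x * s + z, x' * s + z') =
      ptr r m2 s (ptr r m1 (m2 * s) X) $$ (x * s + z, x' * s + z')"
    using b by (simp add: ptr_index ptr_index_assoc pair_less) (rule sum.swap)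
qed auto

lemma ptr_amp:
  assumes "Z \<in> carrier_mat (r * m1 * s) (r * m1 * s)"
  shows "ptr r m1 (m2 * s) (amp (r * m1) m2 s Z) = amp r m2 s (ptr r m1 s Z)"
proof (rule eq_mat_ix[of _ r m2 s])
  fix x y z x' y' z' assume b: "x < r" "y < m2" "z < s" "x' < r" "y' < m2" "z' < s"
  show "ptr r m1 (m2 * s) (amp (r * m1) m2 s Z) $$ (ix m2 s x y z, ix m2 s x' y' z') =
      amp r m2 s (ptr r m1 s Z) $$ (ix m2 s x y z, ix m2 s x' y' z')"
    using b by (simp add: amp_index ptr_index ptr_index_assoc pair_less)
qed (metis mult.assoc amp_carrier ptr_carrier)+

section \<open>Relative entropy and strong subadditivity\<close>

lemma unitary_cancel:
  assumes "unitary_mat n U" "X \<in> carrier_mat n n"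
  shows "mat_adjoint U * (U * X) = X" "U * (mat_adjoint U * X) = X"
proof -
  have U: "U \<in> carrier_mat n n" using assms by (simp add: unitary_mat_def)
  show "mat_adjoint U * (U * X) = X" "U * (mat_adjoint U * X) = X"
    using assms U unitary_left[OF assms(1)] unitary_right[OF assms(1)]
    by (simp_all add: assoc_mult_mat[of _ n n _ n _ n, symmetric])
qed

lemma trace_unitary_conj:
  assumes "unitary_mat n U" "X \<in> carrier_mat n n"
  shows "mat_trace (U * X * mat_adjoint U) = mat_trace X"
proof -
  have U: "U \<in> carrier_mat n n" using assms by (simp add: unitary_mat_def)
  have "mat_trace (U * (X * mat_adjoint U)) = mat_trace ((X * mat_adjoint U) * U)"
    using U assms by (intro trace_comm[of _ n n]) auto
  also have "(X * mat_adjoint U) * U = X"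
    using U assms unitary_left[OF assms(1)] by (simp add: assoc_mult_mat[of _ n n _ n _ n])
  finally show ?thesis using U assms by (simp add: assoc_mult_mat[of _ n n _ n _ n])
qed

lemma trace_diag_mult:
  assumes "Z \<in> carrier_mat n n"
  shows "mat_trace (mat_diag n f * Z) = (\<Sum>i<n. f i * Z $$ (i, i))"
  unfolding mat_diag_mult_left[OF assms] by (simp add: mat_trace_def)

text \<open>
  Affine in \<open>(A, B)\<close>. Its maximum over \<open>Y\<close> is the weighted sum of quotients that governs the growth
  of the relative entropy along the interpolation.\<close>

definition variational :: "real \<Rightarrow> complex mat \<Rightarrow> complex mat \<Rightarrow> complex mat \<Rightarrow> real" where
  "variational t A B Y =
     2 * Re (mat_trace (A * mat_adjoint Y) - mat_trace (B * mat_adjoint Y))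
     - t * Re (mat_trace (A * (Y * mat_adjoint Y)))
     - (1 - t) * Re (mat_trace (B * (mat_adjoint Y * Y)))"

lemma variational_eigenbasis:
  assumes A: "diagonalizes n A U a" and B: "diagonalizes n B V b" and W: "W \<in> carrier_mat n n"
  defines "M \<equiv> mat_adjoint U * V"
  shows "variational t A B (U * W * mat_adjoint V) =
    (\<Sum>i<n. \<Sum>j<n. 2 * ((a i - b j) * Re (M $$ (i, j) * cnj (W $$ (i, j))))
       - (t * a i + (1 - t) * b j) * (cmod (W $$ (i, j)))\<^sup>2)"
proof -
  have U: "U \<in> carrier_mat n n" "unitary_mat n U" and V: "V \<in> carrier_mat n n" "unitary_mat n V"
    using A B by (auto simp: diagonalizes_def unitary_mat_def)
  define Y where "Y = U * W * mat_adjoint V"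
  have Yc: "Y \<in> carrier_mat n n" and Mc: "M \<in> carrier_mat n n" using U V W by (auto simp: Y_def M_def)
  have Ya: "mat_adjoint Y = V * mat_adjoint W * mat_adjoint U"
    using U V W by (simp add: Y_def adjoint_mult[of _ n n _ n] assoc_mult_mat[of _ n n _ n _ n])
  have Ma: "mat_adjoint M = mat_adjoint V * U"
    using U V by (simp add: M_def adjoint_mult[of _ n n _ n])
  let ?D = "\<lambda>f. mat_diag n (\<lambda>i. complex_of_real (f i))"
  note simps = assoc_mult_mat[of _ n n _ n _ n] unitary_cancel[OF U(2)] unitary_cancel[OF V(2)]
  have "A * mat_adjoint Y = U * (?D a * (M * mat_adjoint W)) * mat_adjoint U"
    using A U V W unfolding Ya by (simp add: diagonalizes_def M_def simps)
  then have 1: "mat_trace (A * mat_adjoint Y) =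
      (\<Sum>i<n. \<Sum>j<n. complex_of_real (a i) * (M $$ (i, j) * cnj (W $$ (i, j))))"
    using U W Mc by (simp add: trace_unitary_conj trace_diag_mult index_mult[of _ n n _ n] sum_distrib_left)
  have "B * mat_adjoint Y = V * (?D b * (mat_adjoint W * M)) * mat_adjoint V"
  proof -
    have "mat_adjoint W * mat_adjoint U = mat_adjoint W * (M * mat_adjoint V)"
      using U V W unitary_right[OF V(2)] by (simp add: M_def simps)
    then show ?thesis
      using B U V W Mc unfolding Ya by (simp add: diagonalizes_def simps)
  qed
  then have 2: "mat_trace (B * mat_adjoint Y) =
      (\<Sum>i<n. \<Sum>j<n. complex_of_real (b j) * (M $$ (i, j) * cnj (W $$ (i, j))))"
    using V W Mc by (subst sum.swap) (simp add: trace_unitary_conj trace_diag_mult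
        index_mult[of _ n n _ n] sum_distrib_left mult_ac)
  have "A * (Y * mat_adjoint Y) = U * (?D a * (W * mat_adjoint W)) * mat_adjoint U"
    using A U V W unfolding Ya unfolding Y_def by (simp add: diagonalizes_def simps)
  then have 3: "mat_trace (A * (Y * mat_adjoint Y)) =
      (\<Sum>i<n. \<Sum>j<n. complex_of_real (a i) * (W $$ (i, j) * cnj (W $$ (i, j))))"
    using U W by (simp add: trace_unitary_conj trace_diag_mult index_mult[of _ n n _ n] sum_distrib_left)
  have "B * (mat_adjoint Y * Y) = V * (?D b * (mat_adjoint W * W)) * mat_adjoint V"
    using B U V W unfolding Ya unfolding Y_def by (simp add: diagonalizes_def simps)
  then have 4: "mat_trace (B * (mat_adjoint Y * Y)) =
      (\<Sum>i<n. \<Sum>j<n. complex_of_real (b j) * (W $$ (i, j) * cnj (W $$ (i, j))))"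
    using V W by (subst sum.swap) (simp add: trace_unitary_conj trace_diag_mult
        index_mult[of _ n n _ n] sum_distrib_left mult_ac)
  have re: "Re (complex_of_real x * z) = x * Re z" for x z by simp
  have rw: "Re (z * cnj z) = (cmod z)\<^sup>2" for z
    unfolding cmod_power2 by (simp add: power2_eq_square)
  show ?thesis
    unfolding variational_def Y_def[symmetric] 1 2 3 4
    by (simp only: Re_sum re rw minus_complex.sel sum_distrib_left sum_subtractf[symmetric])
      (intro sum.cong refl, simp add: algebra_simps)
qed

definition quot_term :: "real \<Rightarrow> real \<Rightarrow> real \<Rightarrow> real" where
  "quot_term t a b = (a - b)\<^sup>2 / (t * a + (1 - t) * b)"

text \<open>
  Completing the square in \<open>W\<close>.\<close>

lemma quot_term_bound:
  assumes "0 \<le> a" "0 \<le> b" "0 < t" "t < 1"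
  shows "2 * ((a - b) * Re (M * cnj W)) - (t * a + (1 - t) * b) * (cmod W)\<^sup>2
    \<le> (cmod M)\<^sup>2 * quot_term t a b"
proof (cases "a = 0 \<and> b = 0")
  case False
  define m c where "m = t * a + (1 - t) * b" and "c = a - b"
  have m: "m > 0" using assms False unfolding m_def
    by (metis add_nonneg_pos add_pos_nonneg diff_gt_0_iff_gt less_eq_real_def mult_nonneg_nonneg mult_pos_pos)
  have "0 \<le> (cmod (complex_of_real m * W - complex_of_real c * M))\<^sup>2" by simp
  also have "\<dots> = m * (m * (cmod W)\<^sup>2) - m * (2 * (c * Re (M * cnj W))) + c\<^sup>2 * (cmod M)\<^sup>2"
    unfolding cmod_power2 by (simp add: power2_eq_square algebra_simps)
  finally have "m * (2 * (c * Re (M * cnj W)) - m * (cmod W)\<^sup>2) \<le> c\<^sup>2 * (cmod M)\<^sup>2"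
    by (simp add: algebra_simps)
  then show ?thesis using m unfolding quot_term_def m_def[symmetric] c_def[symmetric]
    by (simp add: pos_le_divide_eq mult_ac)
qed (simp add: quot_term_def)

lemma quot_term_attained:
  assumes "W = complex_of_real ((a - b) / (t * a + (1 - t) * b)) * M"
    and "0 \<le> a" "0 \<le> b" "0 < t" "t < 1"
  shows "2 * ((a - b) * Re (M * cnj W)) - (t * a + (1 - t) * b) * (cmod W)\<^sup>2
    = (cmod M)\<^sup>2 * quot_term t a b"
proof -
  define m c where "m = t * a + (1 - t) * b" and "c = a - b"
  have W: "W = complex_of_real (c / m) * M" using assms(1) by (simp add: m_def c_def)
  have 1: "Re (M * cnj W) = (c / m) * (cmod M)\<^sup>2"
    unfolding W cmod_power2 by (simp add: power2_eq_square algebra_simps add_divide_distrib)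
  have 2: "(cmod W)\<^sup>2 = (c / m)\<^sup>2 * (cmod M)\<^sup>2"
    unfolding W by (simp add: norm_mult norm_divide power_mult_distrib power_divide)
  show ?thesis unfolding quot_term_def m_def[symmetric] c_def[symmetric] 1 2
    by (cases "m = 0") (simp_all add: power2_eq_square field_simps)
qed

lemma variational_amp:
  assumes "A \<in> carrier_mat (r * m * s) (r * m * s)" "B \<in> carrier_mat (r * m * s) (r * m * s)"
    and "Y \<in> carrier_mat (r * s) (r * s)"
  shows "variational t A B (amp r m s Y) = variational t (ptr r m s A) (ptr r m s B) Y"
  using assms
  by (simp add: variational_def amp_adjoint[symmetric] amp_mult[symmetric] trace_mult_amp)

text \<open>The primitive of \<open>\<lambda>t. (1 - t) * quot_term t a b\<close>.\<close>

definition interp :: "real \<Rightarrow> real \<Rightarrow> real \<Rightarrow> real" where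
  "interp a b t = a * ln (b + t * (a - b)) - (b + t * (a - b))"

lemma interp_deriv:
  assumes "0 \<le> a" "0 \<le> b" "b = 0 \<Longrightarrow> a = 0" "0 < t" "t < 1"
  shows "((\<lambda>t. interp a b t) has_real_derivative (1 - t) * quot_term t a b) (at t)"
proof (cases "b = 0")
  case True
  then show ?thesis using assms by (simp add: interp_def quot_term_def)
next
  case False
  have "0 \<le> t * a" "0 < (1 - t) * b" using False assms by (auto simp: less_le)
  then have y: "b + t * (a - b) > 0" by (simp add: algebra_simps)
  have "((\<lambda>t. interp a b t) has_real_derivative a * ((a - b) / (b + t * (a - b))) - (a - b)) (at t)"
    unfolding interp_def using y by (auto intro!: derivative_eq_intros simp: field_simps)
  also have "a * ((a - b) / (b + t * (a - b))) - (a - b) = (1 - t) * quot_term t a b"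
  proof -
    have "t * a + (1 - t) * b = b + t * (a - b)" by (simp add: algebra_simps)
    then show ?thesis using y unfolding quot_term_def
      by (simp add: divide_simps power2_eq_square) (simp add: algebra_simps)
  qed
  finally show ?thesis .
qed

lemma interp_continuous:
  assumes "0 \<le> a" "0 \<le> b" "b = 0 \<Longrightarrow> a = 0"
  shows "continuous_on {0..1} (interp a b)"
proof (cases "a = 0")
  case True
  then show ?thesis unfolding interp_def by (auto intro!: continuous_intros)
next
  case False
  then have ab: "a > 0" "b > 0" using assms by (auto simp: less_le)
  have "b + t * (a - b) \<noteq> 0" if "t \<in> {0..1}" for t
  proof -
    have "b + t * (a - b) = t * a + (1 - t) * b" by (simp add: algebra_simps)
    moreover have "t * a + (1 - t) * b > 0"
      using ab that by (cases "t = 0") (auto intro!: add_pos_nonneg)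
    ultimately show ?thesis by simp
  qed
  then show ?thesis unfolding interp_def by (auto intro!: continuous_intros)
qed

text \<open>
  The interpolation has a singularity only if \<open>b = 0 < a\<close>; the weight must vanish there. For the
  relative entropy this is the inclusion of supports.\<close>

lemma weighted_interp:
  assumes "0 \<le> a" "0 \<le> b" "b = 0 \<Longrightarrow> a \<noteq> 0 \<Longrightarrow> w = 0"
  shows "continuous_on {0..1} (\<lambda>t. w * interp a b t)"
    "0 < t \<Longrightarrow> t < 1 \<Longrightarrow>
      ((\<lambda>t. w * interp a b t) has_real_derivative w * ((1 - t) * quot_term t a b)) (at t)"
proof -
  have w: "w = 0" if "\<not> (b = 0 \<longrightarrow> a = 0)" using assms that by auto
  show "continuous_on {0..1} (\<lambda>t. w * interp a b t)"
    using w interp_continuous[OF assms(1,2)]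
    by (cases "b = 0 \<longrightarrow> a = 0") (auto intro!: continuous_on_mult continuous_on_const)
  show "((\<lambda>t. w * interp a b t) has_real_derivative w * ((1 - t) * quot_term t a b)) (at t)"
    if "0 < t" "t < 1"
    using w interp_deriv[OF assms(1,2) _ that]
    by (cases "b = 0 \<longrightarrow> a = 0") (auto intro!: DERIV_cmult)
qed

definition rel_term :: "real \<Rightarrow> real \<Rightarrow> real" where
  "rel_term a b = a * ln a - a * ln b - a + b"

lemma interp_increment: "interp a b 1 - interp a b 0 = rel_term a b"
  by (simp add: interp_def rel_term_def)

text \<open>
  At each time of the interpolation the optimal \<open>Y\<close> for the reduced pair, tensored with the identity, is a competitor
  for the full pair, so that the full interpolation grows at least as fast.\<close>

lemma rel_entropy_ptr_mono:
  assumes A: "diagonalizes (r * m * s) A U a" and B: "diagonalizes (r * m * s) B V b"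
    and A': "diagonalizes (r * s) (ptr r m s A) U' a'" and B': "diagonalizes (r * s) (ptr r m s B) V' b'"
    and nonneg: "\<And>i. i < r * m * s \<Longrightarrow> 0 \<le> a i \<and> 0 \<le> b i" "\<And>i. i < r * s \<Longrightarrow> 0 \<le> a' i \<and> 0 \<le> b' i"
    and supp: "\<And>i j. i < r * m * s \<Longrightarrow> j < r * m * s \<Longrightarrow> b j = 0 \<Longrightarrow> a i \<noteq> 0 \<Longrightarrow>
        (mat_adjoint U * V) $$ (i, j) = 0"
    and supp': "\<And>i j. i < r * s \<Longrightarrow> j < r * s \<Longrightarrow> b' j = 0 \<Longrightarrow> a' i \<noteq> 0 \<Longrightarrow>
        (mat_adjoint U' * V') $$ (i, j) = 0"
  shows "(\<Sum>i<r * s. \<Sum>j<r * s. (cmod ((mat_adjoint U' * V') $$ (i, j)))\<^sup>2 * rel_term (a' i) (b' j))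
    \<le> (\<Sum>i<r * m * s. \<Sum>j<r * m * s. (cmod ((mat_adjoint U * V) $$ (i, j)))\<^sup>2 * rel_term (a i) (b j))"
proof -
  define N n where "N = r * m * s" and "n = r * s"
  define w where "w i j = (cmod ((mat_adjoint U * V) $$ (i, j)))\<^sup>2" for i j
  define w' where "w' i j = (cmod ((mat_adjoint U' * V') $$ (i, j)))\<^sup>2" for i j
  define H where "H t = (\<Sum>i<N. \<Sum>j<N. w i j * interp (a i) (b j) t)
      - (\<Sum>i<n. \<Sum>j<n. w' i j * interp (a' i) (b' j) t)" for t
  have c: "U \<in> carrier_mat N N" "V \<in> carrier_mat N N" "U' \<in> carrier_mat n n" "V' \<in> carrier_mat n n"
    "unitary_mat N U" "unitary_mat N V" "A \<in> carrier_mat N N" "B \<in> carrier_mat N N"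
    using A B A' B' by (auto simp: diagonalizes_def unitary_mat_def N_def n_def)
  have rate: "(\<Sum>i<n. \<Sum>j<n. w' i j * quot_term t (a' i) (b' j))
      \<le> (\<Sum>i<N. \<Sum>j<N. w i j * quot_term t (a i) (b j))" if t: "0 < t" "t < 1" for t
  proof -
    \<comment> \<open>The maximizer of \<open>quot_term_attained\<close>, entrywise in the two eigenbases.\<close>
    define W' where "W' = mat n n (\<lambda>(i, j). complex_of_real
      ((a' i - b' j) / (t * a' i + (1 - t) * b' j)) * (mat_adjoint U' * V') $$ (i, j))"
    define Y' where "Y' = U' * W' * mat_adjoint V'"
    have W'c: "W' \<in> carrier_mat n n" by (simp add: W'_def)
    then have Y'c: "Y' \<in> carrier_mat n n" using c by (auto simp: Y'_def)
    \<comment> \<open>The maximizer for the reduced pair, tensored with the identity.\<close>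
    define Y where "Y = amp r m s Y'"
    have Yc: "Y \<in> carrier_mat N N" by (simp add: Y_def N_def)
    define W where "W = mat_adjoint U * Y * V"
    have Wc: "W \<in> carrier_mat N N" using c Yc by (auto simp: W_def)
    have Y_eq: "Y = U * W * mat_adjoint V"
      using c Yc unitary_right[OF c(6)] unfolding W_def
      by (simp add: assoc_mult_mat[of _ N N _ N _ N] unitary_cancel)
    have "(\<Sum>i<n. \<Sum>j<n. w' i j * quot_term t (a' i) (b' j)) = variational t (ptr r m s A) (ptr r m s B) Y'"
      unfolding Y'_def variational_eigenbasis[OF A' B' W'c[unfolded n_def]] w'_def n_def
      by (intro sum.cong refl quot_term_attained[symmetric])
        (use t nonneg in \<open>auto simp: W'_def n_def\<close>)
    also have "\<dots> = variational t A B Y"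
      unfolding Y_def by (rule variational_amp[symmetric]) (use c Y'c in \<open>auto simp: N_def n_def\<close>)
    also have "\<dots> \<le> (\<Sum>i<N. \<Sum>j<N. w i j * quot_term t (a i) (b j))"
      unfolding Y_eq variational_eigenbasis[OF A B Wc[unfolded N_def]] w_def N_def
      by (intro sum_mono quot_term_bound) (use t nonneg in auto)
    finally show ?thesis .
  qed
  have incr: "continuous_on {0..1} (\<lambda>t. w i j * interp (a i) (b j) t)"
    "0 < t \<Longrightarrow> t < 1 \<Longrightarrow> ((\<lambda>t. w i j * interp (a i) (b j) t) has_real_derivative
      w i j * ((1 - t) * quot_term t (a i) (b j))) (at t)"
    if "i \<in> {..<N}" "j \<in> {..<N}" for i j t
    using that nonneg supp[of i j] weighted_interp[of "a i" "b j" "w i j"] by (auto simp: w_def N_def)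
  have incr': "continuous_on {0..1} (\<lambda>t. w' i j * interp (a' i) (b' j) t)"
    "0 < t \<Longrightarrow> t < 1 \<Longrightarrow> ((\<lambda>t. w' i j * interp (a' i) (b' j) t) has_real_derivative
      w' i j * ((1 - t) * quot_term t (a' i) (b' j))) (at t)"
    if "i \<in> {..<n}" "j \<in> {..<n}" for i j t
    using that nonneg supp'[of i j] weighted_interp[of "a' i" "b' j" "w' i j"] by (auto simp: w'_def n_def)
  have "H 0 \<le> H 1"
  proof (rule DERIV_nonneg_imp_increasing_open[where f = H])
    show "continuous_on {0..1} H" unfolding H_def
      by (intro continuous_on_diff continuous_on_sum incr incr')
    fix t :: real assume t: "0 < t" "t < 1"
    have "0 \<le> (1 - t) * ((\<Sum>i<N. \<Sum>j<N. w i j * quot_term t (a i) (b j)) -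
        (\<Sum>i<n. \<Sum>j<n. w' i j * quot_term t (a' i) (b' j)))"
      using rate[OF t] t by simp
    also have "\<dots> = (\<Sum>i<N. \<Sum>j<N. w i j * ((1 - t) * quot_term t (a i) (b j))) -
        (\<Sum>i<n. \<Sum>j<n. w' i j * ((1 - t) * quot_term t (a' i) (b' j)))"
      by (simp add: right_diff_distrib sum_distrib_left mult_ac)
    finally have "0 \<le> (\<Sum>i<N. \<Sum>j<N. w i j * ((1 - t) * quot_term t (a i) (b j))) -
        (\<Sum>i<n. \<Sum>j<n. w' i j * ((1 - t) * quot_term t (a' i) (b' j)))" .
    moreover have "(H has_real_derivative (\<Sum>i<N. \<Sum>j<N. w i j * ((1 - t) * quot_term t (a i) (b j))) -
        (\<Sum>i<n. \<Sum>j<n. w' i j * ((1 - t) * quot_term t (a' i) (b' j)))) (at t)"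
      unfolding H_def by (intro DERIV_diff DERIV_sum incr(2) incr'(2) t)
    ultimately show "\<exists>y. (H has_real_derivative y) (at t) \<and> 0 \<le> y" by blast
  qed simp
  moreover have "H 1 - H 0 = (\<Sum>i<N. \<Sum>j<N. w i j * rel_term (a i) (b j))
      - (\<Sum>i<n. \<Sum>j<n. w' i j * rel_term (a' i) (b' j))"
    unfolding H_def by (simp add: interp_increment[symmetric] right_diff_distrib sum_subtractf)
  ultimately show ?thesis by (simp add: w_def w'_def N_def n_def)
qed

lemma outer_less: "p < r * m * s \<Longrightarrow> outer m s p < r * s"
  by (elim ix_cases) (simp add: pair_less)

lemma sum_outer: "(\<Sum>p<r * m * s. f (outer m s p)) = of_nat m * (\<Sum>k<r * s. f k)"
  for f :: "nat \<Rightarrow> 'a::comm_semiring_1"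
proof -
  have "(\<Sum>p<r * m * s. f (outer m s p)) = (\<Sum>x<r. \<Sum>y<m. \<Sum>z<s. f (x * s + z))"
    unfolding sum_ix by (intro sum.cong refl) simp
  then show ?thesis by (simp add: sum_pair sum_distrib_left)
qed

lemma unitary_row_weights:
  assumes "unitary_mat n U" "i < n"
  shows "(\<Sum>j<n. (cmod (U $$ (i, j)))\<^sup>2) = 1"
proof -
  have "complex_of_real (\<Sum>j<n. (cmod (U $$ (i, j)))\<^sup>2) = 1"
    using unitary_rows[OF assms(1,2,2)] by (simp add: complex_norm_square del: of_real_power)
  then show ?thesis using of_real_eq_1_iff by blast
qed

lemma unitary_col_weights:
  assumes "unitary_mat n U" "j < n"
  shows "(\<Sum>i<n. (cmod (U $$ (i, j)))\<^sup>2) = 1"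
proof -
  have "complex_of_real (\<Sum>i<n. (cmod (U $$ (i, j)))\<^sup>2) = 1"
    using unitary_cols[OF assms(1,2,2)] by (simp add: complex_norm_square mult.commute del: of_real_power)
  then show ?thesis using of_real_eq_1_iff by blast
qed

lemma ent_term_ln: "ln 2 * ent_term x = - (x * ln x)"
  by (simp add: ent_term_def log_def)

text \<open>
  Both sides are \<open>tr (ptr A) h(ptr A)\<close>: a function of \<open>ptr A \<otimes> 1\<close> is the amplification of the same
  function of \<open>ptr A\<close>, and amplification is adjoint to the partial trace. Hence the relative entropy
  of \<open>A\<close> and \<open>ptr A \<otimes> 1\<close> is an entropy gap.\<close>

lemma amp_ptr_pairing:
  assumes A: "diagonalizes (r * m * s) A U a" and B: "diagonalizes (r * s) (ptr r m s A) V b"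
  shows "(\<Sum>i<r * m * s. \<Sum>j<r * m * s. (cmod ((mat_adjoint U * amp r m s V) $$ (i, j)))\<^sup>2 *
      (a i * h (outer m s j))) = (\<Sum>k<r * s. b k * h k)"
proof -
  define N n where "N = r * m * s" and "n = r * s"
  define M where "M = mat_adjoint U * amp r m s V"
  let ?D = "\<lambda>n f. mat_diag n (\<lambda>i. complex_of_real (f i))"
  have U: "U \<in> carrier_mat N N" "unitary_mat N U" and V: "V \<in> carrier_mat n n" "unitary_mat n V"
    using A B by (auto simp: diagonalizes_def unitary_mat_def N_def n_def)
  have Ac: "A \<in> carrier_mat N N" using A unfolding N_def by (rule diagonalizes_carrier)
  have W: "amp r m s V \<in> carrier_mat N N" by (simp add: N_def)
  have Mc: "M \<in> carrier_mat N N" using U W by (simp add: M_def)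
  have "mat_trace (A * amp r m s (V * ?D n h * mat_adjoint V)) =
      mat_trace (ptr r m s A * (V * ?D n h * mat_adjoint V))"
    using Ac V by (intro trace_mult_amp) (auto simp: N_def n_def)
  also have "ptr r m s A * (V * ?D n h * mat_adjoint V) = V * (?D n b * ?D n h) * mat_adjoint V"
    using B V unfolding diagonalizes_def n_def[symmetric]
    by (simp add: assoc_mult_mat[of _ n n _ n _ n] unitary_cancel[OF V(2)] del: mat_diag_diag)
  also have "mat_trace \<dots> = (\<Sum>k<n. complex_of_real (b k * h k))"
    using V by (simp add: trace_unitary_conj) (simp add: mat_trace_def mat_diag_def)
  finally have rhs: "mat_trace (A * amp r m s (V * ?D n h * mat_adjoint V)) =
      (\<Sum>k<n. complex_of_real (b k * h k))" .
  have "amp r m s (V * ?D n h * mat_adjoint V) =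
      amp r m s V * ?D N (\<lambda>p. h (outer m s p)) * mat_adjoint (amp r m s V)"
    using V unfolding n_def N_def
    by (simp add: amp_mult[OF mult_carrier_square adjoint_carrier] amp_mult amp_diag amp_adjoint)
  also have "A * \<dots> = U * (?D N a * (M * (?D N (\<lambda>p. h (outer m s p)) * mat_adjoint M))) * mat_adjoint U"
  proof -
    have "mat_adjoint (amp r m s V) = mat_adjoint M * mat_adjoint U"
      using U W unitary_right[OF U(2)] by (simp add: M_def adjoint_mult[of _ N N _ N]
          assoc_mult_mat[of _ N N _ N _ N])
    then show ?thesis
      using A U W Mc unfolding diagonalizes_def N_def[symmetric]
      by (simp add: assoc_mult_mat[of _ N N _ N _ N] M_def)
  qed
  also have "mat_trace \<dots> = (\<Sum>i<N. complex_of_real (a i) *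
      (\<Sum>j<N. M $$ (i, j) * (complex_of_real (h (outer m s j)) * cnj (M $$ (i, j)))))"
  proof -
    define Z where "Z = M * (?D N (\<lambda>p. h (outer m s p)) * mat_adjoint M)"
    have "Z $$ (i, i) = (\<Sum>j<N. M $$ (i, j) * (complex_of_real (h (outer m s j)) * cnj (M $$ (i, j))))"
      if "i < N" for i
      using Mc that by (simp add: Z_def mat_diag_mult_left[of _ N N] index_mult[of _ N N _ N])
    moreover have "Z \<in> carrier_mat N N" using Mc by (simp add: Z_def)
    ultimately show ?thesis using U unfolding Z_def[symmetric]
      by (simp add: trace_unitary_conj trace_diag_mult)
  qed
  also have "\<dots> = complex_of_real (\<Sum>i<N. \<Sum>j<N. (cmod (M $$ (i, j)))\<^sup>2 * (a i * h (outer m s j)))"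
    by (simp add: complex_norm_square sum_distrib_left mult_ac del: of_real_power)
  finally have "complex_of_real (\<Sum>i<N. \<Sum>j<N. (cmod (M $$ (i, j)))\<^sup>2 * (a i * h (outer m s j))) =
      complex_of_real (\<Sum>k<n. b k * h k)" using rhs by simp
  then show ?thesis unfolding M_def N_def n_def using of_real_eq_iff by blast
qed

text \<open>
  The pairing with the indicator function of the zero eigenvalues of \<open>ptr A\<close> is zero.\<close>

lemma amp_ptr_support:
  assumes A: "diagonalizes (r * m * s) A U a" and B: "diagonalizes (r * s) (ptr r m s A) V b"
    and nonneg: "\<And>i. i < r * m * s \<Longrightarrow> 0 \<le> a i"
    and ij: "i < r * m * s" "j < r * m * s" "b (outer m s j) = 0" "a i \<noteq> 0"
  shows "(mat_adjoint U * amp r m s V) $$ (i, j) = 0"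
proof -
  let ?N = "r * m * s"
  let ?t = "\<lambda>i j. (cmod ((mat_adjoint U * amp r m s V) $$ (i, j)))\<^sup>2 *
      (a i * (if b (outer m s j) = 0 then 1 else 0))"
  have nn: "0 \<le> ?t i j" if "i < ?N" for i j using nonneg[OF that] by simp
  have "(\<Sum>i<?N. \<Sum>j<?N. ?t i j) = 0"
    using amp_ptr_pairing[OF A B, of "\<lambda>k. if b k = 0 then 1 else 0"]
    by (simp add: if_distrib cong: if_cong)
  then have "(\<Sum>j<?N. ?t i j) = 0"
    using ij(1) nn by (subst (asm) sum_nonneg_eq_0_iff) (auto intro!: sum_nonneg)
  then have "?t i j = 0"
    using ij(1,2) nn by (subst (asm) sum_nonneg_eq_0_iff) auto
  then show ?thesis using ij(3,4) by simp
qed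

text \<open>
  The summands \<open>-1\<close> and \<open>m\<close> are the traces of \<open>-A\<close> and \<open>ptr A \<otimes> 1\<close>.\<close>

lemma rel_entropy_amp_ptr:
  assumes st: "state (r * m * s) A"
    and A: "diagonalizes (r * m * s) A U a" and B: "diagonalizes (r * s) (ptr r m s A) V b"
  shows "(\<Sum>i<r * m * s. \<Sum>j<r * m * s. (cmod ((mat_adjoint U * amp r m s V) $$ (i, j)))\<^sup>2 *
      rel_term (a i) (b (outer m s j))) = ln 2 * (entropy (ptr r m s A) - entropy A) - 1 + real m"
proof -
  define N n where "N = r * m * s" and "n = r * s"
  define w where "w i j = (cmod ((mat_adjoint U * amp r m s V) $$ (i, j)))\<^sup>2" for i j
  have Mu: "unitary_mat N (mat_adjoint U * amp r m s V)"
    using A B unfolding diagonalizes_def N_def by (intro unitary_mult unitary_adjoint amp_unitary) auto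
  have "complex_of_real (\<Sum>i<N. a i) = 1" "complex_of_real (\<Sum>i<n. b i) = 1"
    using diagonalizes_trace[OF A] diagonalizes_trace[OF B] st state_ptr[OF st]
    by (simp_all add: state_def N_def n_def)
  then have sums: "(\<Sum>i<N. a i) = 1" "(\<Sum>i<n. b i) = 1" using of_real_eq_1_iff by blast+
  have 1: "(\<Sum>i<N. \<Sum>j<N. w i j * f i) = (\<Sum>i<N. f i)" for f :: "nat \<Rightarrow> real"
    by (simp add: sum_distrib_right[symmetric] w_def unitary_row_weights[OF Mu])
  have 2: "(\<Sum>i<N. \<Sum>j<N. w i j * f j) = (\<Sum>j<N. f j)" for f :: "nat \<Rightarrow> real"
    by (subst sum.swap) (simp add: sum_distrib_right[symmetric] w_def unitary_col_weights[OF Mu])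
  have "(\<Sum>i<N. \<Sum>j<N. w i j * rel_term (a i) (b (outer m s j))) =
      (\<Sum>i<N. \<Sum>j<N. w i j * (a i * ln (a i))) - (\<Sum>i<N. \<Sum>j<N. w i j * (a i * ln (b (outer m s j))))
      - (\<Sum>i<N. \<Sum>j<N. w i j * a i) + (\<Sum>i<N. \<Sum>j<N. w i j * b (outer m s j))"
    by (simp add: rel_term_def sum_subtractf[symmetric] sum.distrib[symmetric] algebra_simps)
  also have "\<dots> = (\<Sum>i<N. a i * ln (a i)) - (\<Sum>k<n. b k * ln (b k)) - 1 + real m"
    using amp_ptr_pairing[OF A B, of "\<lambda>k. ln (b k)"] sum_outer[of b m s r] sums
    unfolding w_def[symmetric] N_def[symmetric] n_def[symmetric] by (simp add: 1 2)
  also have "\<dots> = ln 2 * (entropy (ptr r m s A) - entropy A) - 1 + real m"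
    unfolding entropy_diagonalizes[OF A] entropy_diagonalizes[OF B]
    by (simp add: right_diff_distrib sum_distrib_left ent_term_ln sum_negf N_def n_def)
  finally show ?thesis by (simp add: w_def N_def)
qed

text \<open>
  The entropy gap \<open>S(ptr X) - S(X)\<close> for the loss of \<open>m2\<close> is, up to a constant, the relative entropy
  of \<open>X\<close> and \<open>ptr X \<otimes> 1\<close>. Tracing \<open>m1\<close> out of both matrices leaves a pair of the same form, so
  monotonicity compares two such gaps.\<close>

theorem strong_subadditivity:
  assumes X: "state (r * m1 * m2 * s) X"
  shows "entropy X + entropy (ptr r m1 s (ptr (r * m1) m2 s X)) \<le>
    entropy (ptr (r * m1) m2 s X) + entropy (ptr r m1 (m2 * s) X)"
proof -
  \<comment> \<open>The two partial traces group the four factors differently.\<close>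
  have N: "r * m1 * (m2 * s) = r * m1 * m2 * s" and n: "r * (m2 * s) = r * m2 * s"
    by (simp_all add: mult.assoc)
  define B0 X' where "B0 = ptr (r * m1) m2 s X" and "X' = ptr r m1 (m2 * s) X"
  have Xc: "X \<in> carrier_mat (r * m1 * m2 * s) (r * m1 * m2 * s)" using X by (rule state_carrier)
  have B0: "state (r * m1 * s) B0" unfolding B0_def by (rule state_ptr[OF X])
  have X': "state (r * m2 * s) X'"
    using state_ptr[of r m1 "m2 * s" X] X unfolding X'_def N n by simp
  have B0': "ptr r m2 s X' = ptr r m1 s B0"
    unfolding X'_def B0_def by (rule ptr_ptr[OF Xc, symmetric])
  have amp': "ptr r m1 (m2 * s) (amp (r * m1) m2 s B0) = amp r m2 s (ptr r m2 s X')"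
    unfolding B0' by (rule ptr_amp[OF state_carrier[OF B0]])
  obtain U a where U: "diagonalizes (r * m1 * m2 * s) X U a"
    and a: "\<And>i. i < r * m1 * m2 * s \<Longrightarrow> 0 \<le> a i" using state_diagonalizes[OF X] by metis
  obtain V b where V: "diagonalizes (r * m1 * s) (ptr (r * m1) m2 s X) V b"
    and b: "\<And>i. i < r * m1 * s \<Longrightarrow> 0 \<le> b i" using state_diagonalizes[OF B0] unfolding B0_def by metis
  obtain U' a' where U': "diagonalizes (r * m2 * s) X' U' a'"
    and a': "\<And>i. i < r * m2 * s \<Longrightarrow> 0 \<le> a' i" using state_diagonalizes[OF X'] by metis
  obtain V' b' where V': "diagonalizes (r * s) (ptr r m2 s X') V' b'"
    and b': "\<And>i. i < r * s \<Longrightarrow> 0 \<le> b' i" using state_diagonalizes[OF state_ptr[OF X']] by metis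
  have "ln 2 * (entropy (ptr r m2 s X') - entropy X') - 1 + real m2 \<le>
      ln 2 * (entropy (ptr (r * m1) m2 s X) - entropy X) - 1 + real m2"
    unfolding rel_entropy_amp_ptr[OF X' U' V', symmetric] rel_entropy_amp_ptr[OF X U V, symmetric]
  proof (rule rel_entropy_ptr_mono[where r = r and m = m1 and s = "m2 * s", unfolded N n])
    show "diagonalizes (r * m1 * m2 * s) (amp (r * m1) m2 s B0) (amp (r * m1) m2 s V) (\<lambda>j. b (outer m2 s j))"
      unfolding B0_def by (rule amp_diagonalizes[OF V])
    show "diagonalizes (r * m2 * s) (ptr r m1 (m2 * s) (amp (r * m1) m2 s B0)) (amp r m2 s V')
        (\<lambda>j. b' (outer m2 s j))"
      unfolding amp' by (rule amp_diagonalizes[OF V'])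
    show "diagonalizes (r * m2 * s) (ptr r m1 (m2 * s) X) U' a'" using U' unfolding X'_def .
  qed (use U a b a' b' outer_less amp_ptr_support[OF U V a] amp_ptr_support[OF U' V' a'] in auto)
  then have "entropy (ptr r m2 s X') - entropy X' \<le> entropy (ptr (r * m1) m2 s X) - entropy X" by simp
  moreover have e: "ptr r m1 s (ptr (r * m1) m2 s X) = ptr r m2 s X'"
    using B0' unfolding B0_def by simp
  ultimately show ?thesis unfolding e X'_def[symmetric] by simp
qed

lemma entropy_trivial: "state 1 X \<Longrightarrow> entropy X = 0"
proof -
  assume "state 1 X"
  then obtain U e where U: "diagonalizes 1 X U e" "(\<Sum>k<1. e k) = 1"
    by (rule state_diagonalizes)
  then show ?thesis using entropy_diagonalizes[OF U(1)] by simp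
qed

lemma subadditivity:
  assumes "state (m1 * m2) X"
  shows "entropy X \<le> entropy (ptr m1 m2 1 X) + entropy (ptr 1 m1 m2 X)"
proof -
  have "state 1 (ptr 1 m1 1 (ptr m1 m2 1 X))"
    using state_ptr[of 1 m1 1] state_ptr[of m1 m2 1 X] assms by simp
  then show ?thesis
    using strong_subadditivity[of 1 m1 m2 1 X] assms entropy_trivial by simp
qed

section \<open>Elementary entropy inequalities\<close>

text \<open>
  The tangent of the concave function \<open>-x ln x\<close> at \<open>y\<close>.\<close>

lemma ent_term_tangent:
  assumes "0 \<le> x" "0 < y"
  shows "ln 2 * ent_term x \<le> - (x * ln y) - x + y"
proof (cases "x = 0")
  case False
  then have x: "x > 0" using assms by simp
  have "ln (y / x) \<le> y / x - 1" using x assms by (intro ln_le_minus_one) simp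
  then have "x * ln (y / x) \<le> x * (y / x - 1)" using x by simp
  also have "\<dots> = y - x" using x by (simp add: field_simps)
  finally show ?thesis unfolding ent_term_ln using x assms by (simp add: ln_div algebra_simps)
qed (use assms in simp)

lemma ent_term_jensen:
  assumes fin: "finite I" and w: "\<And>i. i \<in> I \<Longrightarrow> 0 \<le> w i" "(\<Sum>i\<in>I. w i) = 1"
    and x: "\<And>i. i \<in> I \<Longrightarrow> 0 \<le> x i"
  shows "(\<Sum>i\<in>I. w i * ent_term (x i)) \<le> ent_term (\<Sum>i\<in>I. w i * x i)"
proof -
  define y where "y = (\<Sum>i\<in>I. w i * x i)"
  have y0: "0 \<le> y" unfolding y_def using w x by (intro sum_nonneg) auto
  show ?thesis
  proof (cases "y = 0")
    case True
    then have "w i * x i = 0" if "i \<in> I" for i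
      using sum_nonneg_eq_0_iff[OF fin, of "\<lambda>i. w i * x i"] w x that unfolding y_def by auto
    then have "w i * ent_term (x i) = 0" if "i \<in> I" for i using that by fastforce
    then show ?thesis using True unfolding y_def by simp
  next
    case False
    then have yp: "y > 0" using y0 by simp
    have "ln 2 * (\<Sum>i\<in>I. w i * ent_term (x i)) = (\<Sum>i\<in>I. w i * (ln 2 * ent_term (x i)))"
      by (simp add: sum_distrib_left mult_ac)
    also have "\<dots> \<le> (\<Sum>i\<in>I. w i * (- (x i * ln y) - x i + y))"
      using w x yp by (intro sum_mono mult_left_mono ent_term_tangent) auto
    also have "\<dots> = - ((\<Sum>i\<in>I. w i * x i) * ln y) - (\<Sum>i\<in>I. w i * x i) + y * (\<Sum>i\<in>I. w i)"
      by (simp add: sum_distrib_left sum_distrib_right algebra_simps sum.distrib sum_subtractf sum_negf)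
    also have "\<dots> = - (y * ln y) - y + y * (\<Sum>i\<in>I. w i)"
      by (simp add: y_def)
    also have "\<dots> = ln 2 * ent_term y" using w(2) by (simp add: ent_term_ln)
    finally show ?thesis unfolding y_def by simp
  qed
qed

lemma ent_term_concave:
  assumes "0 \<le> q" "q \<le> 1" "0 \<le> x" "0 \<le> y"
  shows "q * ent_term x + (1 - q) * ent_term y \<le> ent_term (q * x + (1 - q) * y)"
proof -
  let ?w = "\<lambda>b. if b then q else 1 - q" and ?x = "\<lambda>b. if b then x else y"
  have "(\<Sum>b\<in>UNIV. ?w b * ent_term (?x b)) \<le> ent_term (\<Sum>b\<in>UNIV. ?w b * ?x b)"
    by (rule ent_term_jensen) (use assms in \<open>auto simp: UNIV_bool\<close>)
  then show ?thesis by (simp add: UNIV_bool add.commute)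
qed

lemma ent_term_nonneg: "0 \<le> x \<Longrightarrow> x \<le> 1 \<Longrightarrow> 0 \<le> ent_term x"
  by (cases "x = 0") (auto simp: ent_term_def mult_nonneg_nonpos)

lemma entropy_nonneg: "state n X \<Longrightarrow> 0 \<le> entropy X"
proof -
  assume X: "state n X"
  obtain U e where U: "diagonalizes n X U e" and e: "\<And>k. k < n \<Longrightarrow> 0 \<le> e k" "(\<Sum>k<n. e k) = 1"
    using state_diagonalizes[OF X] by metis
  have "e k \<le> 1" if "k < n" for k
    using member_le_sum[of k "{..<n}" e] e that by auto
  then show ?thesis unfolding entropy_diagonalizes[OF U]
    using e by (intro sum_nonneg ent_term_nonneg) auto
qed

lemma entropy_le_log_dim: "state n X \<Longrightarrow> entropy X \<le> log 2 n"
proof -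
  assume X: "state n X"
  obtain U e where U: "diagonalizes n X U e" and e: "\<And>k. k < n \<Longrightarrow> 0 \<le> e k" "(\<Sum>k<n. e k) = 1"
    using state_diagonalizes[OF X] by metis
  have n: "n > 0" using e(2) by (cases n) auto
  have "ln 2 * entropy X = (\<Sum>k<n. ln 2 * ent_term (e k))"
    unfolding entropy_diagonalizes[OF U] by (simp add: sum_distrib_left)
  also have "\<dots> \<le> (\<Sum>k<n. - (e k * ln (1 / n)) - e k + 1 / n)"
    using e n by (intro sum_mono ent_term_tangent) auto
  also have "\<dots> = - ln (1 / n)"
    using e(2) n by (simp add: sum.distrib sum_subtractf sum_negf sum_distrib_right[symmetric])
  also have "\<dots> = ln n" using n by (simp add: ln_div)
  finally show ?thesis by (simp add: log_def field_simps)
qed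

text \<open>
  The diagonal of a positive matrix in any orthonormal basis is an average of its eigenvalues
  with doubly stochastic weights.\<close>

lemma entropy_le_diagonal:
  assumes A: "diagonalizes n A U a" and a: "\<And>k. k < n \<Longrightarrow> 0 \<le> a k" and W: "unitary_mat n W"
    and x: "\<And>k. k < n \<Longrightarrow> complex_of_real (x k) = (\<Sum>i<n. \<Sum>j<n. A $$ (i, j) * W $$ (j, k) * cnj (W $$ (i, k)))"
  shows "entropy A \<le> (\<Sum>k<n. ent_term (x k))" "\<And>k. k < n \<Longrightarrow> 0 \<le> x k"
proof -
  define M where "M = mat_adjoint U * W"
  have U: "unitary_mat n U" "U \<in> carrier_mat n n" and Wc: "W \<in> carrier_mat n n"
    using A W by (auto simp: diagonalizes_def unitary_mat_def)
  have Mu: "unitary_mat n M" unfolding M_def using U W by (intro unitary_mult unitary_adjoint)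
  have M: "M \<in> carrier_mat n n" using Mu by (simp add: unitary_mat_def)
  have Ac: "A \<in> carrier_mat n n" using A by (rule diagonalizes_carrier)
  have x_eq: "x k = (\<Sum>i<n. (cmod (M $$ (i, k)))\<^sup>2 * a i)" if k: "k < n" for k
  proof -
    have "complex_of_real (x k) = (mat_adjoint W * (A * W)) $$ (k, k)"
      using Wc Ac k by (simp add: x index_mult[of _ n n _ n] sum_distrib_left mult_ac)
    also have "mat_adjoint W * (A * W) = mat_adjoint M * (mat_diag n (\<lambda>i. complex_of_real (a i)) * M)"
      using A U Wc by (simp add: diagonalizes_def M_def adjoint_mult[of _ n n _ n]
          assoc_mult_mat[of _ n n _ n _ n])
    also have "\<dots> $$ (k, k) = (\<Sum>i<n. cnj (M $$ (i, k)) * (complex_of_real (a i) * M $$ (i, k)))"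
      using M k by (simp add: index_mult[of _ n n _ n] mat_diag_mult_left[of _ n n])
    also have "\<dots> = complex_of_real (\<Sum>i<n. (cmod (M $$ (i, k)))\<^sup>2 * a i)"
      by (simp add: complex_norm_square mult_ac del: of_real_power)
    finally show ?thesis using of_real_eq_iff by blast
  qed
  show "0 \<le> x k" if "k < n" for k using a x_eq[OF that] by (auto intro!: sum_nonneg)
  have "entropy A = (\<Sum>i<n. (\<Sum>k<n. (cmod (M $$ (i, k)))\<^sup>2) * ent_term (a i))"
    unfolding entropy_diagonalizes[OF A] by (simp add: unitary_row_weights[OF Mu])
  also have "\<dots> = (\<Sum>k<n. \<Sum>i<n. (cmod (M $$ (i, k)))\<^sup>2 * ent_term (a i))"
    by (subst sum.swap) (simp add: sum_distrib_right)
  also have "\<dots> \<le> (\<Sum>k<n. ent_term (x k))"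
    using a by (intro sum_mono) (auto simp: x_eq unitary_col_weights[OF Mu] intro!: ent_term_jensen)
  finally show "entropy A \<le> (\<Sum>k<n. ent_term (x k))" .
qed

text \<open>
  In the eigenbasis of the mixture its eigenvalues are mixtures of the diagonals of \<open>X\<close> and \<open>Z\<close>, which
  have at least the entropies of \<open>X\<close> and \<open>Z\<close>.\<close>

lemma entropy_concave:
  assumes X: "pos_semidef n X" and Z: "pos_semidef n Z" and q: "0 \<le> q" "q \<le> 1"
    and C: "C = complex_of_real q \<cdot>\<^sub>m X + complex_of_real (1 - q) \<cdot>\<^sub>m Z"
    and Cp: "pos_semidef n C"
  shows "q * entropy X + (1 - q) * entropy Z \<le> entropy C"
proof -
  obtain W c where W: "diagonalizes n C W c" using pos_semidef_diagonalizes[OF Cp] by metis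
  have Wu: "unitary_mat n W" using W by (simp add: diagonalizes_def)
  have Xc: "X \<in> carrier_mat n n" and Zc: "Z \<in> carrier_mat n n"
    using X Z by (auto simp: pos_semidef_def)
  define f where "f A k = (\<Sum>i<n. \<Sum>j<n. A $$ (i, j) * W $$ (j, k) * cnj (W $$ (i, k)))" for A k
  have f_real: "f A k = complex_of_real (Re (f A k))" if "pos_semidef n A" for A k
  proof -
    have "0 \<le> f A k" using that unfolding f_def pos_semidef_iff by auto
    then show ?thesis by (simp add: less_eq_complex_def complex_eq_iff)
  qed
  obtain U a where U: "diagonalizes n X U a" "\<And>k. k < n \<Longrightarrow> 0 \<le> a k"
    using pos_semidef_diagonalizes[OF X] by metis
  obtain V b where V: "diagonalizes n Z V b" "\<And>k. k < n \<Longrightarrow> 0 \<le> b k"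
    using pos_semidef_diagonalizes[OF Z] by metis
  have fX: "complex_of_real (Re (f X k)) = (\<Sum>i<n. \<Sum>j<n. X $$ (i, j) * W $$ (j, k) * cnj (W $$ (i, k)))" for k
    unfolding f_def[symmetric] by (rule f_real[OF X, symmetric])
  note x = entropy_le_diagonal[OF U Wu fX]
  have fZ: "complex_of_real (Re (f Z k)) = (\<Sum>i<n. \<Sum>j<n. Z $$ (i, j) * W $$ (j, k) * cnj (W $$ (i, k)))" for k
    unfolding f_def[symmetric] by (rule f_real[OF Z, symmetric])
  note z = entropy_le_diagonal[OF V Wu fZ]
  have c: "c k = q * Re (f X k) + (1 - q) * Re (f Z k)" if "k < n" for k
  proof -
    have "complex_of_real (c k) = f C k" unfolding f_def by (rule diagonalizes_quadratic[OF W that])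
    also have "\<dots> = complex_of_real q * f X k + complex_of_real (1 - q) * f Z k"
      using Xc Zc that unfolding f_def C sum_distrib_left sum.distrib[symmetric]
      by (intro sum.cong refl) (simp add: algebra_simps)
    finally have "Re (complex_of_real (c k)) = Re (complex_of_real q * f X k + complex_of_real (1 - q) * f Z k)"
      by simp
    then show ?thesis by simp
  qed
  have "q * entropy X + (1 - q) * entropy Z \<le>
      q * (\<Sum>k<n. ent_term (Re (f X k))) + (1 - q) * (\<Sum>k<n. ent_term (Re (f Z k)))"
    using x z q by (intro add_mono mult_left_mono) auto
  also have "\<dots> = (\<Sum>k<n. q * ent_term (Re (f X k)) + (1 - q) * ent_term (Re (f Z k)))"
    by (simp add: sum_distrib_left sum.distrib)
  also have "\<dots> \<le> (\<Sum>k<n. ent_term (c k))"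
    using x z q by (intro sum_mono) (auto simp: c intro!: ent_term_concave)
  finally show ?thesis unfolding entropy_diagonalizes[OF W] .
qed

lemma diagonalizes_smult:
  assumes "diagonalizes n A U e"
  shows "diagonalizes n (complex_of_real c \<cdot>\<^sub>m A) U (\<lambda>k. c * e k)"
proof -
  have U: "U \<in> carrier_mat n n" using assms by (simp add: diagonalizes_def unitary_mat_def)
  have "mat_diag n (\<lambda>i. complex_of_real (c * e i)) = complex_of_real c \<cdot>\<^sub>m mat_diag n (\<lambda>i. complex_of_real (e i))"
    by (intro eq_matI) (auto simp: mat_diag_def)
  then show ?thesis using assms U
    by (simp add: diagonalizes_def mult_smult_distrib[of _ n n _ n] mult_smult_assoc_mat[of _ n n _ n])
qed

lemma entropy_amp:
  assumes Y: "state (r * s) Y" and m: "m > 0"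
  shows "entropy (complex_of_real (1 / real m) \<cdot>\<^sub>m amp r m s Y) = entropy Y + log 2 m"
proof -
  obtain U e where U: "diagonalizes (r * s) Y U e" and e: "\<And>k. k < r * s \<Longrightarrow> 0 \<le> e k" "(\<Sum>k<r * s. e k) = 1"
    using state_diagonalizes[OF Y] by metis
  have t: "real m * ent_term (e k / m) = ent_term (e k) + e k * log 2 m" if "k < r * s" for k
    using e(1)[OF that] m by (cases "e k = 0") (auto simp: ent_term_def log_divide algebra_simps)
  have "entropy (complex_of_real (1 / real m) \<cdot>\<^sub>m amp r m s Y) = real m * (\<Sum>k<r * s. ent_term (e k / m))"
    using entropy_diagonalizes[OF diagonalizes_smult[where c = "1 / real m", OF amp_diagonalizes[OF U, of m]]]
      sum_outer[of "\<lambda>k. ent_term (e k / m)"] by simp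
  also have "\<dots> = (\<Sum>k<r * s. ent_term (e k)) + (\<Sum>k<r * s. e k) * log 2 m"
    by (simp add: sum_distrib_left sum_distrib_right t sum.distrib)
  finally show ?thesis unfolding entropy_diagonalizes[OF U] using e(2) by simp
qed

section \<open>Channels applied to the middle tensor factor\<close>

text \<open>
  The entries of \<open>F\<close> as a linear map, which are also those of its Choi matrix.\<close>

definition kernel :: "superop \<Rightarrow> nat \<Rightarrow> nat \<Rightarrow> nat \<Rightarrow> nat \<Rightarrow> complex" where
  "kernel F i j a b = app F (mat_unit (dim_in F) i j) $$ (a, b)"

text \<open>
  \<open>id\<^sub>r \<otimes> F \<otimes> id\<^sub>s\<close>.\<close>

definition apply_mid :: "nat \<Rightarrow> superop \<Rightarrow> nat \<Rightarrow> complex mat \<Rightarrow> complex mat" where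
  "apply_mid r F s X = mat (r * dim_out F * s) (r * dim_out F * s) (\<lambda>(p, q).
     \<Sum>i<dim_in F. \<Sum>j<dim_in F.
       X $$ (ix (dim_in F) s (p div s div dim_out F) i (p mod s),
             ix (dim_in F) s (q div s div dim_out F) j (q mod s))
       * kernel F i j (p div s mod dim_out F) (q div s mod dim_out F))"

text \<open>
  A superoperator is an arbitrary function on matrices, whereas tensor products only use its values
  on matrix units; this condition says that these determine it.\<close>

definition linear_op :: "superop \<Rightarrow> bool" where
  "linear_op F \<longleftrightarrow> (\<forall>X\<in>carrier_mat (dim_in F) (dim_in F). app F X = apply_mid 1 F 1 X)"

lemma apply_mid_carrier [simp]: "apply_mid r F s X \<in> carrier_mat (r * dim_out F * s) (r * dim_out F * s)"
  by (simp add: apply_mid_def)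

lemma apply_mid_index:
  assumes "x < r" "a < dim_out F" "z < s" "x' < r" "a' < dim_out F" "z' < s"
  shows "apply_mid r F s X $$ (ix (dim_out F) s x a z, ix (dim_out F) s x' a' z') =
    (\<Sum>i<dim_in F. \<Sum>j<dim_in F. X $$ (ix (dim_in F) s x i z, ix (dim_in F) s x' j z') * kernel F i j a a')"
  using assms by (simp add: apply_mid_def ix_less)

lemma apply_mid_index_assoc:
  assumes "x < r" "a < dim_out F" "b < n" "z < s" "x' < r" "a' < dim_out F" "b' < n" "z' < s"
  shows "apply_mid r F (n * s) X $$ (ix n s (x * dim_out F + a) b z, ix n s (x' * dim_out F + a') b' z') =
    (\<Sum>i<dim_in F. \<Sum>j<dim_in F.
      X $$ (ix n s (x * dim_in F + i) b z, ix n s (x' * dim_in F + j) b' z') * kernel F i j a a')"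
  using apply_mid_index[of x r a F "b * s + z" "n * s" x' a' "b' * s + z'" X] assms
  by (simp only: ix_assoc pair_less simp_thms)

lemma dim_tensor [simp]:
  "dim_in (F \<otimes>\<^sub>o G) = dim_in F * dim_in G" "dim_out (F \<otimes>\<^sub>o G) = dim_out F * dim_out G"
  by (simp_all add: tensor_op_def)

lemma app_tensor_index:
  assumes "a < dim_out F" "b < dim_out G" "a' < dim_out F" "b' < dim_out G"
  shows "app (F \<otimes>\<^sub>o G) X $$ (a * dim_out G + b, a' * dim_out G + b') =
    (\<Sum>i<dim_in F. \<Sum>j<dim_in F. \<Sum>k<dim_in G. \<Sum>l<dim_in G.
       X $$ (i * dim_in G + k, j * dim_in G + l) * kernel F i j a a' * kernel G k l b b')"
  using assms by (simp add: tensor_op_def pair_less kernel_def)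

lemma sum_delta2:
  fixes f :: "nat \<Rightarrow> nat \<Rightarrow> 'a::comm_semiring_1"
  assumes "i < m" "j < n"
  shows "(\<Sum>i'<m. \<Sum>j'<n. (if i' = i \<and> j' = j then 1 else 0) * f i' j') = f i j"
proof -
  have "(if i' = i \<and> j' = j then 1 else 0) * f i' j' = (if j' = j then (if i' = i then f i j else 0) else 0)"
    for i' j' by simp
  then show ?thesis using assms by simp
qed

lemma kernel_tensor:
  assumes "i < dim_in F" "k < dim_in G" "j < dim_in F" "l < dim_in G"
    and "a < dim_out F" "b < dim_out G" "a' < dim_out F" "b' < dim_out G"
  shows "kernel (F \<otimes>\<^sub>o G) (i * dim_in G + k) (j * dim_in G + l) (a * dim_out G + b) (a' * dim_out G + b') =
    kernel F i j a a' * kernel G k l b b'"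
proof -
  have inj: "i' * dim_in G + k' = i * dim_in G + k \<longleftrightarrow> i' = i \<and> k' = k"
    if "k' < dim_in G" "k < dim_in G" for i' k' i k
    using that by (metis pair_div pair_mod)
  have "kernel (F \<otimes>\<^sub>o G) (i * dim_in G + k) (j * dim_in G + l) (a * dim_out G + b) (a' * dim_out G + b') =
      (\<Sum>i'<dim_in F. \<Sum>j'<dim_in F. \<Sum>k'<dim_in G. \<Sum>l'<dim_in G.
         (if i' = i \<and> j' = j then 1 else 0) * ((if k' = k \<and> l' = l then 1 else 0) *
           (kernel F i' j' a a' * kernel G k' l' b b')))"
    unfolding kernel_def[of "F \<otimes>\<^sub>o G"]
    using assms by (simp only: app_tensor_index) (auto simp: mat_unit_def pair_less inj intro!: sum.cong)
  also have "\<dots> = (\<Sum>i'<dim_in F. \<Sum>j'<dim_in F. (if i' = i \<and> j' = j then 1 else 0) *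
      (\<Sum>k'<dim_in G. \<Sum>l'<dim_in G. (if k' = k \<and> l' = l then 1 else 0) *
           (kernel F i' j' a a' * kernel G k' l' b b')))"
    by (simp only: sum_distrib_left)
  also have "\<dots> = kernel F i j a a' * kernel G k l b b'"
    using assms by (simp only: sum_delta2)
  finally show ?thesis .
qed

lemma linear_tensor: "linear_op (F \<otimes>\<^sub>o G)"
  unfolding linear_op_def
proof
  fix X :: "complex mat" assume "X \<in> carrier_mat (dim_in (F \<otimes>\<^sub>o G)) (dim_in (F \<otimes>\<^sub>o G))"
  show "app (F \<otimes>\<^sub>o G) X = apply_mid 1 (F \<otimes>\<^sub>o G) 1 X"
  proof (rule eq_mat_pair[of _ "dim_out F" "dim_out G"])
    fix a b a' b' assume ab: "a < dim_out F" "b < dim_out G" "a' < dim_out F" "b' < dim_out G"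
    have "apply_mid 1 (F \<otimes>\<^sub>o G) 1 X $$ (a * dim_out G + b, a' * dim_out G + b') =
        (\<Sum>p<dim_in F * dim_in G. \<Sum>q<dim_in F * dim_in G. X $$ (p, q) *
           kernel (F \<otimes>\<^sub>o G) p q (a * dim_out G + b) (a' * dim_out G + b'))"
      using apply_mid_index[of 0 1 "a * dim_out G + b" "F \<otimes>\<^sub>o G" 0 1 0 "a' * dim_out G + b'" 0 X] ab
      by (simp add: pair_less)
    also have "\<dots> = (\<Sum>i<dim_in F. \<Sum>k<dim_in G. \<Sum>j<dim_in F. \<Sum>l<dim_in G.
        X $$ (i * dim_in G + k, j * dim_in G + l) * kernel F i j a a' * kernel G k l b b')"
      using ab by (auto simp: sum_pair kernel_tensor mult.assoc intro!: sum.cong)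
    also have "\<dots> = (\<Sum>i<dim_in F. \<Sum>j<dim_in F. \<Sum>k<dim_in G. \<Sum>l<dim_in G.
        X $$ (i * dim_in G + k, j * dim_in G + l) * kernel F i j a a' * kernel G k l b b')"
      by (rule sum.cong[OF refl], rule sum.swap)
    finally show "app (F \<otimes>\<^sub>o G) X $$ (a * dim_out G + b, a' * dim_out G + b') =
        apply_mid 1 (F \<otimes>\<^sub>o G) 1 X $$ (a * dim_out G + b, a' * dim_out G + b')"
      using ab by (simp only: app_tensor_index)
  qed (use apply_mid_carrier[of 1 "F \<otimes>\<^sub>o G" 1 X] in \<open>auto simp: tensor_op_def\<close>)
qed

text \<open>
  Having bystanders on both sides makes this composition possible without permuting factors: each
  of \<open>F\<close> and \<open>G\<close> treats the other system as part of a bystander.\<close>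

lemma apply_mid_tensor:
  "apply_mid r (F \<otimes>\<^sub>o G) s X = apply_mid r F (dim_out G * s) (apply_mid (r * dim_in F) G s X)" (is "?L = ?R")
proof (rule eq_mat_ix[of _ "r * dim_out F" "dim_out G" s])
  fix p b z p' b' z'
  let ?p = "ix (dim_out G) s p b z" and ?p' = "ix (dim_out G) s p' b' z'"
  assume "p < r * dim_out F" and b: "b < dim_out G" "z < s" and "p' < r * dim_out F" and b': "b' < dim_out G" "z' < s"
  then obtain x a x' a' where a: "x < r" "a < dim_out F" "x' < r" "a' < dim_out F"
    and p: "p = x * dim_out F + a" "p' = x' * dim_out F + a'" by (metis pair_cases)
  have ixF: "?p = ix (dim_out F * dim_out G) s x (a * dim_out G + b) z"
    "?p' = ix (dim_out F * dim_out G) s x' (a' * dim_out G + b') z'"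
    by (simp_all add: p ix_assoc)
  have "?L $$ (?p, ?p') =
      (\<Sum>i<dim_in F. \<Sum>k<dim_in G. \<Sum>j<dim_in F. \<Sum>l<dim_in G.
        X $$ (ix (dim_in G) s (x * dim_in F + i) k z, ix (dim_in G) s (x' * dim_in F + j) l z') *
        (kernel F i j a a' * kernel G k l b b'))"
    using apply_mid_index[of x r "a * dim_out G + b" "F \<otimes>\<^sub>o G" z s x' "a' * dim_out G + b'" z' X] a b b'
    unfolding ixF by (simp add: pair_less sum_pair kernel_tensor ix_assoc)
  also have "\<dots> = (\<Sum>i<dim_in F. \<Sum>j<dim_in F. \<Sum>k<dim_in G. \<Sum>l<dim_in G.
        X $$ (ix (dim_in G) s (x * dim_in F + i) k z, ix (dim_in G) s (x' * dim_in F + j) l z') *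
        (kernel F i j a a' * kernel G k l b b'))"
    by (rule sum.cong[OF refl], rule sum.swap)
  also have "\<dots> = (\<Sum>i<dim_in F. \<Sum>j<dim_in F.
        apply_mid (r * dim_in F) G s X $$ (ix (dim_out G) s (x * dim_in F + i) b z, ix (dim_out G) s (x' * dim_in F + j) b' z') *
        kernel F i j a a')"
    using a b b' by (intro sum.cong refl) (simp add: apply_mid_index pair_less sum_distrib_right mult.assoc[of "X $$ _"]
        mult.commute[of "kernel G _ _ _ _" "kernel F _ _ _ _"])
  also have "\<dots> = ?R $$
      (?p, ?p')"
    unfolding p using a b b' by (simp only: apply_mid_index_assoc)
  finally show "?L $$ (?p, ?p') =
      ?R $$ (?p, ?p')" .
next
  show "apply_mid r (F \<otimes>\<^sub>o G) s X \<in> carrier_mat (r * dim_out F * dim_out G * s) (r * dim_out F * dim_out G * s)"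
    using apply_mid_carrier[of r "F \<otimes>\<^sub>o G" s X] by (simp add: mult.assoc)
  show "apply_mid r F (dim_out G * s) (apply_mid (r * dim_in F) G s X) \<in>
      carrier_mat (r * dim_out F * dim_out G * s) (r * dim_out F * dim_out G * s)"
    using apply_mid_carrier[of r F "dim_out G * s"] by (simp add: mult.assoc)
qed

lemma ptr_left_apply_mid:
  "ptr r m (dim_out G * s) (apply_mid (r * m) G s X) = apply_mid r G s (ptr r m (dim_in G * s) X)" (is "?L = ?R")
proof (rule eq_mat_ix[of _ r "dim_out G" s])
  fix x b z x' b' z'
  assume b: "x < r" "b < dim_out G" "z < s" "x' < r" "b' < dim_out G" "z' < s"
  let ?p = "ix (dim_out G) s x b z" and ?p' = "ix (dim_out G) s x' b' z'"
  have "?L $$ (?p, ?p') =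
      (\<Sum>y<m. \<Sum>i<dim_in G. \<Sum>j<dim_in G.
        X $$ (ix (dim_in G) s (x * m + y) i z, ix (dim_in G) s (x' * m + y) j z') * kernel G i j b b')"
    using b by (simp add: ptr_index_assoc apply_mid_index pair_less)
  also have "\<dots> = (\<Sum>i<dim_in G. \<Sum>j<dim_in G. \<Sum>y<m.
        X $$ (ix (dim_in G) s (x * m + y) i z, ix (dim_in G) s (x' * m + y) j z') * kernel G i j b b')"
    by (rule sum_rotate)
  also have "\<dots> = ?R $$ (?p, ?p')"
    using b by (simp add: ptr_index_assoc apply_mid_index sum_distrib_right)
  finally show "?L $$ (?p, ?p') =
      ?R $$ (?p, ?p')" .
qed (metis mult.assoc ptr_carrier apply_mid_carrier)+

lemma ptr_right_apply_mid:
  "ptr (r * dim_out F) m s (apply_mid r F (m * s) X) = apply_mid r F s (ptr (r * dim_in F) m s X)" (is "?L = ?R")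
proof (rule eq_mat_ix[of _ r "dim_out F" s])
  fix x a z x' a' z'
  assume b: "x < r" "a < dim_out F" "z < s" "x' < r" "a' < dim_out F" "z' < s"
  let ?p = "ix (dim_out F) s x a z" and ?p' = "ix (dim_out F) s x' a' z'"
  have "?L $$ (?p, ?p') =
      (\<Sum>y<m. \<Sum>i<dim_in F. \<Sum>j<dim_in F.
        X $$ (ix m s (x * dim_in F + i) y z, ix m s (x' * dim_in F + j) y z') * kernel F i j a a')"
    using b by (simp add: ptr_index apply_mid_index_assoc pair_less)
  also have "\<dots> = (\<Sum>i<dim_in F. \<Sum>j<dim_in F. \<Sum>y<m.
        X $$ (ix m s (x * dim_in F + i) y z, ix m s (x' * dim_in F + j) y z') * kernel F i j a a')"
    by (rule sum_rotate)
  also have "\<dots> = ?R $$ (?p, ?p')"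
    using b by (simp add: ptr_index apply_mid_index pair_less sum_distrib_right)
  finally show "?L $$ (?p, ?p') =
      ?R $$ (?p, ?p')" .
qed auto

lemma dim_id [simp]: "dim_in (id_op n) = n" "dim_out (id_op n) = n"
  and dim_trace [simp]: "dim_in (trace_op n) = n" "dim_out (trace_op n) = 1"
  by (simp_all add: id_op_def trace_op_def)

lemma kernel_id: "a < n \<Longrightarrow> b < n \<Longrightarrow> kernel (id_op n) i j a b = (if i = a \<and> j = b then 1 else 0)"
  by (auto simp: kernel_def id_op_def mat_unit_def)

lemma kernel_trace: "i < n \<Longrightarrow> kernel (trace_op n) i j 0 0 = (if j = i then 1 else 0)"
proof -
  assume i: "i < n"
  have "kernel (trace_op n) i j 0 0 = (\<Sum>k<n. if k = i then (if k = j then 1 else 0) else 0)"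
    by (auto simp: kernel_def trace_op_def mat_trace_def mat_unit_def intro!: sum.cong)
  then show ?thesis using i by auto
qed

lemma apply_mid_id:
  assumes "X \<in> carrier_mat (r * n * s) (r * n * s)"
  shows "apply_mid r (id_op n) s X = X"
proof (rule eq_mat_ix[of _ r n s])
  fix x y z x' y' z' assume b: "x < r" "y < n" "z < s" "x' < r" "y' < n" "z' < s"
  show "apply_mid r (id_op n) s X $$ (ix n s x y z, ix n s x' y' z') = X $$ (ix n s x y z, ix n s x' y' z')"
    using apply_mid_index[of x r y "id_op n" z s x' y' z' X] b
      sum_delta2[of y n y' n "\<lambda>i j. X $$ (ix n s x i z, ix n s x' j z')"]
    by (simp add: kernel_id mult.commute)
qed (use assms apply_mid_carrier[of r "id_op n" s X] in auto)

lemma apply_mid_trace: "apply_mid r (trace_op m) s X = ptr r m s X"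
proof (rule eq_mat_pair[of _ r s])
  fix x z x' z' assume b: "x < r" "z < s" "x' < r" "z' < s"
  show "apply_mid r (trace_op m) s X $$ (x * s + z, x' * s + z') = ptr r m s X $$ (x * s + z, x' * s + z')"
    using apply_mid_index[of x r 0 "trace_op m" z s x' 0 z' X] b
    by (simp add: kernel_trace ptr_index if_distrib cong: if_cong)
qed (use apply_mid_carrier[of r "trace_op m" s X] in auto)

lemma linear_id: "linear_op (id_op n)"
  unfolding linear_op_def using apply_mid_id[of _ 1 n 1] by (auto simp: id_op_def)

lemma app_tensor:
  assumes "X \<in> carrier_mat (dim_in F * dim_in G) (dim_in F * dim_in G)"
  shows "app (F \<otimes>\<^sub>o G) X = apply_mid 1 F (dim_out G) (apply_mid (dim_in F) G 1 X)"
  using linear_tensor[of F G] assms apply_mid_tensor[of 1 F G 1 X] unfolding linear_op_def by simp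

lemma app_id_tensor:
  assumes "X \<in> carrier_mat (d * dim_in G) (d * dim_in G)"
  shows "app (id_op d \<otimes>\<^sub>o G) X = apply_mid d G 1 X"
  using app_tensor[of X "id_op d" G] apply_mid_id[of "apply_mid d G 1 X" 1 d "dim_out G"]
    apply_mid_carrier[of d G 1 X] assms by simp

lemma app_trace_id:
  assumes "X \<in> carrier_mat (d * n) (d * n)"
  shows "app (trace_op d \<otimes>\<^sub>o id_op n) X = ptr 1 d n X"
  using app_tensor[of X "trace_op d" "id_op n"] apply_mid_id[of X d n 1] assms by (simp add: apply_mid_trace)

section \<open>Channels and noise estimates\<close>

text \<open>
  The last condition is trace preservation, \<open>tr F(E\<^sub>i\<^sub>j) = tr E\<^sub>i\<^sub>j\<close>.\<close>

definition channel :: "superop \<Rightarrow> bool" where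
  "channel F \<longleftrightarrow> linear_op F \<and>
     (\<forall>r s X. pos_semidef (r * dim_in F * s) X \<longrightarrow> pos_semidef (r * dim_out F * s) (apply_mid r F s X)) \<and>
     (\<forall>i<dim_in F. \<forall>j<dim_in F. (\<Sum>a<dim_out F. kernel F i j a a) = (if j = i then 1 else 0))"

lemma ptr_apply_mid_same:
  assumes "channel F"
  shows "ptr r (dim_out F) s (apply_mid r F s X) = ptr r (dim_in F) s X"
proof (rule eq_mat_pair[of _ r s])
  fix x z x' z' assume b: "x < r" "z < s" "x' < r" "z' < s"
  let ?X = "\<lambda>i j. X $$ (ix (dim_in F) s x i z, ix (dim_in F) s x' j z')"
  have "ptr r (dim_out F) s (apply_mid r F s X) $$ (x * s + z, x' * s + z') =
      (\<Sum>a<dim_out F. \<Sum>i<dim_in F. \<Sum>j<dim_in F. ?X i j * kernel F i j a a)"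
    using b by (simp add: ptr_index apply_mid_index)
  also have "\<dots> = (\<Sum>i<dim_in F. \<Sum>j<dim_in F. \<Sum>a<dim_out F. ?X i j * kernel F i j a a)"
    by (rule sum_rotate)
  also have "\<dots> = (\<Sum>i<dim_in F. \<Sum>j<dim_in F. ?X i j * (if j = i then 1 else 0))"
    using assms by (intro sum.cong refl) (simp add: channel_def sum_distrib_left[symmetric])
  also have "\<dots> = ptr r (dim_in F) s X $$ (x * s + z, x' * s + z')"
    using b by (simp add: ptr_index if_distrib cong: if_cong)
  finally show "ptr r (dim_out F) s (apply_mid r F s X) $$ (x * s + z, x' * s + z') =
      ptr r (dim_in F) s X $$ (x * s + z, x' * s + z')" .
qed auto

lemma state_apply_mid:
  assumes F: "channel F" and X: "state (r * dim_in F * s) X"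
  shows "state (r * dim_out F * s) (apply_mid r F s X)"
proof -
  have "mat_trace (apply_mid r F s X) = mat_trace (ptr r (dim_out F) s (apply_mid r F s X))"
    by (rule trace_ptr[symmetric]) simp
  also have "\<dots> = mat_trace X"
    unfolding ptr_apply_mid_same[OF F] by (rule trace_ptr[OF state_carrier[OF X]])
  finally show ?thesis using F X by (simp add: state_def channel_def)
qed

lemma channel_app:
  assumes "channel F" "X \<in> carrier_mat (dim_in F) (dim_in F)"
  shows "app F X = apply_mid 1 F 1 X"
  using assms by (simp add: channel_def linear_op_def)

lemma state_app: "channel F \<Longrightarrow> state (dim_in F) X \<Longrightarrow> state (dim_out F) (app F X)"
  using state_apply_mid[of F 1 1 X] by (simp add: channel_app[OF _ state_carrier])

lemma channel_tensor:
  assumes F: "channel F" and G: "channel G"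
  shows "channel (F \<otimes>\<^sub>o G)"
  unfolding channel_def
proof (intro conjI allI impI linear_tensor)
  fix r s X assume "pos_semidef (r * dim_in (F \<otimes>\<^sub>o G) * s) X"
  then have "pos_semidef (r * dim_in F * dim_in G * s) X" by (simp add: mult.assoc)
  then have "pos_semidef (r * dim_in F * (dim_out G * s)) (apply_mid (r * dim_in F) G s X)"
    using G unfolding channel_def by (metis mult.assoc)
  then have "pos_semidef (r * dim_out F * (dim_out G * s)) (apply_mid r (F \<otimes>\<^sub>o G) s X)"
    using F by (simp add: channel_def apply_mid_tensor)
  then show "pos_semidef (r * dim_out (F \<otimes>\<^sub>o G) * s) (apply_mid r (F \<otimes>\<^sub>o G) s X)"
    by (simp add: mult.assoc)
next
  fix p q assume "p < dim_in (F \<otimes>\<^sub>o G)" "q < dim_in (F \<otimes>\<^sub>o G)"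
  then obtain i k j l where pq: "i < dim_in F" "k < dim_in G" "j < dim_in F" "l < dim_in G"
    "p = i * dim_in G + k" "q = j * dim_in G + l" by (metis dim_tensor(1) pair_cases)
  have "(\<Sum>c<dim_out (F \<otimes>\<^sub>o G). kernel (F \<otimes>\<^sub>o G) p q c c) =
      (\<Sum>a<dim_out F. kernel F i j a a) * (\<Sum>b<dim_out G. kernel G k l b b)"
    using pq by (simp add: sum_pair kernel_tensor sum_product)
  also have "\<dots> = (if q = p then 1 else 0)"
    using F G pq unfolding channel_def by (auto dest: arg_cong[of _ _ "\<lambda>t. t div dim_in G"]
        arg_cong[of _ _ "\<lambda>t. t mod dim_in G"])
  finally show "(\<Sum>c<dim_out (F \<otimes>\<^sub>o G). kernel (F \<otimes>\<^sub>o G) p q c c) = (if q = p then 1 else 0)" .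
qed

text \<open>
  The output of an erasure-like channel carries at least the entropy of an input that survives
  with probability \<open>q\<close> and is lost otherwise, plus an amount \<open>c\<close> created by the noise itself.
  The bystanders on both sides of the channel make this property stable under tensor products.\<close>

definition noisy :: "superop \<Rightarrow> real \<Rightarrow> real \<Rightarrow> bool" where
  "noisy F q c \<longleftrightarrow> (\<forall>r s X. state (r * dim_in F * s) X \<longrightarrow>
     q * entropy X + (1 - q) * entropy (ptr r (dim_in F) s X) + c \<le> entropy (apply_mid r F s X))"

definition output_bound :: "superop \<Rightarrow> real \<Rightarrow> bool" where
  "output_bound F u \<longleftrightarrow> (\<forall>X. state (dim_in F) X \<longrightarrow> entropy (app F X) \<le> u)"

text \<open>
  The estimate for \<open>F\<close> is applied to the output of \<open>G\<close>, and the estimate for \<open>G\<close> both to the joint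
  input and to what remains when the input of \<open>F\<close> is lost. The result is an average over independent
  losses; by strong subadditivity it is at least the average in which both inputs or none are lost
  with the same marginal probability.\<close>

lemma noisy_tensor:
  assumes F: "channel F" "noisy F q c" and G: "channel G" "noisy G q c'" and q: "0 \<le> q" "q \<le> 1"
  shows "noisy (F \<otimes>\<^sub>o G) q (c + c')"
  unfolding noisy_def
proof (intro allI impI)
  fix r s X assume X0: "state (r * dim_in (F \<otimes>\<^sub>o G) * s) X"
  define m1 m2 n2 where "m1 = dim_in F" and "m2 = dim_in G" and "n2 = dim_out G"
  have X: "state (r * m1 * m2 * s) X" using X0 by (simp add: m1_def m2_def mult.assoc)
  note Xc = state_carrier[OF X]
  define Y where "Y = apply_mid (r * m1) G s X"
  have Y: "state (r * m1 * (n2 * s)) Y"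
    using state_apply_mid[OF G(1), of "r * m1" s X] X by (simp add: Y_def m2_def n2_def mult.assoc)
  have X1: "state (r * m2 * s) (ptr r m1 (m2 * s) X)"
    using state_ptr[of r m1 "m2 * s" X] X by (simp add: mult.assoc)
  have step1: "q * entropy Y + (1 - q) * entropy (ptr r m1 (n2 * s) Y) + c \<le> entropy (apply_mid r (F \<otimes>\<^sub>o G) s X)"
    using F(2) Y unfolding noisy_def apply_mid_tensor Y_def m1_def n2_def by blast
  have step2: "q * entropy X + (1 - q) * entropy (ptr (r * m1) m2 s X) + c' \<le> entropy Y"
    using G(2) X unfolding noisy_def Y_def m2_def by blast
  have "ptr r m1 (n2 * s) Y = apply_mid r G s (ptr r m1 (m2 * s) X)"
    unfolding Y_def n2_def m2_def by (rule ptr_left_apply_mid)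
  then have step3: "q * entropy (ptr r m1 (m2 * s) X) +
      (1 - q) * entropy (ptr r m2 s (ptr r m1 (m2 * s) X)) + c' \<le> entropy (ptr r m1 (n2 * s) Y)"
    using G(2) X1 unfolding noisy_def m2_def by metis
  have lost: "ptr r (dim_in (F \<otimes>\<^sub>o G)) s X = ptr r m2 s (ptr r m1 (m2 * s) X)"
  proof (rule eq_mat_pair[of _ r s])
    fix x z x' z' assume "x < r" "z < s" "x' < r" "z' < s"
    then show "ptr r (dim_in (F \<otimes>\<^sub>o G)) s X $$ (x * s + z, x' * s + z') =
        ptr r m2 s (ptr r m1 (m2 * s) X) $$ (x * s + z, x' * s + z')"
      by (simp add: ptr_index ptr_index_assoc sum_pair m1_def m2_def ix_assoc) (rule sum.swap)
  qed auto
  \<comment> \<open>The remaining combination is \<open>q (1 - q)\<close> times the defect of this inequality.\<close>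
  have ssa: "entropy X + entropy (ptr r m2 s (ptr r m1 (m2 * s) X)) \<le>
      entropy (ptr (r * m1) m2 s X) + entropy (ptr r m1 (m2 * s) X)"
    using strong_subadditivity[OF X] unfolding ptr_ptr[OF Xc] .
  define S S0 S1 S2 where "S = entropy X" and "S0 = entropy (ptr r m2 s (ptr r m1 (m2 * s) X))"
    and "S1 = entropy (ptr (r * m1) m2 s X)" and "S2 = entropy (ptr r m1 (m2 * s) X)"
  note S_defs = this
  have "q * S + (1 - q) * S0 + (c + c') =
      q * (q * S + (1 - q) * S0 + c') + (1 - q) * (q * S + (1 - q) * S0 + c') + c"
    by (simp add: algebra_simps)
  also have "\<dots> = q * (q * S + (1 - q) * S1 + c') + (1 - q) * (q * S2 + (1 - q) * S0 + c') + c
      - q * (1 - q) * (S1 + S2 - S - S0)"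
    by (simp add: algebra_simps)
  also have "\<dots> \<le> q * (q * S + (1 - q) * S1 + c') + (1 - q) * (q * S2 + (1 - q) * S0 + c') + c"
    using ssa q by (simp add: S_defs)
  also have "\<dots> \<le> q * entropy Y + (1 - q) * entropy (ptr r m1 (n2 * s) Y) + c"
    using step2 step3 q unfolding S_defs by (intro add_mono mult_left_mono) auto
  also note step1
  finally show "q * S + (1 - q) * entropy (ptr r (dim_in (F \<otimes>\<^sub>o G)) s X) + (c + c') \<le>
      entropy (apply_mid r (F \<otimes>\<^sub>o G) s X)" unfolding lost S_defs .
qed

lemma output_bound_tensor:
  assumes F: "channel F" "output_bound F u" and G: "channel G" "output_bound G u'"
  shows "output_bound (F \<otimes>\<^sub>o G) (u + u')"
  unfolding output_bound_def
proof (intro allI impI)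
  fix X assume "state (dim_in (F \<otimes>\<^sub>o G)) X"
  then have X: "state (dim_in F * dim_in G) X" by simp
  have Z: "state (dim_out F * dim_out G) (app (F \<otimes>\<^sub>o G) X)"
    using state_app[OF channel_tensor[OF F(1) G(1)], of X] X by simp
  have X1: "state (dim_in F) (ptr (dim_in F) (dim_in G) 1 X)" and X2: "state (dim_in G) (ptr 1 (dim_in F) (dim_in G) X)"
    using state_ptr[of "dim_in F" "dim_in G" 1 X] state_ptr[of 1 "dim_in F" "dim_in G" X] X by simp_all
  let ?Y = "apply_mid (dim_in F) G 1 X"
  have "ptr (dim_out F) (dim_out G) 1 (app (F \<otimes>\<^sub>o G) X) = app F (ptr (dim_in F) (dim_in G) 1 X)"
    using ptr_right_apply_mid[of 1 F "dim_out G" 1 ?Y] ptr_apply_mid_same[OF G(1), of "dim_in F" 1 X]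
    by (simp add: app_tensor[OF state_carrier[OF X]] channel_app[OF F(1) state_carrier[OF X1]]
        del: One_nat_def)
  moreover have "ptr 1 (dim_out F) (dim_out G) (app (F \<otimes>\<^sub>o G) X) = app G (ptr 1 (dim_in F) (dim_in G) X)"
    using ptr_apply_mid_same[OF F(1), of 1 "dim_out G" ?Y] ptr_left_apply_mid[of 1 "dim_in F" G 1 X]
    by (simp add: app_tensor[OF state_carrier[OF X]] channel_app[OF G(1) state_carrier[OF X2]]
        del: One_nat_def)
  ultimately have "entropy (app (F \<otimes>\<^sub>o G) X) \<le>
      entropy (app F (ptr (dim_in F) (dim_in G) 1 X)) + entropy (app G (ptr 1 (dim_in F) (dim_in G) X))"
    using subadditivity[OF Z] by simp
  also have "\<dots> \<le> u + u'"
    using F(2) G(2) X1 X2 unfolding output_bound_def by (intro add_mono) auto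
  finally show "entropy (app (F \<otimes>\<^sub>o G) X) \<le> u + u'" .
qed

lemma channel_id: "channel (id_op n)"
  unfolding channel_def
  by (auto simp: linear_id apply_mid_id[OF pos_semidef_carrier] kernel_id)

section \<open>Closure properties of positive semidefinite matrices\<close>

lemma eigenfamily_pos_semidef:
  assumes fam: "eigenfamily n A K e u" and e: "\<And>k. k \<in> K \<Longrightarrow> 0 \<le> e k"
  shows "pos_semidef n A"
proof (rule gram_pos_semidef[where K = K and g = "\<lambda>k i. complex_of_real (sqrt (e k)) * u k i"])
  fix i j assume ij: "i < n" "j < n"
  have "complex_of_real (e k) * u k i * cnj (u k j) =
      complex_of_real (sqrt (e k)) * u k i * cnj (complex_of_real (sqrt (e k)) * u k j)" if "k \<in> K" for k
  proof -
    have "complex_of_real (e k) = complex_of_real (sqrt (e k)) * complex_of_real (sqrt (e k))"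
      using e[OF that] by (simp flip: of_real_mult)
    then show ?thesis by simp
  qed
  then have "(\<Sum>k\<in>K. complex_of_real (e k) * u k i * cnj (u k j)) =
      (\<Sum>k\<in>K. complex_of_real (sqrt (e k)) * u k i * cnj (complex_of_real (sqrt (e k)) * u k j))"
    by (rule sum.cong[OF refl])
  moreover have "A $$ (i, j) = (\<Sum>k\<in>K. complex_of_real (e k) * u k i * cnj (u k j))"
    using fam ij by (simp add: eigenfamily_def)
  ultimately show "A $$ (i, j) = (\<Sum>k\<in>K. complex_of_real (sqrt (e k)) * u k i * cnj (complex_of_real (sqrt (e k)) * u k j))"
    by (rule trans[rotated])
qed (use fam in \<open>simp add: eigenfamily_def\<close>)

lemma pos_semidef_add:
  assumes "pos_semidef n A" "pos_semidef n B"
  shows "pos_semidef n (A + B)"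
  unfolding pos_semidef_iff
proof (intro conjI allI)
  fix f
  have c: "A \<in> carrier_mat n n" "B \<in> carrier_mat n n" using assms by (auto simp: pos_semidef_def)
  have "(\<Sum>i<n. \<Sum>j<n. (A + B) $$ (i, j) * f j * cnj (f i)) =
      (\<Sum>i<n. \<Sum>j<n. A $$ (i, j) * f j * cnj (f i)) + (\<Sum>i<n. \<Sum>j<n. B $$ (i, j) * f j * cnj (f i))"
    unfolding sum.distrib[symmetric] using c by (intro sum.cong refl) (simp add: algebra_simps)
  also have "0 \<le> \<dots>" using assms by (intro add_nonneg_nonneg) (auto simp: pos_semidef_iff)
  finally show "0 \<le> (\<Sum>i<n. \<Sum>j<n. (A + B) $$ (i, j) * f j * cnj (f i))" .
qed (use assms in \<open>auto simp: pos_semidef_def\<close>)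

lemma pos_semidef_smult:
  assumes "pos_semidef n A" "0 \<le> c"
  shows "pos_semidef n (complex_of_real c \<cdot>\<^sub>m A)"
proof -
  obtain U e where U: "diagonalizes n A U e" and e: "\<And>k. k < n \<Longrightarrow> 0 \<le> e k"
    using pos_semidef_diagonalizes[OF assms(1)] by metis
  show ?thesis
    by (rule eigenfamily_pos_semidef[OF diagonalizes_eigenfamily[OF diagonalizes_smult[OF U]]])
      (use e assms in auto)
qed

lemma pos_semidef_amp:
  assumes "pos_semidef (r * s) Y"
  shows "pos_semidef (r * m * s) (amp r m s Y)"
proof -
  obtain U e where U: "diagonalizes (r * s) Y U e" and e: "\<And>k. k < r * s \<Longrightarrow> 0 \<le> e k"
    using pos_semidef_diagonalizes[OF assms(1)] by metis
  show ?thesis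
    by (rule eigenfamily_pos_semidef[OF diagonalizes_eigenfamily[OF amp_diagonalizes[OF U]]])
      (use e outer_less in auto)
qed

lemma dim_mat_unit [simp]: "dim_row (mat_unit n i j) = n" "dim_col (mat_unit n i j) = n"
  by (simp_all add: mat_unit_def)

lemma trace_mat_unit: "i < n \<Longrightarrow> mat_trace (mat_unit n i j) = (if j = i then 1 else 0)"
  using kernel_trace[of i n j] by (simp add: kernel_def trace_op_def)

section \<open>The depolarizing channel\<close>

lemma dim_depolarizing [simp]: "dim_in (depolarizing n q) = n" "dim_out (depolarizing n q) = n"
  by (simp_all add: depolarizing_def)

lemma kernel_depolarizing:
  assumes "i < n" "j < n" "a < n" "b < n"
  shows "kernel (depolarizing n q) i j a b =
    complex_of_real q * (if i = a \<and> j = b then 1 else 0)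
    + complex_of_real ((1 - q) * (1 / real n)) * (if j = i then if a = b then 1 else 0 else 0)"
  using assms by (auto simp: kernel_def depolarizing_def trace_mat_unit) (auto simp: mat_unit_def split: if_splits)

lemma apply_mid_depolarizing:
  assumes "X \<in> carrier_mat (r * n * s) (r * n * s)"
  shows "apply_mid r (depolarizing n q) s X = complex_of_real q \<cdot>\<^sub>m X
    + complex_of_real (1 - q) \<cdot>\<^sub>m (complex_of_real (1 / real n) \<cdot>\<^sub>m amp r n s (ptr r n s X))"
    (is "?L = ?R")
proof (rule eq_mat_ix[of _ r n s])
  fix x a z x' b z' assume h: "x < r" "a < n" "z < s" "x' < r" "b < n" "z' < s"
  let ?X = "\<lambda>i j. X $$ (ix n s x i z, ix n s x' j z')"
  have "?L $$ (ix n s x a z, ix n s x' b z') =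
      (\<Sum>i<n. \<Sum>j<n. (if i = a \<and> j = b then 1 else 0) * (complex_of_real q * ?X i j)
        + (if j = i then complex_of_real ((1 - q) * (1 / real n)) * (if a = b then 1 else 0) * ?X i j else 0))"
  proof -
    have "?L $$ (ix n s x a z, ix n s x' b z') =
        (\<Sum>i<n. \<Sum>j<n. ?X i j * kernel (depolarizing n q) i j a b)"
      using apply_mid_index[of x r a "depolarizing n q" z s x' b z' X] h by simp
    also have "\<dots> = (\<Sum>i<n. \<Sum>j<n. (if i = a \<and> j = b then 1 else 0) * (complex_of_real q * ?X i j)
        + (if j = i then complex_of_real ((1 - q) * (1 / real n)) * (if a = b then 1 else 0) * ?X i j else 0))"
      using h by (intro sum.cong refl) (simp add: kernel_depolarizing distrib_left)
    finally show ?thesis .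
  qed
  also have "\<dots> = complex_of_real q * ?X a b +
      complex_of_real ((1 - q) * (1 / real n)) * (if a = b then 1 else 0) * (\<Sum>i<n. ?X i i)"
    using h by (simp only: sum.distrib sum_delta2) (simp add: sum_distrib_left)
  also have "\<dots> = ?R
      $$ (ix n s x a z, ix n s x' b z')"
  proof -
    have "amp r n s (ptr r n s X) $$ (ix n s x a z, ix n s x' b z') = (if a = b then \<Sum>i<n. ?X i i else 0)"
      using h by (simp add: amp_index ptr_index)
    then show ?thesis using assms h carrier_matD[OF amp_carrier[of r n s "ptr r n s X"]]
      by (simp add: ix_less)
  qed
  finally show "?L $$ (ix n s x a z, ix n s x' b z') = ?R
      $$ (ix n s x a z, ix n s x' b z')" .
qed (use assms apply_mid_carrier[of r "depolarizing n q" s X] in auto)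

lemma linear_depolarizing: "linear_op (depolarizing n q)"
  unfolding linear_op_def
proof
  fix X :: "complex mat" assume "X \<in> carrier_mat (dim_in (depolarizing n q)) (dim_in (depolarizing n q))"
  then have X: "X \<in> carrier_mat n n" by simp
  have "amp 1 n 1 (ptr 1 n 1 X) $$ (a, b) = (if a = b then mat_trace X else 0)" if "a < n" "b < n" for a b
    using amp_index[of 0 1 a n 0 1 0 b 0 "ptr 1 n 1 X"] ptr_index[of 0 1 0 1 0 0 n X] that X
    by (simp add: mat_trace_def)
  then show "app (depolarizing n q) X = apply_mid 1 (depolarizing n q) 1 X"
    using X apply_mid_depolarizing[of X 1 n 1 q] carrier_matD[OF amp_carrier[of 1 n 1 "ptr 1 n 1 X"]]
    by (auto simp: depolarizing_def intro!: eq_matI)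
qed

lemma channel_depolarizing:
  assumes "0 \<le> q" "q \<le> 1" "0 < n"
  shows "channel (depolarizing n q)"
  unfolding channel_def
proof (intro conjI allI impI linear_depolarizing)
  fix r s X assume "pos_semidef (r * dim_in (depolarizing n q) * s) X"
  then have X: "pos_semidef (r * n * s) X" by simp
  show "pos_semidef (r * dim_out (depolarizing n q) * s) (apply_mid r (depolarizing n q) s X)"
    unfolding apply_mid_depolarizing[OF pos_semidef_carrier[OF X]] dim_depolarizing
    using assms X by (intro pos_semidef_add pos_semidef_smult pos_semidef_amp pos_semidef_ptr) auto
next
  fix i j assume ij: "i < dim_in (depolarizing n q)" "j < dim_in (depolarizing n q)"
  have "(\<Sum>a<n. kernel (depolarizing n q) i j a a) =
      (\<Sum>a<n. (if a = i then (if j = i then complex_of_real q else 0) else 0)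
        + complex_of_real ((1 - q) * (1 / real n)) * (if j = i then 1 else 0))"
    using ij by (intro sum.cong refl) (auto simp: kernel_depolarizing)
  also have "\<dots> = (if j = i then 1 else 0)"
    using ij assms by (simp add: sum.distrib)
  finally show "(\<Sum>a<dim_out (depolarizing n q). kernel (depolarizing n q) i j a a) = (if j = i then 1 else 0)"
    by simp
qed

text \<open>
  The output is a mixture of the input and of the reduced state with a maximally mixed replacement.\<close>

lemma noisy_depolarizing:
  assumes "0 \<le> q" "q \<le> 1" "0 < n"
  shows "noisy (depolarizing n q) q ((1 - q) * log 2 n)"
  unfolding noisy_def dim_depolarizing
proof (intro allI impI)
  fix r s X assume X: "state (r * n * s) X"
  let ?Z = "complex_of_real (1 / real n) \<cdot>\<^sub>m amp r n s (ptr r n s X)"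
  have Xp: "pos_semidef (r * n * s) X" using X by (simp add: state_def)
  have P: "state (r * s) (ptr r n s X)" by (rule state_ptr[OF X])
  have "q * entropy X + (1 - q) * entropy ?Z \<le> entropy (apply_mid r (depolarizing n q) s X)"
  proof (rule entropy_concave[OF Xp _ assms(1,2) apply_mid_depolarizing[OF state_carrier[OF X]]])
    show "pos_semidef (r * n * s) ?Z"
      using Xp by (intro pos_semidef_smult pos_semidef_amp pos_semidef_ptr) auto
    show "pos_semidef (r * n * s) (apply_mid r (depolarizing n q) s X)"
      using channel_depolarizing[OF assms] Xp by (simp add: channel_def)
  qed
  then show "q * entropy X + (1 - q) * entropy (ptr r n s X) + (1 - q) * log 2 n
      \<le> entropy (apply_mid r (depolarizing n q) s X)"
    unfolding entropy_amp[OF P assms(3)] by (simp add: algebra_simps)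
qed

lemma output_bound_depolarizing:
  assumes "0 \<le> q" "q \<le> 1" "0 < n"
  shows "output_bound (depolarizing n q) (log 2 n)"
  unfolding output_bound_def
  using state_app[OF channel_depolarizing[OF assms]] entropy_le_log_dim by fastforce

section \<open>The erasure channel\<close>

lemma dim_erasure [simp]: "dim_in (erasure n q) = n" "dim_out (erasure n q) = Suc n"
  by (simp_all add: erasure_def)

lemma kernel_erasure:
  assumes "i < n" "j < n" "a < Suc n" "b < Suc n"
  shows "kernel (erasure n q) i j a b =
    (if a < n \<and> b < n then complex_of_real q * (if i = a \<and> j = b then 1 else 0)
     else if a = n \<and> b = n then complex_of_real (1 - q) * (if j = i then 1 else 0) else 0)"
  using assms by (cases "a < n"; cases "b < n")
    (simp_all add: kernel_def erasure_def trace_mat_unit less_Suc_eq, simp_all add: mat_unit_def)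

lemma apply_mid_erasure_index:
  assumes "x < r" "a < Suc n" "z < s" "x' < r" "b < Suc n" "z' < s"
  shows "apply_mid r (erasure n q) s X $$ (ix (Suc n) s x a z, ix (Suc n) s x' b z') =
    (if a < n \<and> b < n then complex_of_real q * X $$ (ix n s x a z, ix n s x' b z')
     else if a = n \<and> b = n then complex_of_real (1 - q) * ptr r n s X $$ (x * s + z, x' * s + z') else 0)"
proof -
  let ?X = "\<lambda>i j. X $$ (ix n s x i z, ix n s x' j z')"
  have e: "apply_mid r (erasure n q) s X $$ (ix (Suc n) s x a z, ix (Suc n) s x' b z') =
      (\<Sum>i<n. \<Sum>j<n. ?X i j * kernel (erasure n q) i j a b)"
    using apply_mid_index[of x r a "erasure n q" z s x' b z' X] assms by simp
  consider "a < n" "b < n" | "a = n" "b = n" | "a = n \<and> b < n \<or> a < n \<and> b = n" using assms by linarith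
  then show ?thesis
  proof cases
    case 1
    have "(\<Sum>i<n. \<Sum>j<n. ?X i j * kernel (erasure n q) i j a b) =
        (\<Sum>i<n. \<Sum>j<n. (if i = a \<and> j = b then 1 else 0) * (complex_of_real q * ?X i j))"
      using 1 assms by (intro sum.cong refl) (simp add: kernel_erasure)
    then show ?thesis using 1 unfolding e by (simp only: sum_delta2) simp
  next
    case 2
    have "(\<Sum>i<n. \<Sum>j<n. ?X i j * kernel (erasure n q) i j a b) =
        (\<Sum>i<n. \<Sum>j<n. if j = i then complex_of_real (1 - q) * ?X i j else 0)"
      using 2 assms by (intro sum.cong refl) (auto simp: kernel_erasure)
    then show ?thesis using 2 assms unfolding e by (simp add: ptr_index sum_distrib_left)
  next
    case 3
    then show ?thesis using assms unfolding e by (auto simp: kernel_erasure intro!: sum.neutral)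
  qed
qed

lemma linear_erasure: "linear_op (erasure n q)"
  unfolding linear_op_def
proof
  fix X :: "complex mat" assume "X \<in> carrier_mat (dim_in (erasure n q)) (dim_in (erasure n q))"
  then have X: "X \<in> carrier_mat n n" by simp
  have t: "ptr 1 n 1 X $$ (0, 0) = mat_trace X"
    using ptr_index[of 0 1 0 1 0 0 n X] X by (simp add: mat_trace_def)
  show "app (erasure n q) X = apply_mid 1 (erasure n q) 1 X"
  proof (rule eq_matI)
    fix a b assume "a < dim_row (apply_mid 1 (erasure n q) 1 X)" "b < dim_col (apply_mid 1 (erasure n q) 1 X)"
    then have ab: "a < Suc n" "b < Suc n" using apply_mid_carrier[of 1 "erasure n q" 1 X] by auto
    show "app (erasure n q) X $$ (a, b) = apply_mid 1 (erasure n q) 1 X $$ (a, b)"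
      using apply_mid_erasure_index[of 0 1 a n 0 1 0 b 0 q X] ab X t
      by (auto simp: erasure_def)
  qed (use X apply_mid_carrier[of 1 "erasure n q" 1 X] in \<open>auto simp: erasure_def\<close>)
qed

text \<open>
  The output is a direct sum of the surviving input and the reduced state left after erasure,
  so its eigenvectors are those of the two summands. The flag is the last level \<open>n\<close> of the middle factor.\<close>

definition erasure_vec ::
  "nat \<Rightarrow> nat \<Rightarrow> ('k \<Rightarrow> nat \<Rightarrow> complex) \<Rightarrow> ('l \<Rightarrow> nat \<Rightarrow> complex) \<Rightarrow> 'k + 'l \<Rightarrow> nat \<Rightarrow> complex" where
  "erasure_vec n s u v = case_sum
     (\<lambda>k p. if p div s mod (Suc n) < n then u k (ix n s (p div s div (Suc n)) (p div s mod (Suc n)) (p mod s)) else 0)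
     (\<lambda>l p. if p div s mod (Suc n) = n then v l (outer (Suc n) s p) else 0)"

lemma erasure_vec_ix:
  assumes "a < Suc n" "z < s"
  shows "erasure_vec n s u v (Inl k) (ix (Suc n) s x a z) = (if a < n then u k (ix n s x a z) else 0)"
    "erasure_vec n s u v (Inr l) (ix (Suc n) s x a z) = (if a = n then v l (x * s + z) else 0)"
  using assms outer_ix[of a "Suc n" z s x] pair_div[of a "Suc n" x] pair_mod[of a "Suc n" x]
  unfolding erasure_vec_def by (simp_all del: mult_Suc mult_Suc_right)

lemma eigenfamily_erasure:
  assumes X: "eigenfamily (r * n * s) X K a u" and Y: "eigenfamily (r * s) (ptr r n s X) L b v"
  shows "eigenfamily (r * (Suc n) * s) (apply_mid r (erasure n q) s X) (K <+> L)
    (case_sum (\<lambda>k. q * a k) (\<lambda>l. (1 - q) * b l)) (erasure_vec n s u v)"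
proof (rule eigenfamilyI)
  have fin: "finite K" "finite L" using X Y by (auto simp: eigenfamily_def)
  show "finite (K <+> L)" using fin by simp
  show "apply_mid r (erasure n q) s X \<in> carrier_mat (r * (Suc n) * s) (r * (Suc n) * s)"
    using apply_mid_carrier[of r "erasure n q" s X] by simp
  let ?e = "case_sum (\<lambda>k. q * a k) (\<lambda>l. (1 - q) * b l)"
  let ?w = "erasure_vec n s u v"
  fix i j assume "i < r * (Suc n) * s" "j < r * (Suc n) * s"
  then obtain x c z x' c' z' where h: "x < r" "c < Suc n" "z < s" "x' < r" "c' < Suc n" "z' < s"
    and ij: "i = ix (Suc n) s x c z" "j = ix (Suc n) s x' c' z'" by (metis ix_cases)
  have "(\<Sum>k\<in>K <+> L. complex_of_real (?e k) * ?w k i * cnj (?w k j)) =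
      (\<Sum>k\<in>K. complex_of_real (q * a k) * ?w (Inl k) i * cnj (?w (Inl k) j)) +
      (\<Sum>l\<in>L. complex_of_real ((1 - q) * b l) * ?w (Inr l) i * cnj (?w (Inr l) j))"
    using fin by (subst sum.Plus) auto
  also have "\<dots> = apply_mid r (erasure n q) s X $$ (i, j)"
  proof -
    have Xi: "X $$ (ix n s x c z, ix n s x' c' z') =
        (\<Sum>k\<in>K. complex_of_real (a k) * u k (ix n s x c z) * cnj (u k (ix n s x' c' z')))" if "c < n" "c' < n"
      using X h that ix_less[of x r c n z s] ix_less[of x' r c' n z' s] by (simp add: eigenfamily_def)
    have Yi: "ptr r n s X $$ (x * s + z, x' * s + z') =
        (\<Sum>l\<in>L. complex_of_real (b l) * v l (x * s + z) * cnj (v l (x' * s + z')))"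
      using Y h by (simp add: eigenfamily_def pair_less)
    consider "c < n" "c' < n" | "c = n" "c' = n" | "c = n \<and> c' < n \<or> c < n \<and> c' = n"
      using h by linarith
    then show ?thesis
      unfolding ij apply_mid_erasure_index[OF h]
      by cases (use h in \<open>auto simp: erasure_vec_ix Xi Yi sum_distrib_left mult.assoc
        simp del: mult_Suc mult_Suc_right\<close>)
  qed
  finally show "apply_mid r (erasure n q) s X $$ (i, j) =
      (\<Sum>k\<in>K <+> L. complex_of_real (?e k) * ?w k i * cnj (?w k j))" by simp
next
  let ?w = "erasure_vec n s u v"
  fix k l assume kl: "k \<in> K <+> L" "l \<in> K <+> L"
  have uu: "(\<Sum>x<r. \<Sum>c<n. \<Sum>z<s. u k (ix n s x c z) * cnj (u l (ix n s x c z))) = (if k = l then 1 else 0)"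
    if "k \<in> K" "l \<in> K" for k l
    using X that unfolding eigenfamily_def sum_ix by blast
  have vv: "(\<Sum>x<r. \<Sum>z<s. v k (x * s + z) * cnj (v l (x * s + z))) = (if k = l then 1 else 0)"
    if "k \<in> L" "l \<in> L" for k l
    using Y that unfolding eigenfamily_def sum_pair by blast
  have "(\<Sum>i<r * (Suc n) * s. ?w k i * cnj (?w l i)) =
      (\<Sum>x<r. \<Sum>c<Suc n. \<Sum>z<s. ?w k (ix (Suc n) s x c z) * cnj (?w l (ix (Suc n) s x c z)))"
    by (rule sum_ix)
  also have "\<dots> = (\<Sum>x<r. (\<Sum>c<n. \<Sum>z<s. ?w k (ix (Suc n) s x c z) * cnj (?w l (ix (Suc n) s x c z))) +
      (\<Sum>z<s. ?w k (ix (Suc n) s x n z) * cnj (?w l (ix (Suc n) s x n z))))"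
    by (simp add: lessThan_Suc add.commute)
  also have "\<dots> = (if k = l then 1 else 0)"
    using kl uu vv by (elim PlusE) (simp_all add: erasure_vec_ix del: mult_Suc mult_Suc_right)
  finally show "(\<Sum>i<r * (Suc n) * s. ?w k i * cnj (?w l i)) = (if k = l then 1 else 0)" .
qed

lemma ent_term_mult: "0 \<le> x \<Longrightarrow> 0 \<le> y \<Longrightarrow> ent_term (x * y) = x * ent_term y + y * ent_term x"
  by (cases "x = 0 \<or> y = 0") (auto simp: ent_term_def log_mult algebra_simps)

lemma bin_entropy_eq: "bin_entropy q = ent_term q + ent_term (1 - q)"
  by (simp add: bin_entropy_def ent_term_def)

lemma entropy_erasure:
  assumes q: "0 \<le> q" "q \<le> 1" and X: "state (r * n * s) X"
  shows "entropy (apply_mid r (erasure n q) s X) =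
    q * entropy X + (1 - q) * entropy (ptr r n s X) + bin_entropy q"
proof -
  obtain U a where U: "diagonalizes (r * n * s) X U a"
    and a: "\<And>i. i < r * n * s \<Longrightarrow> 0 \<le> a i" "(\<Sum>i<r * n * s. a i) = 1"
    using state_diagonalizes[OF X] by metis
  obtain V b where V: "diagonalizes (r * s) (ptr r n s X) V b"
    and b: "\<And>i. i < r * s \<Longrightarrow> 0 \<le> b i" "(\<Sum>i<r * s. b i) = 1"
    using state_diagonalizes[OF state_ptr[OF X]] by metis
  have "entropy (apply_mid r (erasure n q) s X) =
      (\<Sum>k<r * n * s. ent_term (q * a k)) + (\<Sum>l<r * s. ent_term ((1 - q) * b l))"
    unfolding entropy_eigenfamily[OF eigenfamily_erasure[OF diagonalizes_eigenfamily[OF U] diagonalizes_eigenfamily[OF V]]]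
    by (subst sum.Plus) simp_all
  also have "\<dots> = (\<Sum>k<r * n * s. q * ent_term (a k) + a k * ent_term q) +
      (\<Sum>l<r * s. (1 - q) * ent_term (b l) + b l * ent_term (1 - q))"
    using q a b by (auto simp: ent_term_mult)
  also have "\<dots> = q * entropy X + (1 - q) * entropy (ptr r n s X) + bin_entropy q"
    unfolding entropy_diagonalizes[OF U] entropy_diagonalizes[OF V] bin_entropy_eq
    by (simp add: sum.distrib sum_distrib_left[symmetric] sum_distrib_right[symmetric] a b)
  finally show ?thesis .
qed

lemma channel_erasure:
  assumes "0 \<le> q" "q \<le> 1"
  shows "channel (erasure n q)"
  unfolding channel_def
proof (intro conjI allI impI linear_erasure)
  fix r s X assume "pos_semidef (r * dim_in (erasure n q) * s) X"
  then have X: "pos_semidef (r * n * s) X" by simp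
  obtain U a where U: "diagonalizes (r * n * s) X U a" "\<And>i. i < r * n * s \<Longrightarrow> 0 \<le> a i"
    using pos_semidef_diagonalizes[OF X] by metis
  obtain V b where V: "diagonalizes (r * s) (ptr r n s X) V b" "\<And>i. i < r * s \<Longrightarrow> 0 \<le> b i"
    using pos_semidef_diagonalizes[OF pos_semidef_ptr[OF X]] by metis
  show "pos_semidef (r * dim_out (erasure n q) * s) (apply_mid r (erasure n q) s X)"
    unfolding dim_erasure
    by (rule eigenfamily_pos_semidef[OF eigenfamily_erasure[OF diagonalizes_eigenfamily[OF U(1)]
          diagonalizes_eigenfamily[OF V(1)]]]) (use U(2) V(2) assms in auto)
next
  fix i j assume ij: "i < dim_in (erasure n q)" "j < dim_in (erasure n q)"
  have "(\<Sum>a<n. kernel (erasure n q) i j a a) =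
      (\<Sum>a<n. if a = i then (if j = i then complex_of_real q else 0) else 0)"
    using ij by (intro sum.cong refl) (auto simp: kernel_erasure)
  also have "\<dots> = (if j = i then complex_of_real q else 0)" using ij by simp
  finally have "(\<Sum>a<Suc n. kernel (erasure n q) i j a a) = (if j = i then 1 else 0)"
    using ij by (simp add: lessThan_Suc kernel_erasure)
  then show "(\<Sum>a<dim_out (erasure n q). kernel (erasure n q) i j a a) = (if j = i then 1 else 0)"
    by simp
qed

lemma noisy_erasure: "0 \<le> q \<Longrightarrow> q \<le> 1 \<Longrightarrow> noisy (erasure n q) q (bin_entropy q)"
  unfolding noisy_def by (simp add: entropy_erasure)

lemma output_bound_erasure:
  assumes q: "0 \<le> q" "q \<le> 1"
  shows "output_bound (erasure n q) (bin_entropy q + q * log 2 n)"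
  unfolding output_bound_def dim_erasure
proof (intro allI impI)
  fix X assume X: "state n X"
  have "state 1 (ptr 1 n 1 X)" using state_ptr[of 1 n 1 X] X by simp
  then have "entropy (app (erasure n q) X) = q * entropy X + bin_entropy q"
    using entropy_erasure[OF q, of 1 n 1 X] X
    by (simp add: channel_app[OF channel_erasure[OF q]] state_carrier entropy_trivial)
  also have "\<dots> \<le> bin_entropy q + q * log 2 n"
    using entropy_le_log_dim[OF X] q by (simp add: mult_left_mono)
  finally show "entropy (app (erasure n q) X) \<le> bin_entropy q + q * log 2 n" .
qed

section \<open>The upper bound on the capacity\<close>

lemma mixture_carrier [simp]: "mixture m N p A \<in> carrier_mat m m"
  by (simp add: mixture_def)

lemma state_mixture:
  assumes p: "prob_dist N p" and A: "\<And>i. i < N \<Longrightarrow> state m (A i)"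
  shows "state m (mixture m N p A)"
  unfolding state_def
proof
  show "pos_semidef m (mixture m N p A)"
    unfolding pos_semidef_iff
  proof (intro conjI allI mixture_carrier)
    fix f
    have "(\<Sum>i<m. \<Sum>j<m. mixture m N p A $$ (i, j) * f j * cnj (f i)) =
        (\<Sum>i<m. \<Sum>j<m. \<Sum>k<N. complex_of_real (p k) * (A k $$ (i, j) * f j * cnj (f i)))"
      by (auto simp: mixture_def sum_distrib_right mult.assoc intro!: sum.cong)
    also have "\<dots> = (\<Sum>k<N. \<Sum>i<m. \<Sum>j<m. complex_of_real (p k) * (A k $$ (i, j) * f j * cnj (f i)))"
      by (rule sum_rotate[symmetric])
    also have "\<dots> = (\<Sum>k<N. complex_of_real (p k) * (\<Sum>i<m. \<Sum>j<m. A k $$ (i, j) * f j * cnj (f i)))"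
      by (simp only: sum_distrib_left)
    also have "0 \<le> \<dots>"
    proof (rule sum_nonneg)
      fix k assume "k \<in> {..<N}"
      then have "pos_semidef m (A k)" "0 \<le> p k" using A p by (auto simp: state_def prob_dist_def)
      then show "0 \<le> complex_of_real (p k) * (\<Sum>i<m. \<Sum>j<m. A k $$ (i, j) * f j * cnj (f i))"
        unfolding pos_semidef_iff by (intro mult_nonneg_nonneg) (auto simp: less_eq_complex_def)
    qed
    finally show "0 \<le> (\<Sum>i<m. \<Sum>j<m. mixture m N p A $$ (i, j) * f j * cnj (f i))" .
  qed
  have "mat_trace (mixture m N p A) = (\<Sum>i<m. \<Sum>k<N. complex_of_real (p k) * A k $$ (i, i))"
    by (simp add: mixture_def mat_trace_def)
  also have "\<dots> = (\<Sum>k<N. complex_of_real (p k) * mat_trace (A k))"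
    using A by (subst sum.swap) (auto simp: mat_trace_def sum_distrib_left dest!: state_carrier intro!: sum.cong)
  also have "\<dots> = complex_of_real (\<Sum>k<N. p k)" using A by (simp add: state_def)
  also have "(\<Sum>k<N. p k) = 1" using p by (simp add: prob_dist_def)
  finally show "mat_trace (mixture m N p A) = 1" by simp
qed

lemma app_mixture:
  assumes F: "channel F" and A: "\<And>k. k < N \<Longrightarrow> A k \<in> carrier_mat (dim_in F) (dim_in F)"
  shows "mixture (dim_out F) N p (\<lambda>k. app F (A k)) = app F (mixture (dim_in F) N p A)"
proof (rule eq_matI)
  have c: "apply_mid 1 F 1 (mixture (dim_in F) N p A) \<in> carrier_mat (dim_out F) (dim_out F)"
    using apply_mid_carrier[of 1 F 1] by simp
  fix a b assume "a < dim_row (app F (mixture (dim_in F) N p A))" "b < dim_col (app F (mixture (dim_in F) N p A))"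
  then have ab: "a < dim_out F" "b < dim_out F" using c by (simp_all add: channel_app[OF F])
  have s: "apply_mid 1 F 1 X $$ (a, b) = (\<Sum>i<dim_in F. \<Sum>j<dim_in F. X $$ (i, j) * kernel F i j a b)" for X
    using apply_mid_index[of 0 1 a F 0 1 0 b 0 X] ab by simp
  have "mixture (dim_out F) N p (\<lambda>k. app F (A k)) $$ (a, b) =
      (\<Sum>k<N. \<Sum>i<dim_in F. \<Sum>j<dim_in F. complex_of_real (p k) * A k $$ (i, j) * kernel F i j a b)"
    using ab by (simp add: mixture_def channel_app[OF F A] s sum_distrib_left mult.assoc
        del: One_nat_def)
  also have "\<dots> = (\<Sum>i<dim_in F. \<Sum>j<dim_in F. \<Sum>k<N. complex_of_real (p k) * A k $$ (i, j) * kernel F i j a b)"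
    by (rule sum_rotate)
  also have "\<dots> = app F (mixture (dim_in F) N p A) $$ (a, b)"
    using ab by (simp add: channel_app[OF F mixture_carrier] s del: One_nat_def)
      (simp add: mixture_def sum_distrib_right)
  finally show "mixture (dim_out F) N p (\<lambda>k. app F (A k)) $$ (a, b) = app F (mixture (dim_in F) N p A) $$ (a, b)" .
qed (use apply_mid_carrier[of 1 F 1 "mixture (dim_in F) N p A"] in
  \<open>auto simp: channel_app[OF F mixture_carrier] carrier_matD[OF mixture_carrier]\<close>)

lemma ensemble_value_eq:
  assumes F: "channel F" and st: "\<forall>i<N. state (d * dim_in F) (\<rho> i)"
  shows "ensemble_value d F N p \<rho> =
    entropy (app F (mixture (dim_in F) N p (\<lambda>i. ptr 1 d (dim_in F) (\<rho> i))))
    + (\<Sum>i<N. p i * (entropy (ptr d (dim_in F) 1 (\<rho> i)) - entropy (apply_mid d F 1 (\<rho> i))))"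
proof -
  have c: "\<rho> i \<in> carrier_mat (d * dim_in F) (d * dim_in F)" if "i < N" for i
    using st that by (intro state_carrier) blast
  have "mixture (dim_out F) N p (\<lambda>i. app F (app (trace_op d \<otimes>\<^sub>o id_op (dim_in F)) (\<rho> i))) =
      mixture (dim_out F) N p (\<lambda>i. app F (ptr 1 d (dim_in F) (\<rho> i)))"
    unfolding mixture_def using c by (intro cong_mat refl) (simp add: app_trace_id)
  also have "\<dots> = app F (mixture (dim_in F) N p (\<lambda>i. ptr 1 d (dim_in F) (\<rho> i)))"
    using ptr_carrier[of 1 d "dim_in F"] by (intro app_mixture[OF F]) simp
  finally show ?thesis unfolding ensemble_value_def using c
    by (simp add: app_id_tensor apply_mid_trace)
qed

text \<open>
  The first entropy is at most \<open>u\<close>, the output entropy of the averaged input; the noise estimate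
  bounds each remaining term.\<close>

theorem C_prod_upper_bound:
  assumes F: "channel F" "noisy F q c" "output_bound F u" and q: "0 \<le> q" "q \<le> 1"
  shows "C_prod d F \<le> ereal (u - c + q * log 2 d)"
  unfolding C_prod_def
proof (rule Sup_least, clarsimp)
  fix N p \<rho> assume p: "prob_dist N p" and st: "\<forall>i<N. state (d * dim_in F) (\<rho> i)"
  have avg: "state (dim_in F) (mixture (dim_in F) N p (\<lambda>i. ptr 1 d (dim_in F) (\<rho> i)))"
    using st state_ptr[of 1 d "dim_in F"] by (intro state_mixture[OF p]) simp
  have gain: "entropy (ptr d (dim_in F) 1 (\<rho> i)) - entropy (apply_mid d F 1 (\<rho> i)) \<le> q * log 2 d - c"
    if "i < N" for i
  proof -
    have s: "state (d * dim_in F * 1) (\<rho> i)" using st that by simp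
    have "state d (ptr d (dim_in F) 1 (\<rho> i))" using state_ptr[OF s] by simp
    then have "entropy (ptr d (dim_in F) 1 (\<rho> i)) \<le> log 2 d" by (rule entropy_le_log_dim)
    then have "q * entropy (ptr d (dim_in F) 1 (\<rho> i)) \<le> q * log 2 d" using q by (intro mult_left_mono)
    moreover have "0 \<le> q * entropy (\<rho> i)" using entropy_nonneg[OF s] q by simp
    moreover have "q * entropy (\<rho> i) + (1 - q) * entropy (ptr d (dim_in F) 1 (\<rho> i)) + c
        \<le> entropy (apply_mid d F 1 (\<rho> i))"
      using F(2) s unfolding noisy_def by blast
    ultimately show ?thesis by (simp add: algebra_simps)
  qed
  have "(\<Sum>i<N. p i * (entropy (ptr d (dim_in F) 1 (\<rho> i)) - entropy (apply_mid d F 1 (\<rho> i)))) \<le>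
      (\<Sum>i<N. p i * (q * log 2 d - c))"
    using gain p by (intro sum_mono mult_left_mono) (auto simp: prob_dist_def)
  also have "\<dots> = q * log 2 d - c" using p by (simp add: prob_dist_def sum_distrib_right[symmetric])
  finally have "(\<Sum>i<N. p i * (entropy (ptr d (dim_in F) 1 (\<rho> i)) - entropy (apply_mid d F 1 (\<rho> i)))) \<le>
      q * log 2 d - c" .
  moreover have "entropy (app F (mixture (dim_in F) N p (\<lambda>i. ptr 1 d (dim_in F) (\<rho> i)))) \<le> u"
    using F(3) avg unfolding output_bound_def by blast
  ultimately show "ensemble_value d F N p \<rho> \<le> u - c + q * log 2 d"
    using ensemble_value_eq[OF F(1), of N d \<rho> p] st by simp
qed

lemma dim_tensor_power [simp]:
  "dim_in (tensor_power F k) = dim_in F ^ k" "dim_out (tensor_power F k) = dim_out F ^ k"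
  by (induction k) (simp_all add: mult.commute)

lemma tensor_power_estimates:
  assumes F: "channel F" "noisy F q c" "output_bound F u" and q: "0 \<le> q" "q \<le> 1"
  shows "channel (tensor_power F k) \<and> noisy (tensor_power F k) q (real k * c) \<and>
    output_bound (tensor_power F k) (real k * u)"
proof (induction k)
  case 0
  have "ptr r 1 s X = X" if "state (r * 1 * s) X" for r s X
    using state_carrier[OF that] by (intro eq_mat_pair[of _ r s]) (auto simp: ptr_index)
  then have "noisy (id_op 1) q 0"
    unfolding noisy_def by (auto simp: apply_mid_id[OF state_carrier] algebra_simps)
  moreover have "output_bound (id_op 1) 0"
    using entropy_trivial by (auto simp: output_bound_def id_op_def)
  ultimately show ?case using channel_id[of 1] by simp
next
  case (Suc k)
  then show ?case
    using noisy_tensor[of "tensor_power F k" q "real k * c" F c] output_bound_tensor[of "tensor_power F k" "real k * u" F u]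
      channel_tensor[of "tensor_power F k" F] F q
    by (simp add: algebra_simps)
qed

section \<open>Product ensembles\<close>

definition achievable :: "nat \<Rightarrow> superop \<Rightarrow> real \<Rightarrow> bool" where
  "achievable d F v \<longleftrightarrow> (\<exists>N p \<rho>. prob_dist N p \<and> (\<forall>i<N. state (d * dim_in F) (\<rho> i)) \<and>
     ensemble_value d F N p \<rho> = v)"

lemma achievable_le_C_prod: "achievable d F v \<Longrightarrow> ereal v \<le> C_prod d F"
  unfolding achievable_def C_prod_def by (intro Sup_upper) auto

lemma C_prod_le:
  assumes "\<And>v. achievable d F v \<Longrightarrow> ereal v \<le> c"
  shows "C_prod d F \<le> c"
  unfolding C_prod_def using assms unfolding achievable_def by (intro Sup_least) auto

text \<open>
  The product of \<open>A\<close> on \<open>r1 m1\<close> and \<open>B\<close> on \<open>r2 m2\<close>, with the factors reordered as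
  \<open>r1 r2 m1 m2\<close> so that the assistance systems and the channel inputs are each grouped.\<close>

definition idx1 :: "nat \<Rightarrow> nat \<Rightarrow> nat \<Rightarrow> nat \<Rightarrow> nat" where
  "idx1 r2 m1 m2 p = (p div (m1 * m2) div r2) * m1 + p mod (m1 * m2) div m2"

definition idx2 :: "nat \<Rightarrow> nat \<Rightarrow> nat \<Rightarrow> nat \<Rightarrow> nat" where
  "idx2 r2 m1 m2 p = (p div (m1 * m2) mod r2) * m2 + p mod (m1 * m2) mod m2"

definition regroup :: "nat \<Rightarrow> nat \<Rightarrow> nat \<Rightarrow> nat \<Rightarrow> complex mat \<Rightarrow> complex mat \<Rightarrow> complex mat" where
  "regroup r1 m1 r2 m2 A B = mat (r1 * r2 * (m1 * m2)) (r1 * r2 * (m1 * m2)) (\<lambda>(p, q).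
     A $$ (idx1 r2 m1 m2 p, idx1 r2 m1 m2 q) * B $$ (idx2 r2 m1 m2 p, idx2 r2 m1 m2 q))"

abbreviation (input) ix4 :: "nat \<Rightarrow> nat \<Rightarrow> nat \<Rightarrow> nat \<Rightarrow> nat \<Rightarrow> nat \<Rightarrow> nat \<Rightarrow> nat" where
  "ix4 r2 m1 m2 x1 x2 y1 y2 \<equiv> (x1 * r2 + x2) * (m1 * m2) + (y1 * m2 + y2)"

lemma idx_ix4 [simp]:
  assumes "x2 < r2" "y1 < m1" "y2 < m2"
  shows "idx1 r2 m1 m2 (ix4 r2 m1 m2 x1 x2 y1 y2) = x1 * m1 + y1"
    "idx2 r2 m1 m2 (ix4 r2 m1 m2 x1 x2 y1 y2) = x2 * m2 + y2"
  using assms pair_less[of y1 m1 y2 m2] by (simp_all add: idx1_def idx2_def)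

lemma ix4_less:
  assumes "x1 < r1" "x2 < r2" "y1 < m1" "y2 < m2"
  shows "ix4 r2 m1 m2 x1 x2 y1 y2 < r1 * r2 * (m1 * m2)"
  using assms by (intro pair_less)

lemma ix4_cases:
  assumes "p < r1 * r2 * (m1 * m2)"
  obtains x1 x2 y1 y2 where "x1 < r1" "x2 < r2" "y1 < m1" "y2 < m2" "p = ix4 r2 m1 m2 x1 x2 y1 y2"
  using assms by (metis pair_cases)

lemma eq_mat_ix4:
  assumes "A \<in> carrier_mat (r1 * r2 * (m1 * m2)) (r1 * r2 * (m1 * m2))"
    and "B \<in> carrier_mat (r1 * r2 * (m1 * m2)) (r1 * r2 * (m1 * m2))"
    and "\<And>x1 x2 y1 y2 x1' x2' y1' y2'.
      x1 < r1 \<Longrightarrow> x2 < r2 \<Longrightarrow> y1 < m1 \<Longrightarrow> y2 < m2 \<Longrightarrow> x1' < r1 \<Longrightarrow> x2' < r2 \<Longrightarrow> y1' < m1 \<Longrightarrow> y2' < m2 \<Longrightarrow>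
      A $$ (ix4 r2 m1 m2 x1 x2 y1 y2, ix4 r2 m1 m2 x1' x2' y1' y2') =
      B $$ (ix4 r2 m1 m2 x1 x2 y1 y2, ix4 r2 m1 m2 x1' x2' y1' y2')"
  shows "A = B"
proof (rule eq_matI)
  fix p q assume "p < dim_row B" "q < dim_col B"
  then have "p < r1 * r2 * (m1 * m2)" "q < r1 * r2 * (m1 * m2)" using assms(2) by auto
  then show "A $$ (p, q) = B $$ (p, q)"
    by (elim ix4_cases) (simp only: assms(3))
qed (use assms(1,2) in auto)

lemma regroup_carrier [simp]:
  "regroup r1 m1 r2 m2 A B \<in> carrier_mat (r1 * r2 * (m1 * m2)) (r1 * r2 * (m1 * m2))"
  by (simp add: regroup_def)

lemma regroup_index:
  assumes "x1 < r1" "x2 < r2" "y1 < m1" "y2 < m2" "x1' < r1" "x2' < r2" "y1' < m1" "y2' < m2"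
  shows "regroup r1 m1 r2 m2 A B $$ (ix4 r2 m1 m2 x1 x2 y1 y2, ix4 r2 m1 m2 x1' x2' y1' y2') =
    A $$ (x1 * m1 + y1, x1' * m1 + y1') * B $$ (x2 * m2 + y2, x2' * m2 + y2')"
  using assms by (simp add: regroup_def ix4_less)

lemma sum_idx:
  "(\<Sum>p<r1 * r2 * (m1 * m2). f (idx1 r2 m1 m2 p) * g (idx2 r2 m1 m2 p)) =
    (\<Sum>i<r1 * m1. f i) * (\<Sum>j<r2 * m2. g j)"
  for f g :: "nat \<Rightarrow> 'a::comm_semiring_1"
proof -
  have "(\<Sum>p<r1 * r2 * (m1 * m2). f (idx1 r2 m1 m2 p) * g (idx2 r2 m1 m2 p)) =
      (\<Sum>x1<r1. \<Sum>x2<r2. \<Sum>y1<m1. \<Sum>y2<m2. f (x1 * m1 + y1) * g (x2 * m2 + y2))"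
    unfolding sum_pair[of _ "r1 * r2"] sum_pair[of _ r1 r2] sum_pair[of _ m1 m2]
    by (intro sum.cong refl) simp
  also have "\<dots> = (\<Sum>x1<r1. \<Sum>y1<m1. \<Sum>x2<r2. \<Sum>y2<m2. f (x1 * m1 + y1) * g (x2 * m2 + y2))"
    by (rule sum.cong[OF refl], rule sum.swap)
  also have "\<dots> = (\<Sum>i<r1 * m1. f i) * (\<Sum>j<r2 * m2. g j)"
    by (simp only: sum_pair sum_distrib_left[symmetric] sum_distrib_right[symmetric])
  finally show ?thesis .
qed

lemma eigenfamily_regroup:
  assumes A: "eigenfamily (r1 * m1) A K a u" and B: "eigenfamily (r2 * m2) B L b v"
  shows "eigenfamily (r1 * r2 * (m1 * m2)) (regroup r1 m1 r2 m2 A B) (K \<times> L) (\<lambda>(k, l). a k * b l)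
    (\<lambda>(k, l) p. u k (idx1 r2 m1 m2 p) * v l (idx2 r2 m1 m2 p))"
proof (rule eigenfamilyI)
  let ?w = "\<lambda>(k, l) p. u k (idx1 r2 m1 m2 p) * v l (idx2 r2 m1 m2 p)"
  show "finite (K \<times> L)" using A B by (simp add: eigenfamily_def)
  fix i j assume "i < r1 * r2 * (m1 * m2)" "j < r1 * r2 * (m1 * m2)"
  then obtain x1 x2 y1 y2 x1' x2' y1' y2' where
    h: "x1 < r1" "x2 < r2" "y1 < m1" "y2 < m2" "x1' < r1" "x2' < r2" "y1' < m1" "y2' < m2"
    and ij: "i = ix4 r2 m1 m2 x1 x2 y1 y2" "j = ix4 r2 m1 m2 x1' x2' y1' y2'"
    by (metis ix4_cases)
  have "regroup r1 m1 r2 m2 A B $$ (i, j) =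
      (\<Sum>k\<in>K. complex_of_real (a k) * u k (x1 * m1 + y1) * cnj (u k (x1' * m1 + y1'))) *
      (\<Sum>l\<in>L. complex_of_real (b l) * v l (x2 * m2 + y2) * cnj (v l (x2' * m2 + y2')))"
    unfolding ij regroup_index[OF h] using A B h by (simp add: eigenfamily_def pair_less)
  also have "\<dots> = (\<Sum>k\<in>K. \<Sum>l\<in>L. complex_of_real (a k * b l) * ?w (k, l) i * cnj (?w (k, l) j))"
    unfolding ij sum_product using h by (intro sum.cong refl, simp only: case_prod_conv idx_ix4 of_real_mult complex_cnj_mult)
      (simp only: mult_ac)
  also have "\<dots> = (\<Sum>kl\<in>K \<times> L. complex_of_real ((\<lambda>(k, l). a k * b l) kl) * ?w kl i * cnj (?w kl j))"
    by (simp add: sum.cartesian_product case_prod_unfold)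
  finally show "regroup r1 m1 r2 m2 A B $$ (i, j) =
      (\<Sum>kl\<in>K \<times> L. complex_of_real ((\<lambda>(k, l). a k * b l) kl) * ?w kl i * cnj (?w kl j))" .
next
  fix kl kl' assume kl: "kl \<in> K \<times> L" "kl' \<in> K \<times> L"
  obtain k l k' l' where e: "kl = (k, l)" "kl' = (k', l')" by (metis surj_pair)
  have "(\<Sum>p<r1 * r2 * (m1 * m2). (u k (idx1 r2 m1 m2 p) * v l (idx2 r2 m1 m2 p)) *
      cnj (u k' (idx1 r2 m1 m2 p) * v l' (idx2 r2 m1 m2 p))) =
      (\<Sum>p<r1 * r2 * (m1 * m2). (\<lambda>i. u k i * cnj (u k' i)) (idx1 r2 m1 m2 p) *
        (\<lambda>j. v l j * cnj (v l' j)) (idx2 r2 m1 m2 p))"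
    by (simp add: mult_ac)
  also have "\<dots> = (if k = k' then 1 else 0) * (if l = l' then 1 else 0)"
    unfolding sum_idx[where f = "\<lambda>i. u k i * cnj (u k' i)" and g = "\<lambda>j. v l j * cnj (v l' j)"]
    using A B kl unfolding e by (simp add: eigenfamily_def)
  finally show "(\<Sum>p<r1 * r2 * (m1 * m2). (case kl of (k, l) \<Rightarrow> \<lambda>p. u k (idx1 r2 m1 m2 p) * v l (idx2 r2 m1 m2 p)) p *
      cnj ((case kl' of (k, l) \<Rightarrow> \<lambda>p. u k (idx1 r2 m1 m2 p) * v l (idx2 r2 m1 m2 p)) p)) = (if kl = kl' then 1 else 0)"
    by (simp add: e)
qed simp

lemma trace_regroup:
  assumes "A \<in> carrier_mat (r1 * m1) (r1 * m1)" "B \<in> carrier_mat (r2 * m2) (r2 * m2)"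
  shows "mat_trace (regroup r1 m1 r2 m2 A B) = mat_trace A * mat_trace B"
proof -
  have "mat_trace (regroup r1 m1 r2 m2 A B) = (\<Sum>p<r1 * r2 * (m1 * m2).
      (\<lambda>i. A $$ (i, i)) (idx1 r2 m1 m2 p) * (\<lambda>j. B $$ (j, j)) (idx2 r2 m1 m2 p))"
    unfolding mat_trace_def regroup_def by (intro sum.cong) auto
  then show ?thesis using assms sum_idx[where f = "\<lambda>i. A $$ (i, i)" and g = "\<lambda>j. B $$ (j, j)" and ?r1.0 = r1 and ?r2.0 = r2 and ?m1.0 = m1 and ?m2.0 = m2]
    by (simp add: mat_trace_def)
qed

lemma state_regroup:
  assumes A: "state (r1 * m1) A" and B: "state (r2 * m2) B"
  shows "state (r1 * r2 * (m1 * m2)) (regroup r1 m1 r2 m2 A B)"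
proof -
  obtain U a where U: "diagonalizes (r1 * m1) A U a" "\<And>i. i < r1 * m1 \<Longrightarrow> 0 \<le> a i"
    using state_diagonalizes[OF A] by metis
  obtain V b where V: "diagonalizes (r2 * m2) B V b" "\<And>i. i < r2 * m2 \<Longrightarrow> 0 \<le> b i"
    using state_diagonalizes[OF B] by metis
  have "pos_semidef (r1 * r2 * (m1 * m2)) (regroup r1 m1 r2 m2 A B)"
    by (rule eigenfamily_pos_semidef[OF eigenfamily_regroup[OF diagonalizes_eigenfamily[OF U(1)]
          diagonalizes_eigenfamily[OF V(1)]]]) (use U(2) V(2) in auto)
  then show ?thesis
    using trace_regroup[OF state_carrier[OF A] state_carrier[OF B]] A B by (simp add: state_def)
qed

lemma entropy_regroup:
  assumes A: "state (r1 * m1) A" and B: "state (r2 * m2) B"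
  shows "entropy (regroup r1 m1 r2 m2 A B) = entropy A + entropy B"
proof -
  obtain U a where U: "diagonalizes (r1 * m1) A U a"
    and a: "\<And>i. i < r1 * m1 \<Longrightarrow> 0 \<le> a i" "(\<Sum>i<r1 * m1. a i) = 1"
    using state_diagonalizes[OF A] by metis
  obtain V b where V: "diagonalizes (r2 * m2) B V b"
    and b: "\<And>i. i < r2 * m2 \<Longrightarrow> 0 \<le> b i" "(\<Sum>i<r2 * m2. b i) = 1"
    using state_diagonalizes[OF B] by metis
  have "entropy (regroup r1 m1 r2 m2 A B) = (\<Sum>k<r1 * m1. \<Sum>l<r2 * m2. ent_term (a k * b l))"
    unfolding entropy_eigenfamily[OF eigenfamily_regroup[OF diagonalizes_eigenfamily[OF U] diagonalizes_eigenfamily[OF V]]]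
    by (simp add: sum.cartesian_product case_prod_unfold)
  also have "\<dots> = (\<Sum>k<r1 * m1. \<Sum>l<r2 * m2. a k * ent_term (b l) + b l * ent_term (a k))"
    using a b by (intro sum.cong refl ent_term_mult) auto
  also have "\<dots> = (\<Sum>k<r1 * m1. a k * (\<Sum>l<r2 * m2. ent_term (b l))) + (\<Sum>k<r1 * m1. (\<Sum>l<r2 * m2. b l) * ent_term (a k))"
    by (simp add: sum.distrib sum_distrib_left sum_distrib_right)
  also have "\<dots> = entropy A + entropy B"
    unfolding entropy_diagonalizes[OF U] entropy_diagonalizes[OF V]
    by (simp add: sum_distrib_right[symmetric] a b)
  finally show ?thesis .
qed

lemma apply_mid_regroup:
  "apply_mid (r1 * r2) (F \<otimes>\<^sub>o G) 1 (regroup r1 (dim_in F) r2 (dim_in G) A B) =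
    regroup r1 (dim_out F) r2 (dim_out G) (apply_mid r1 F 1 A) (apply_mid r2 G 1 B)" (is "?L = ?R")
proof (rule eq_mat_ix4[of _ r1 r2 "dim_out F" "dim_out G"])
  fix x1 x2 y1 y2 x1' x2' y1' y2'
  assume h: "x1 < r1" "x2 < r2" "y1 < dim_out F" "y2 < dim_out G"
    "x1' < r1" "x2' < r2" "y1' < dim_out F" "y2' < dim_out G"
  let ?p = "ix4 r2 (dim_out F) (dim_out G) x1 x2 y1 y2" and ?p' = "ix4 r2 (dim_out F) (dim_out G) x1' x2' y1' y2'"
  let ?A = "\<lambda>i j. A $$ (x1 * dim_in F + i, x1' * dim_in F + j) * kernel F i j y1 y1'"
  let ?B = "\<lambda>k l. B $$ (x2 * dim_in G + k, x2' * dim_in G + l) * kernel G k l y2 y2'"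
  have "?L $$
      (?p, ?p') =
      (\<Sum>i<dim_in F. \<Sum>k<dim_in G. \<Sum>j<dim_in F. \<Sum>l<dim_in G.
        A $$ (x1 * dim_in F + i, x1' * dim_in F + j) * B $$ (x2 * dim_in G + k, x2' * dim_in G + l) *
        (kernel F i j y1 y1' * kernel G k l y2 y2'))"
    using apply_mid_index[of "x1 * r2 + x2" "r1 * r2" "y1 * dim_out G + y2" "F \<otimes>\<^sub>o G" 0 1
        "x1' * r2 + x2'" "y1' * dim_out G + y2'" 0 "regroup r1 (dim_in F) r2 (dim_in G) A B"] h
    by (simp add: pair_less sum_pair kernel_tensor regroup_index del: One_nat_def)
  also have "\<dots> = (\<Sum>i<dim_in F. \<Sum>k<dim_in G. \<Sum>j<dim_in F. \<Sum>l<dim_in G. ?A i j * ?B k l)"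
    by (intro sum.cong refl) (simp only: mult_ac)
  also have "\<dots> = (\<Sum>i<dim_in F. \<Sum>j<dim_in F. \<Sum>k<dim_in G. \<Sum>l<dim_in G. ?A i j * ?B k l)"
    by (rule sum.cong[OF refl], rule sum.swap)
  also have "\<dots> = (\<Sum>i<dim_in F. \<Sum>j<dim_in F. ?A i j) * (\<Sum>k<dim_in G. \<Sum>l<dim_in G. ?B k l)"
    by (simp only: sum_distrib_left[symmetric] sum_distrib_right[symmetric])
  also have "\<dots> = ?R $$
      (?p, ?p')"
    using apply_mid_index[of x1 r1 y1 F 0 1 x1' y1' 0 A] apply_mid_index[of x2 r2 y2 G 0 1 x2' y2' 0 B] h
    by (simp add: regroup_index)
  finally show "?L $$
      (?p, ?p') =
      ?R $$
      (?p, ?p')" .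
qed (use apply_mid_carrier[of "r1 * r2" "F \<otimes>\<^sub>o G" 1] in auto)

lemma ptr_right_regroup:
  "ptr (r1 * r2) (m1 * m2) 1 (regroup r1 m1 r2 m2 A B) = regroup r1 1 r2 1 (ptr r1 m1 1 A) (ptr r2 m2 1 B)" (is "?L = ?R")
proof (rule eq_mat_pair[of _ r1 r2])
  fix x1 x2 x1' x2' assume h: "x1 < r1" "x2 < r2" "x1' < r1" "x2' < r2"
  have "?L $$ (x1 * r2 + x2, x1' * r2 + x2') =
      (\<Sum>y1<m1. \<Sum>y2<m2. A $$ (x1 * m1 + y1, x1' * m1 + y1) * B $$ (x2 * m2 + y2, x2' * m2 + y2))"
    using ptr_index[of "x1 * r2 + x2" "r1 * r2" 0 1 "x1' * r2 + x2'" 0 "m1 * m2"] h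
    by (simp add: pair_less sum_pair regroup_index)
  also have "\<dots> = ptr r1 m1 1 A $$ (x1, x1') * ptr r2 m2 1 B $$ (x2, x2')"
    using ptr_index[of x1 r1 0 1 x1' 0 m1 A] ptr_index[of x2 r2 0 1 x2' 0 m2 B] h
    by (simp add: sum_product)
  also have "\<dots> = ?R $$ (x1 * r2 + x2, x1' * r2 + x2')"
    using regroup_index[of x1 r1 x2 r2 0 1 0 1 x1' x2' 0 0 "ptr r1 m1 1 A" "ptr r2 m2 1 B"] h by simp
  finally show "?L $$ (x1 * r2 + x2, x1' * r2 + x2') =
      ?R $$ (x1 * r2 + x2, x1' * r2 + x2')" .
qed (use ptr_carrier[of "r1 * r2" "m1 * m2" 1] regroup_carrier[of r1 1 r2 1] in auto)

lemma ptr_left_regroup: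
  "ptr 1 (r1 * r2) (m1 * m2) (regroup r1 m1 r2 m2 A B) = regroup 1 m1 1 m2 (ptr 1 r1 m1 A) (ptr 1 r2 m2 B)" (is "?L = ?R")
proof (rule eq_mat_pair[of _ m1 m2])
  fix y1 y2 y1' y2' assume h: "y1 < m1" "y2 < m2" "y1' < m1" "y2' < m2"
  have "?L $$ (y1 * m2 + y2, y1' * m2 + y2') =
      (\<Sum>x1<r1. \<Sum>x2<r2. A $$ (x1 * m1 + y1, x1 * m1 + y1') * B $$ (x2 * m2 + y2, x2 * m2 + y2'))"
    using ptr_index[of 0 1 "y1 * m2 + y2" "m1 * m2" 0 "y1' * m2 + y2'" "r1 * r2"] h
    by (simp add: pair_less sum_pair regroup_index)
  also have "\<dots> = ptr 1 r1 m1 A $$ (y1, y1') * ptr 1 r2 m2 B $$ (y2, y2')"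
    using ptr_index[of 0 1 y1 m1 0 y1' r1 A] ptr_index[of 0 1 y2 m2 0 y2' r2 B] h
    by (simp add: sum_product)
  also have "\<dots> = ?R $$ (y1 * m2 + y2, y1' * m2 + y2')"
    using regroup_index[of 0 1 0 1 y1 m1 y2 m2 0 0 y1' y2' "ptr 1 r1 m1 A" "ptr 1 r2 m2 B"] h by simp
  finally show "?L $$ (y1 * m2 + y2, y1' * m2 + y2') =
      ?R $$ (y1 * m2 + y2, y1' * m2 + y2')" .
qed (use ptr_carrier[of 1 "r1 * r2" "m1 * m2"] regroup_carrier[of 1 m1 1 m2] in auto)

lemma mixture_index:
  "a < m \<Longrightarrow> b < m \<Longrightarrow> mixture m N p A $$ (a, b) = (\<Sum>i<N. complex_of_real (p i) * A i $$ (a, b))"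
  by (simp add: mixture_def)

lemma mixture_regroup:
  "mixture (m1 * m2) (N1 * N2) (\<lambda>i. p1 (i div N2) * p2 (i mod N2))
     (\<lambda>i. regroup 1 m1 1 m2 (A (i div N2)) (B (i mod N2))) =
   regroup 1 m1 1 m2 (mixture m1 N1 p1 A) (mixture m2 N2 p2 B)" (is "?L = ?R")
proof (rule eq_mat_pair[of _ m1 m2])
  fix y1 y2 y1' y2' assume h: "y1 < m1" "y2 < m2" "y1' < m1" "y2' < m2"
  have s: "regroup 1 m1 1 m2 A B $$ (y1 * m2 + y2, y1' * m2 + y2') = A $$ (y1, y1') * B $$ (y2, y2')" for A B
    using regroup_index[of 0 1 0 1 y1 m1 y2 m2 0 0 y1' y2' A B] h by simp
  have "?L $$ (y1 * m2 + y2, y1' * m2 + y2') =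
     (\<Sum>i<N1. \<Sum>j<N2. complex_of_real (p1 i * p2 j) * (A i $$ (y1, y1') * B j $$ (y2, y2')))"
    unfolding mixture_index[OF pair_less[OF h(1,2)] pair_less[OF h(3,4)]] sum_pair s
    by (intro sum.cong refl) simp
  also have "\<dots> = (\<Sum>i<N1. complex_of_real (p1 i) * A i $$ (y1, y1')) *
      (\<Sum>j<N2. complex_of_real (p2 j) * B j $$ (y2, y2'))"
    unfolding sum_product by (intro sum.cong refl) (simp only: of_real_mult mult_ac)
  also have "\<dots> = ?R $$ (y1 * m2 + y2, y1' * m2 + y2')"
    unfolding s using h by (simp only: mixture_index)
  finally show "?L $$ (y1 * m2 + y2, y1' * m2 + y2') =
   ?R $$ (y1 * m2 + y2, y1' * m2 + y2')" .
qed (use regroup_carrier[of 1 m1 1 m2] in auto)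

text \<open>The product ensemble has this value because every entropy in it is additive over the two parts.\<close>

lemma achievable_tensor:
  assumes F: "channel F" "achievable d1 F v1" and G: "channel G" "achievable d2 G v2"
  shows "achievable (d1 * d2) (F \<otimes>\<^sub>o G) (v1 + v2)"
proof -
  obtain N1 p1 A where p1: "prob_dist N1 p1" and A: "\<forall>i<N1. state (d1 * dim_in F) (A i)"
    and v1: "ensemble_value d1 F N1 p1 A = v1" using F(2) unfolding achievable_def by blast
  obtain N2 p2 B where p2: "prob_dist N2 p2" and B: "\<forall>i<N2. state (d2 * dim_in G) (B i)"
    and v2: "ensemble_value d2 G N2 p2 B = v2" using G(2) unfolding achievable_def by blast
  define m1 m2 n1 n2 where "m1 = dim_in F" and "m2 = dim_in G" and "n1 = dim_out F" and "n2 = dim_out G"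
  note dims = this
  define p where "p i = p1 (i div N2) * p2 (i mod N2)" for i
  define R where "R i = regroup d1 m1 d2 m2 (A (i div N2)) (B (i mod N2))" for i
  have lt: "i div N2 < N1" "i mod N2 < N2" if "i < N1 * N2" for i
    using that by (elim pair_cases, simp)+
  have sp: "(\<Sum>i<N1 * N2. p i * (f (i div N2) + g (i mod N2))) =
      (\<Sum>i<N1. p1 i * f i) + (\<Sum>j<N2. p2 j * g j)" for f g :: "nat \<Rightarrow> real"
  proof -
    have "(\<Sum>i<N1 * N2. p i * (f (i div N2) + g (i mod N2))) =
        (\<Sum>i<N1. \<Sum>j<N2. (p1 i * f i) * p2 j + p1 i * (p2 j * g j))"
      unfolding sum_pair by (intro sum.cong refl) (simp add: p_def algebra_simps)
    also have "\<dots> = (\<Sum>i<N1. \<Sum>j<N2. (p1 i * f i) * p2 j) + (\<Sum>i<N1. \<Sum>j<N2. p1 i * (p2 j * g j))"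
      by (simp only: sum.distrib)
    also have "\<dots> = (\<Sum>i<N1. p1 i * f i) * (\<Sum>j<N2. p2 j) + (\<Sum>i<N1. p1 i) * (\<Sum>j<N2. p2 j * g j)"
      by (simp only: sum_product)
    finally show ?thesis using p1 p2 by (simp add: prob_dist_def)
  qed
  have pd: "prob_dist (N1 * N2) p"
    unfolding prob_dist_def
  proof (intro conjI allI impI)
    show "0 \<le> p i" if "i < N1 * N2" for i
      using lt[OF that] p1 p2 by (simp add: prob_dist_def p_def)
    show "(\<Sum>i<N1 * N2. p i) = 1" using sp[of "\<lambda>_. 1" "\<lambda>_. 0"] p1 by (simp add: prob_dist_def)
  qed
  have sA: "state (d1 * m1) (A (i div N2))" and sB: "state (d2 * m2) (B (i mod N2))" if "i < N1 * N2" for i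
    using A B lt[OF that] by (auto simp: dims)
  have R: "state (d1 * d2 * dim_in (F \<otimes>\<^sub>o G)) (R i)" if "i < N1 * N2" for i
    using state_regroup[OF sA[OF that] sB[OF that]] by (simp add: R_def dims)
  then have R': "\<forall>i<N1 * N2. state (d1 * d2 * dim_in (F \<otimes>\<^sub>o G)) (R i)" by blast
  have mA: "state m1 (mixture m1 N1 p1 (\<lambda>i. ptr 1 d1 m1 (A i)))"
    using A state_ptr[of 1 d1 m1] by (intro state_mixture[OF p1]) (simp add: dims)
  have mB: "state m2 (mixture m2 N2 p2 (\<lambda>i. ptr 1 d2 m2 (B i)))"
    using B state_ptr[of 1 d2 m2] by (intro state_mixture[OF p2]) (simp add: dims)
  let ?MA = "mixture m1 N1 p1 (\<lambda>i. ptr 1 d1 m1 (A i))" and ?MB = "mixture m2 N2 p2 (\<lambda>i. ptr 1 d2 m2 (B i))"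
  have "mixture (m1 * m2) (N1 * N2) p (\<lambda>i. ptr 1 (d1 * d2) (m1 * m2) (R i)) = regroup 1 m1 1 m2 ?MA ?MB"
    unfolding R_def ptr_left_regroup p_def by (rule mixture_regroup)
  moreover have "app (F \<otimes>\<^sub>o G) (regroup 1 m1 1 m2 ?MA ?MB) = regroup 1 n1 1 n2 (app F ?MA) (app G ?MB)"
    using apply_mid_regroup[of 1 1 F G ?MA ?MB] regroup_carrier[of 1 m1 1 m2 ?MA ?MB]
      channel_app[OF F(1) state_carrier[OF mA[unfolded m1_def]]]
      channel_app[OF G(1) state_carrier[OF mB[unfolded m2_def]]]
      channel_app[OF channel_tensor[OF F(1) G(1)], of "regroup 1 m1 1 m2 ?MA ?MB"]
    by (simp add: dims)
  moreover have "entropy (regroup 1 n1 1 n2 (app F ?MA) (app G ?MB)) = entropy (app F ?MA) + entropy (app G ?MB)"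
    using state_app[OF F(1)] state_app[OF G(1)] mA mB by (intro entropy_regroup) (simp_all add: dims)
  ultimately have out: "entropy (app (F \<otimes>\<^sub>o G) (mixture (m1 * m2) (N1 * N2) p (\<lambda>i. ptr 1 (d1 * d2) (m1 * m2) (R i)))) =
      entropy (app F ?MA) + entropy (app G ?MB)" by simp
  have gain: "entropy (ptr (d1 * d2) (m1 * m2) 1 (R i)) - entropy (apply_mid (d1 * d2) (F \<otimes>\<^sub>o G) 1 (R i)) =
      (entropy (ptr d1 m1 1 (A (i div N2))) - entropy (apply_mid d1 F 1 (A (i div N2)))) +
      (entropy (ptr d2 m2 1 (B (i mod N2))) - entropy (apply_mid d2 G 1 (B (i mod N2))))" if i: "i < N1 * N2" for i
  proof -
    have "entropy (ptr (d1 * d2) (m1 * m2) 1 (R i)) =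
        entropy (ptr d1 m1 1 (A (i div N2))) + entropy (ptr d2 m2 1 (B (i mod N2)))"
      unfolding R_def ptr_right_regroup
      using sA[OF i] sB[OF i] state_ptr[of d1 m1 1] state_ptr[of d2 m2 1] by (intro entropy_regroup) simp_all
    moreover have "entropy (apply_mid (d1 * d2) (F \<otimes>\<^sub>o G) 1 (R i)) =
        entropy (apply_mid d1 F 1 (A (i div N2))) + entropy (apply_mid d2 G 1 (B (i mod N2)))"
      unfolding R_def m1_def m2_def apply_mid_regroup
      using sA[OF i] sB[OF i] state_apply_mid[OF F(1), of d1 1] state_apply_mid[OF G(1), of d2 1]
      by (intro entropy_regroup) (simp_all add: dims)
    ultimately show ?thesis by simp
  qed
  define fA where "fA i = entropy (ptr d1 m1 1 (A i)) - entropy (apply_mid d1 F 1 (A i))" for i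
  define fB where "fB i = entropy (ptr d2 m2 1 (B i)) - entropy (apply_mid d2 G 1 (B i))" for i
  have "ensemble_value (d1 * d2) (F \<otimes>\<^sub>o G) (N1 * N2) p R = entropy (app F ?MA) + entropy (app G ?MB) +
      (\<Sum>i<N1 * N2. p i * (fA (i div N2) + fB (i mod N2)))"
    unfolding ensemble_value_eq[OF channel_tensor[OF F(1) G(1)] R'] dim_tensor m1_def[symmetric] m2_def[symmetric] out
    by (simp add: gain fA_def fB_def del: One_nat_def)
  also have "\<dots> = v1 + v2"
    unfolding sp[of fA fB] unfolding v1[symmetric] v2[symmetric] ensemble_value_eq[OF F(1) A] ensemble_value_eq[OF G(1) B]
      m1_def[symmetric] m2_def[symmetric] fA_def fB_def by simp
  finally show ?thesis unfolding achievable_def using pd R' by blast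
qed

lemma state_one: "state 1 (1\<^sub>m 1)"
proof -
  have "pos_semidef 1 (1\<^sub>m 1)"
    by (rule gram_pos_semidef[where K = "{()}" and g = "\<lambda>_ _. 1"]) auto
  then show ?thesis by (simp add: state_def mat_trace_def)
qed

text \<open>
  The start of the induction over tensor powers.\<close>

lemma achievable_id: "achievable 1 (id_op 1) 0"
proof -
  have s: "\<forall>i<1. state (1 * dim_in (id_op 1)) ((\<lambda>_. 1\<^sub>m 1) i)" using state_one by simp
  have p: "prob_dist 1 (\<lambda>_. 1)" by (simp add: prob_dist_def)
  have "state 1 (mixture 1 1 (\<lambda>_. 1) (\<lambda>i. ptr 1 1 1 (1\<^sub>m 1)))"
    using state_ptr[of 1 1 1 "1\<^sub>m 1"] state_one by (intro state_mixture[OF p]) simp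
  then have v: "ensemble_value 1 (id_op 1) 1 (\<lambda>_. 1) (\<lambda>_. 1\<^sub>m 1) = 0"
    using ensemble_value_eq[OF channel_id[of 1] s, of "\<lambda>_. 1"]
      state_app[OF channel_id[of 1]] state_ptr[of 1 1 1 "1\<^sub>m 1"] state_apply_mid[OF channel_id[of 1], of 1 1 "1\<^sub>m 1"] state_one
    by (simp add: entropy_trivial del: One_nat_def)
  show ?thesis unfolding achievable_def
    by (intro exI[of _ 1] exI[of _ "\<lambda>_. 1"] exI[of _ "\<lambda>_. 1\<^sub>m 1"] conjI p s v)
qed

lemma achievable_tensor_power:
  assumes F: "channel F" "achievable d F v"
  shows "channel (tensor_power F k) \<and> achievable (d ^ k) (tensor_power F k) (real k * v)"
proof (induction k)
  case 0
  then show ?case using channel_id[of 1] achievable_id by simp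
next
  case (Suc k)
  then show ?case
    using achievable_tensor[of "tensor_power F k" "d ^ k" "real k * v" F d v] channel_tensor[of "tensor_power F k" F] F
    by (simp add: algebra_simps)
qed

section \<open>Shifted maximally entangled states\<close>

text \<open>
  The maximally entangled unit vector of \<open>\<complex>\<^sup>d \<otimes> \<complex>\<^sup>n\<close> that pairs level \<open>i < d\<close> with level
  \<open>i + t\<close> modulo \<open>n\<close>.\<close>

definition entangled_vec :: "nat \<Rightarrow> nat \<Rightarrow> nat \<Rightarrow> nat \<Rightarrow> complex" where
  "entangled_vec d n t p = (if p mod n = (p div n + t) mod n then complex_of_real (1 / sqrt (real d)) else 0)"

definition entangled_state :: "nat \<Rightarrow> nat \<Rightarrow> nat \<Rightarrow> complex mat" where
  "entangled_state d n t = mat (d * n) (d * n) (\<lambda>(p, q). entangled_vec d n t p * cnj (entangled_vec d n t q))"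

definition max_mixed :: "nat \<Rightarrow> complex mat" where
  "max_mixed n = complex_of_real (1 / real n) \<cdot>\<^sub>m 1\<^sub>m n"

lemma max_mixed_carrier [simp]: "max_mixed n \<in> carrier_mat n n"
  by (simp add: max_mixed_def)

lemma max_mixed_index: "i < n \<Longrightarrow> j < n \<Longrightarrow> max_mixed n $$ (i, j) = (if i = j then complex_of_real (1 / real n) else 0)"
  by (simp add: max_mixed_def)

lemma entangled_vec_pair:
  "b < n \<Longrightarrow> entangled_vec d n t (i * n + b) = (if b = (i + t) mod n then complex_of_real (1 / sqrt (real d)) else 0)"
  by (simp add: entangled_vec_def)

lemma entangled_vec_overlap:
  assumes "d > 0" "n > 0"
  shows "(\<Sum>b<n. entangled_vec d n t (i * n + b) * cnj (entangled_vec d n t (j * n + b))) =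
    (if (i + t) mod n = (j + t) mod n then complex_of_real (1 / real d) else 0)"
proof -
  have "(\<Sum>b<n. entangled_vec d n t (i * n + b) * cnj (entangled_vec d n t (j * n + b))) =
      (\<Sum>b<n. if b = (i + t) mod n then
        (if (i + t) mod n = (j + t) mod n then complex_of_real (1 / real d) else 0) else 0)"
    using assms by (intro sum.cong refl) (auto simp: entangled_vec_pair simp flip: of_real_mult)
  then show ?thesis using assms by simp
qed

lemma entangled_vec_norm:
  assumes "d > 0" "n > 0"
  shows "(\<Sum>p<d * n. entangled_vec d n t p * cnj (entangled_vec d n t p)) = 1"
  using assms by (simp add: sum_pair entangled_vec_overlap)

lemma eigenfamily_entangled_state:
  assumes "d > 0" "n > 0"
  shows "eigenfamily (d * n) (entangled_state d n t) {()} (\<lambda>_. 1) (\<lambda>_. entangled_vec d n t)"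
  by (rule eigenfamilyI) (simp_all add: entangled_state_def entangled_vec_norm[OF assms])

lemma state_entangled_state:
  assumes "d > 0" "n > 0"
  shows "state (d * n) (entangled_state d n t)"
  using eigenfamily_pos_semidef[OF eigenfamily_entangled_state[OF assms]] entangled_vec_norm[OF assms]
  by (simp add: state_def mat_trace_def entangled_state_def)

lemma entropy_entangled_state:
  assumes "d > 0" "n > 0"
  shows "entropy (entangled_state d n t) = 0"
  using entropy_eigenfamily[OF eigenfamily_entangled_state[OF assms]] by simp

lemma add_mod_inj:
  assumes "(i + t) mod n = (j + t) mod n" "i < n" "j < n"
  shows "i = (j :: nat)"
proof -
  have "b = a" if "a \<le> b" "(b + t) mod n = (a + t) mod n" "b < n" for a b
    using mod_eq_dvd_iff_nat[of "a + t" "b + t" n] that by (auto dest: dvd_imp_le)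
  then show ?thesis using assms by (metis nat_le_linear)
qed

lemma ptr_entangled_state:
  assumes "0 < d" "d \<le> n"
  shows "ptr d n 1 (entangled_state d n t) = max_mixed d"
proof (rule eq_matI)
  fix i j assume "i < dim_row (max_mixed d)" "j < dim_col (max_mixed d)"
  then have ij: "i < d" "j < d" by (auto simp: max_mixed_def)
  then have "(i + t) mod n = (j + t) mod n \<longleftrightarrow> i = j" using add_mod_inj[of i t n j] assms by auto
  moreover have "ptr d n 1 (entangled_state d n t) $$ (i, j) =
      (\<Sum>b<n. entangled_vec d n t (i * n + b) * cnj (entangled_vec d n t (j * n + b)))"
    using ptr_index[of i d 0 1 j 0 n "entangled_state d n t"] ij by (simp add: entangled_state_def pair_less)
  ultimately show "ptr d n 1 (entangled_state d n t) $$ (i, j) = (max_mixed d) $$ (i, j)"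
    using ij assms entangled_vec_overlap[of d n t i j] by (simp add: max_mixed_index)
qed (use ptr_carrier[of d n 1] in \<open>auto simp: max_mixed_def\<close>)

lemma sum_shift:
  fixes i n :: nat
  assumes "n > 0"
  shows "(\<Sum>t<n. f ((i + t) mod n)) = (\<Sum>b<n. f b)"
proof -
  have inj: "inj_on (\<lambda>t. (i + t) mod n) {..<n}"
    by (rule inj_onI) (metis add.commute add_mod_inj lessThan_iff)
  moreover have "(\<lambda>t. (i + t) mod n) ` {..<n} \<subseteq> {..<n}" using assms by auto
  ultimately have "(\<lambda>t. (i + t) mod n) ` {..<n} = {..<n}" by (intro endo_inj_surj) auto
  then have "(\<Sum>b<n. f b) = (\<Sum>b\<in>(\<lambda>t. (i + t) mod n) ` {..<n}. f b)" by simp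
  also have "\<dots> = (\<Sum>t<n. f ((i + t) mod n))" by (simp add: sum.reindex[OF inj])
  finally show ?thesis by simp
qed

text \<open>
  For fixed \<open>i\<close> the shifts \<open>i + t\<close> run once through all \<open>n\<close> levels.\<close>

lemma mixture_entangled_state:
  assumes "0 < d" "0 < n"
  shows "mixture n n (\<lambda>_. 1 / real n) (\<lambda>t. ptr 1 d n (entangled_state d n t)) = max_mixed n"
proof (rule eq_matI)
  fix b c assume "b < dim_row (max_mixed n)" "c < dim_col (max_mixed n)"
  then have bc: "b < n" "c < n" by (auto simp: max_mixed_def)
  have e: "ptr 1 d n (entangled_state d n t) $$ (b, c) =
      (\<Sum>i<d. if b = (i + t) mod n then (if b = c then complex_of_real (1 / real d) else 0) else 0)" for t
  proof -
    have "ptr 1 d n (entangled_state d n t) $$ (b, c) =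
        (\<Sum>i<d. entangled_vec d n t (i * n + b) * cnj (entangled_vec d n t (i * n + c)))"
      using ptr_index[of 0 1 b n 0 c d "entangled_state d n t"] bc by (simp add: entangled_state_def pair_less)
    also have "\<dots> = (\<Sum>i<d. if b = (i + t) mod n then (if b = c then complex_of_real (1 / real d) else 0) else 0)"
      using bc assms by (intro sum.cong refl) (auto simp: entangled_vec_pair simp flip: of_real_mult)
    finally show ?thesis .
  qed
  have "(\<Sum>t<n. ptr 1 d n (entangled_state d n t) $$ (b, c)) =
      (\<Sum>i<d. \<Sum>t<n. if b = (i + t) mod n then (if b = c then complex_of_real (1 / real d) else 0) else 0)"
    unfolding e by (rule sum.swap)
  also have "\<dots> = (\<Sum>i<d. if b = c then complex_of_real (1 / real d) else 0)"
    using sum_shift[of n "\<lambda>x. if b = x then (if b = c then complex_of_real (1 / real d) else 0) else 0"] assms bc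
    by simp
  also have "\<dots> = (if b = c then 1 else 0)" using assms by simp
  finally show "mixture n n (\<lambda>_. 1 / real n) (\<lambda>t. ptr 1 d n (entangled_state d n t)) $$ (b, c) =
      (max_mixed n) $$ (b, c)"
    using bc by (simp add: mixture_index max_mixed_index sum_divide_distrib[symmetric])
qed (auto simp: carrier_matD[OF mixture_carrier] max_mixed_def)

lemma diagonalizes_one: "diagonalizes n (complex_of_real c \<cdot>\<^sub>m 1\<^sub>m n) (1\<^sub>m n) (\<lambda>_. c)"
proof -
  have "mat_diag n (\<lambda>_. complex_of_real c) = complex_of_real c \<cdot>\<^sub>m 1\<^sub>m n"
    by (rule eq_matI) (auto simp: mat_diag_def)
  then show ?thesis by (simp add: diagonalizes_def unitary_mat_def)
qed

lemma diagonalizes_max_mixed: "diagonalizes n (max_mixed n) (1\<^sub>m n) (\<lambda>_. 1 / real n)"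
  unfolding max_mixed_def by (rule diagonalizes_one)

lemma entropy_max_mixed: "0 < n \<Longrightarrow> entropy (max_mixed n) = log 2 n"
  unfolding entropy_diagonalizes[OF diagonalizes_max_mixed] by (simp add: ent_term_def log_divide)

lemma state_max_mixed: "0 < n \<Longrightarrow> state n (max_mixed n)"
  using eigenfamily_pos_semidef[OF diagonalizes_eigenfamily[OF diagonalizes_max_mixed], of n]
    diagonalizes_trace[OF diagonalizes_max_mixed, of n]
  by (simp add: state_def)

lemma achievable_entangled_states:
  assumes F: "channel F" "dim_in F = n" and d: "0 < d" "d \<le> n"
    and out: "entropy (app F (max_mixed n)) = w"
    and apply_mid: "\<And>t. entropy (apply_mid d F 1 (entangled_state d n t)) = w'"
  shows "achievable d F (w + log 2 d - w')"
proof -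
  have n: "0 < n" using d by simp
  have st: "\<forall>t<n. state (d * dim_in F) (entangled_state d n t)" using state_entangled_state d n F(2) by simp
  have p: "prob_dist n (\<lambda>_. 1 / real n)" using n by (simp add: prob_dist_def)
  have "ensemble_value d F n (\<lambda>_. 1 / real n) (entangled_state d n) = w + (log 2 d - w')"
    unfolding ensemble_value_eq[OF F(1) st] F(2) mixture_entangled_state[OF d(1) n] out apply_mid
      ptr_entangled_state[OF d] entropy_max_mixed[OF d(1)] using n by simp
  then show ?thesis unfolding achievable_def
    using st p by (intro exI[of _ n] exI[of _ "\<lambda>_. 1 / real n"] exI[of _ "entangled_state d n"]) auto
qed

lemma achievable_erasure:
  assumes q: "0 \<le> q" "q \<le> 1" and d: "0 < d" "d \<le> n"
  shows "achievable d (erasure n q) (q * log 2 (real n * real d))"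
proof -
  have n: "0 < n" using d by simp
  have m: "state (1 * n * 1) (max_mixed n)" using state_max_mixed[OF n] by simp
  have "entropy (app (erasure n q) (max_mixed n)) = q * log 2 n + bin_entropy q"
    using entropy_erasure[OF q m] channel_app[OF channel_erasure[OF q], of "max_mixed n" n]
      entropy_trivial[of "ptr 1 n 1 (max_mixed n)"] state_ptr[OF m] entropy_max_mixed[OF n]
    by simp
  moreover have "entropy (apply_mid d (erasure n q) 1 (entangled_state d n t)) = (1 - q) * log 2 d + bin_entropy q" for t
    using entropy_erasure[OF q, of d n 1 "entangled_state d n t"] state_entangled_state[OF d(1) n]
    by (simp add: entropy_entangled_state[OF d(1) n] ptr_entangled_state[OF d] entropy_max_mixed[OF d(1)] del: One_nat_def)
  ultimately have "achievable d (erasure n q)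
      (q * log 2 n + bin_entropy q + log 2 d - ((1 - q) * log 2 d + bin_entropy q))"
    using d by (intro achievable_entangled_states channel_erasure[OF q]) auto
  then show ?thesis using n d by (simp add: log_mult algebra_simps)
qed

section \<open>The depolarizing channel on entangled states\<close>

lemma diagonalizes_add_one:
  assumes "diagonalizes n A U e"
  shows "diagonalizes n (A + complex_of_real c \<cdot>\<^sub>m 1\<^sub>m n) U (\<lambda>k. e k + c)"
proof -
  have U: "U \<in> carrier_mat n n" "unitary_mat n U" using assms by (auto simp: diagonalizes_def unitary_mat_def)
  have "mat_diag n (\<lambda>i. complex_of_real (e i + c)) =
      mat_diag n (\<lambda>i. complex_of_real (e i)) + complex_of_real c \<cdot>\<^sub>m 1\<^sub>m n"
    by (rule eq_matI) (auto simp: mat_diag_def)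
  then have "U * mat_diag n (\<lambda>i. complex_of_real (e i + c)) * mat_adjoint U =
      U * mat_diag n (\<lambda>i. complex_of_real (e i)) * mat_adjoint U + complex_of_real c \<cdot>\<^sub>m (U * mat_adjoint U)"
    using U by (simp add: mult_add_distrib_mat[of _ n n _ n] add_mult_distrib_mat[of _ n n _ _ n]
        mult_smult_distrib[of _ n n _ n] mult_smult_assoc_mat[of _ n n _ n])
  then show ?thesis using assms U by (simp add: diagonalizes_def unitary_right)
qed

lemma ent_term_eq_0: "0 \<le> x \<Longrightarrow> x \<le> 1 \<Longrightarrow> ent_term x = 0 \<Longrightarrow> x = 0 \<or> x = 1"
  by (cases "x = 0") (auto simp: ent_term_def log_def)

text \<open>Entropy zero forces every eigenvalue to be 0 or 1, and the trace leaves a single 1.\<close>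

lemma sum_pure_spectrum:
  assumes X: "state n X" and U: "diagonalizes n X U e" and S: "entropy X = 0"
  shows "(\<Sum>k<n. f (e k)) = f 1 + real (n - 1) * f (0 :: real)"
proof -
  have e: "0 \<le> e k" if "k < n" for k
    using pos_semidef_eigenvalues_nonneg[OF _ U that] X by (simp add: state_def)
  have "complex_of_real (\<Sum>k<n. e k) = 1" using diagonalizes_trace[OF U] X by (simp add: state_def)
  then have s: "(\<Sum>k<n. e k) = 1" using of_real_eq_1_iff by blast
  have le: "e k \<le> 1" if "k < n" for k
    using member_le_sum[of k "{..<n}" e] e that s by auto
  have "ent_term (e k) = 0" if "k < n" for k
    using S that sum_nonneg_eq_0_iff[of "{..<n}" "\<lambda>k. ent_term (e k)"] ent_term_nonneg e le
    unfolding entropy_diagonalizes[OF U] by auto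
  then have "f (e k) = e k * f 1 + (1 - e k) * f 0" if "k < n" for k
    using ent_term_eq_0[OF e[OF that] le[OF that]] that by auto
  then have "(\<Sum>k<n. f (e k)) = (\<Sum>k<n. e k * f 1 + (1 - e k) * f 0)" by simp
  also have "\<dots> = (\<Sum>k<n. e k) * f 1 + (real n - (\<Sum>k<n. e k)) * f 0"
    by (simp add: sum.distrib sum_distrib_right left_diff_distrib sum_subtractf)
  also have "\<dots> = f 1 + real (n - 1) * f 0" using s by (cases n) auto
  finally show ?thesis .
qed

lemma amp_smult_one: "amp r m s (c \<cdot>\<^sub>m 1\<^sub>m (r * s)) = c \<cdot>\<^sub>m 1\<^sub>m (r * m * s)"
proof -
  have "c \<cdot>\<^sub>m 1\<^sub>m k = mat_diag k (\<lambda>_. c)" for k by (rule eq_matI) (auto simp: mat_diag_def)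
  then show ?thesis by (simp add: amp_diag)
qed

text \<open>
  The noise adds a multiple of the identity to a multiple of a pure state, so all but one
  of the eigenvalues are equal.\<close>

lemma entropy_depolarized_entangled_state:
  assumes d: "0 < d" "d \<le> n"
  shows "entropy (apply_mid d (depolarizing n q) 1 (entangled_state d n t)) =
    ent_term (q + (1 - q) / (real n * real d)) + real (d * n - 1) * ent_term ((1 - q) / (real n * real d))"
proof -
  have n: "0 < n" using d by simp
  have st: "state (d * n) (entangled_state d n t)" by (rule state_entangled_state[OF d(1) n])
  obtain U e where U: "diagonalizes (d * n) (entangled_state d n t) U e" using state_diagonalizes[OF st] by metis
  let ?c = "(1 - q) / (real n * real d)"
  have amp: "amp d n 1 (ptr d n 1 (entangled_state d n t)) = complex_of_real (1 / real d) \<cdot>\<^sub>m 1\<^sub>m (d * n)"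
    using amp_smult_one[of d n 1] unfolding ptr_entangled_state[OF d] max_mixed_def by simp
  have "apply_mid d (depolarizing n q) 1 (entangled_state d n t) =
      complex_of_real q \<cdot>\<^sub>m entangled_state d n t
        + complex_of_real (1 - q) \<cdot>\<^sub>m (complex_of_real (1 / real n) \<cdot>\<^sub>m (complex_of_real (1 / real d) \<cdot>\<^sub>m 1\<^sub>m (d * n)))"
    unfolding amp[symmetric] using state_carrier[OF st] by (intro apply_mid_depolarizing) simp
  also have "\<dots> = complex_of_real q \<cdot>\<^sub>m entangled_state d n t + complex_of_real ?c \<cdot>\<^sub>m 1\<^sub>m (d * n)"
    by (intro eq_matI) (auto simp: mult.commute)
  finally have "apply_mid d (depolarizing n q) 1 (entangled_state d n t) =
      complex_of_real q \<cdot>\<^sub>m entangled_state d n t + complex_of_real ?c \<cdot>\<^sub>m 1\<^sub>m (d * n)" .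
  then have "entropy (apply_mid d (depolarizing n q) 1 (entangled_state d n t)) = (\<Sum>k<d * n. ent_term (q * e k + ?c))"
    by (simp only: entropy_diagonalizes[OF diagonalizes_add_one[OF diagonalizes_smult[OF U]]])
  also have "\<dots> = ent_term (q * 1 + ?c) + real (d * n - 1) * ent_term (q * 0 + ?c)"
    by (rule sum_pure_spectrum[OF st U entropy_entangled_state[OF d(1) n], of "\<lambda>x. ent_term (q * x + ?c)"])
  finally show ?thesis by simp
qed

lemma depolarizing_max_mixed:
  assumes "0 < n"
  shows "app (depolarizing n q) (max_mixed n) = max_mixed n"
  using assms state_max_mixed[OF assms] unfolding state_def
  by (auto simp: depolarizing_def max_mixed_def field_simps intro!: eq_matI)

text \<open>
  With \<open>K = n d\<close> the ensemble of shifts has value \<open>log K - H(\<mu>) - (1 - \<mu>) log (K - 1)\<close>, and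
  \<open>1 - \<mu> \<le> 1 - q\<close>.\<close>

lemma C_prod_depolarizing_lower:
  assumes q: "0 \<le> q" "q \<le> 1" and d: "0 < d" "d \<le> n" and \<mu>: "\<mu> = q + (1 - q) / (real n * real d)"
  shows "ereal (q * log 2 (real n * real d) - bin_entropy \<mu>) \<le> C_prod d (depolarizing n q)"
proof -
  have n: "0 < n" using d by simp
  define K where "K = real n * real d"
  define c where "c = (1 - q) / K"
  have K: "1 \<le> K" using n d unfolding K_def
    by (metis One_nat_def Suc_leI mult_pos_pos of_nat_1 of_nat_le_iff of_nat_mult)
  have c0: "0 \<le> c" using q K by (simp add: c_def)
  have \<mu>1: "1 - \<mu> = (K - 1) * c" using K unfolding \<mu> K_def[symmetric] c_def by (simp add: field_simps)
  have k1: "real (d * n - 1) = K - 1"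
    using n d by (simp add: K_def of_nat_diff mult.commute Suc_leI)
  \<comment> \<open>The \<open>K - 1\<close> small eigenvalues carry total weight \<open>1 - \<mu> \<le> 1 - q\<close>.\<close>
  have small: "(K - 1) * ent_term c \<le> ent_term (1 - \<mu>) + (1 - q) * log 2 K"
  proof (cases "K = 1 \<or> c = 0")
    case True
    then show ?thesis using q K \<mu>1 by auto
  next
    case False
    then have p: "1 < K" "0 < c" using K c0 by auto
    have "(K - 1) * ent_term c = ent_term (1 - \<mu>) + (K - 1) * c * log 2 (K - 1)"
    proof -
      have "log 2 ((K - 1) * c) = log 2 (K - 1) + log 2 c" using p by (simp add: log_mult)
      then show ?thesis unfolding \<mu>1 ent_term_def by (simp add: distrib_left mult.assoc)
    qed
    also have "(K - 1) * c * log 2 (K - 1) \<le> (1 - q) * log 2 K"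
    proof (cases "2 \<le> K")
      case True
      have "(K - 1) * c \<le> 1 - q" using K q c0 by (simp add: c_def field_simps)
      moreover have "0 \<le> log 2 (K - 1)" "log 2 (K - 1) \<le> log 2 K" using True by auto
      ultimately show ?thesis using q by (intro mult_mono) auto
    next
      case False
      then have "(K - 1) * c * log 2 (K - 1) \<le> 0"
        using p by (intro mult_nonneg_nonpos) auto
      also have "0 \<le> (1 - q) * log 2 K" using q K by simp
      finally show ?thesis .
    qed
    finally show ?thesis by simp
  qed
  have out: "entropy (app (depolarizing n q) (max_mixed n)) = log 2 n"
    unfolding depolarizing_max_mixed[OF n] by (rule entropy_max_mixed[OF n])
  have "achievable d (depolarizing n q) (log 2 n + log 2 d - (ent_term \<mu> + (K - 1) * ent_term c))"
    using entropy_depolarized_entangled_state[OF d, of q] d out unfolding k1 K_def[symmetric] c_def[symmetric]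
      \<mu>[unfolded K_def[symmetric] c_def[symmetric], symmetric]
    by (intro achievable_entangled_states channel_depolarizing[OF q n]) auto
  then have "ereal (log 2 n + log 2 d - (ent_term \<mu> + (K - 1) * ent_term c)) \<le> C_prod d (depolarizing n q)"
    by (rule achievable_le_C_prod)
  moreover have "log 2 n + log 2 d = log 2 K" using n d by (simp add: K_def log_mult)
  ultimately show ?thesis
    using small unfolding bin_entropy_eq K_def[symmetric]
    by (elim order_trans[rotated]) (simp add: algebra_simps)
qed

section \<open>The two capacities\<close>

lemma bin_entropy_le_1:
  assumes "0 \<le> \<mu>" "\<mu> \<le> 1"
  shows "bin_entropy \<mu> \<le> 1"
proof -
  have "ln 2 * bin_entropy \<mu> \<le> ln 2 * 1"
    using ent_term_tangent[of \<mu> "1 / 2"] ent_term_tangent[of "1 - \<mu>" "1 / 2"] assms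
    by (simp add: bin_entropy_eq ln_div algebra_simps)
  then show ?thesis by simp
qed

lemma C_reg_eq:
  assumes "\<And>k. 1 \<le> k \<Longrightarrow> C_prod (d ^ k) (tensor_power F k) = ereal (real k * v)"
  shows "C_reg d F = ereal v"
proof -
  have "C_prod (d ^ k) (tensor_power F k) / ereal (real k) = ereal v" if "k \<in> {1..}" for k
    using assms[of k] that by simp
  then have "C_reg d F = (SUP k\<in>{1::nat..}. ereal v)" unfolding C_reg_def by (intro SUP_cong) auto
  then show ?thesis by simp
qed

text \<open>
  The first tensor power is \<open>id\<^sub>1 \<otimes> F\<close> rather than \<open>F\<close> itself; the product ensemble construction
  covers the difference.\<close>

lemma C_prod_le_C_reg:
  assumes F: "channel F"
  shows "C_prod d F \<le> C_reg d F"
proof -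
  have "C_prod d F \<le> C_prod (d ^ 1) (tensor_power F 1)"
  proof (rule C_prod_le)
    fix v assume "achievable d F v"
    then show "ereal v \<le> C_prod (d ^ 1) (tensor_power F 1)"
      using achievable_tensor_power[OF F, of d v 1] achievable_le_C_prod by fastforce
  qed
  also have "\<dots> = C_prod (d ^ 1) (tensor_power F 1) / ereal (real 1)" by (simp flip: one_ereal_def)
  also have "\<dots> \<le> C_reg d F" unfolding C_reg_def by (rule SUP_upper) simp
  finally show ?thesis .
qed

lemma C_prod_tensor_power_upper:
  assumes F: "channel F" "noisy F q c" "output_bound F u" and q: "0 \<le> q" "q \<le> 1" and d: "0 < d"
  shows "C_prod (d ^ k) (tensor_power F k) \<le> ereal (real k * (u - c + q * log 2 d))"
proof -
  have "C_prod (d ^ k) (tensor_power F k) \<le> ereal (real k * u - real k * c + q * log 2 (real (d ^ k)))"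
    using tensor_power_estimates[OF F q, of k] by (intro C_prod_upper_bound[OF _ _ _ q]) auto
  then show ?thesis using d by (simp add: log_nat_power algebra_simps)
qed

theorem theorem1p6:
  fixes n d :: nat and q \<mu> :: real
  assumes "1 \<le> d" and "d \<le> n" and "0 \<le> q" and "q \<le> 1"
    and "\<mu> = q + (1 - q) / (real n * real d)"
  shows "ereal (q * log 2 (real n * real d) - bin_entropy \<mu>) \<le> C_prod d (depolarizing n q)
    \<and> C_prod d (depolarizing n q) \<le> C_reg d (depolarizing n q)
    \<and> C_reg d (depolarizing n q) \<le> ereal (q * log 2 (real n * real d))
    \<and> ereal (q * log 2 (real n * real d) - 1) \<le> C_prod d (depolarizing n q)
    \<and> (\<forall>k\<ge>1. C_prod (d ^ k) (tensor_power (erasure n q) k)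
                 = ereal (real k) * C_prod d (erasure n q)
             \<and> ereal (real k) * C_prod d (erasure n q)
                 = ereal (real k * q * log 2 (real n * real d)))
    \<and> C_reg d (erasure n q) = ereal (q * log 2 (real n * real d))"
proof -
  have d: "0 < d" "d \<le> n" and n: "0 < n" and q: "0 \<le> q" "q \<le> 1" using assms by auto
  define L where "L = log 2 (real n * real d)"
  have L: "log 2 n + log 2 d = L" using d n by (simp add: L_def log_mult)
  have K: "1 \<le> real n * real d" using n d
    by (metis One_nat_def Suc_leI mult_pos_pos of_nat_1 of_nat_le_iff of_nat_mult)
  have "(1 - q) * 1 \<le> (1 - q) * (real n * real d)" using q K by (intro mult_left_mono) auto
  then have "(1 - q) / (real n * real d) \<le> 1 - q" using K by (simp add: divide_le_eq)
  then have \<mu>: "0 \<le> \<mu>" "\<mu> \<le> 1" using assms(5) q K by auto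
  note low = C_prod_depolarizing_lower[OF q d assms(5)]
  have low1: "ereal (q * log 2 (real n * real d) - 1) \<le> C_prod d (depolarizing n q)"
    using low bin_entropy_le_1[OF \<mu>] by (elim order_trans[rotated]) simp
  have up: "C_reg d (depolarizing n q) \<le> ereal (q * L)"
    unfolding C_reg_def
  proof (rule SUP_least)
    fix k :: nat assume k: "k \<in> {1..}"
    have "C_prod (d ^ k) (tensor_power (depolarizing n q) k) \<le>
        ereal (real k * (log 2 n - (1 - q) * log 2 n + q * log 2 d))"
      by (rule C_prod_tensor_power_upper[OF channel_depolarizing[OF q n] noisy_depolarizing[OF q n]
            output_bound_depolarizing[OF q n] q d(1)])
    also have "log 2 n - (1 - q) * log 2 n + q * log 2 d = q * L" unfolding L[symmetric] by (simp add: algebra_simps)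
    finally show "C_prod (d ^ k) (tensor_power (depolarizing n q) k) / ereal (real k) \<le> ereal (q * L)"
      using k by (subst ereal_divide_le_pos) (auto simp: mult.commute)
  qed
  have Ek: "C_prod (d ^ k) (tensor_power (erasure n q) k) = ereal (real k * (q * L))" for k
  proof (rule antisym)
    have "C_prod (d ^ k) (tensor_power (erasure n q) k) \<le>
        ereal (real k * (bin_entropy q + q * log 2 n - bin_entropy q + q * log 2 d))"
      by (rule C_prod_tensor_power_upper[OF channel_erasure[OF q] noisy_erasure[OF q]
            output_bound_erasure[OF q] q d(1)])
    also have "bin_entropy q + q * log 2 n - bin_entropy q + q * log 2 d = q * L"
      unfolding L[symmetric] by (simp add: algebra_simps)
    finally show "C_prod (d ^ k) (tensor_power (erasure n q) k) \<le> ereal (real k * (q * L))" .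
    show "ereal (real k * (q * L)) \<le> C_prod (d ^ k) (tensor_power (erasure n q) k)"
      using achievable_tensor_power[OF channel_erasure[OF q] achievable_erasure[OF q d], of k]
        achievable_le_C_prod unfolding L_def by blast
  qed
  have E: "C_prod d (erasure n q) = ereal (q * L)"
  proof (rule antisym)
    show "C_prod d (erasure n q) \<le> ereal (q * L)"
      using C_prod_upper_bound[OF channel_erasure[OF q] noisy_erasure[OF q] output_bound_erasure[OF q] q, of d n]
      unfolding L[symmetric] by (simp add: algebra_simps)
    show "ereal (q * L) \<le> C_prod d (erasure n q)"
      unfolding L_def by (rule achievable_le_C_prod[OF achievable_erasure[OF q d]])
  qed
  have "C_reg d (erasure n q) = ereal (q * L)" by (rule C_reg_eq) (rule Ek)
  then show ?thesis
    using low low1 up C_prod_le_C_reg[OF channel_depolarizing[OF q n], of d] Ek E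
    unfolding L_def by (simp add: mult.assoc)
qed

end
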